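(* The variety $\hat{G}_2$ is a flat deformation of $G_2$.
   Context: We work over $\mathbb{C}$. Let $V$ be a 7-dimensional vector space. A four-form in $\bigwedge^4V$ is non-degenerate if it lies in the open orbit of the natural action of $\mathrm{GL}(V)=\mathrm{GL}(7)$ on $\bigwedge^4V$. For $\omega\in\bigwedge^4V$ put $G(\omega)=\{[v_1\wedge v_2]\in G(2,V) : v_1\wedge v_2\wedge\omega=0\in\bigwedge^6V\}$, considered in its linear span in $\mathbb{P}(\bigwedge^2V)$. The variety $G_2$ (the adjoint variety of the complex simple Lie group $\mathbb{G}_2$) is $G(\omega)\subset\mathbb{P}^{13}$ for a non-degenerate $\omega$. The variety $\hat{G}_2$ is $G(\omega_0)\subset\mathbb{P}^{13}$, where, for a basis $x_1,\dots,x_7$ of $V$, $\omega_0= x_1\wedge x_2 \wedge x_3 \wedge x_7+x_4\wedge x_5 \wedge x_6 \wedge x_7 + x_2\wedge x_3 \wedge x_5 \wedge x_6 + x_1\wedge x_3 \wedge x_4 \wedge x_6$. A variety $X\subset\mathbb{P}^{13}$ is called a flat deformation (flat degeneration) of $Y\subset\mathbb{P}^{13}$ if there is a flat family of subschemes of $\mathbb{P}^{13}$ over a smooth connected curve with one fiber equal to $X$ and all other fibers projectively isomorphic to $Y$. *)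

theory Defs
  imports
    "HOL-Analysis.Analysis"
    "HOL-Library.Poly_Mapping"
    "HOL-Algebra.Free_Abelian_Groups"
    "HOL-Algebra.Module"
    "HOL-Algebra.QuotRing"
begin

section \<open>The exterior algebra of a coordinate space\<close>

text \<open>
  The exterior algebra of \<open>\<complex>^'m\<close> has the basis \<open>e\<^sub>S\<close>, where \<open>S\<close> runs over the subsets of the
  linearly ordered index type and \<open>e\<^sub>S\<close> is the wedge product of the \<open>e\<^sub>i\<close>, \<open>i \<in> S\<close>, in increasing
  order. An element is the vector of its coefficients. The sign in the product counts the
  inversions needed to sort the concatenation of \<open>T\<close> and \<open>S - T\<close>.
\<close>

type_synonym 'm ext = "complex ^ ('m set)"

definition wedge :: "'m::{finite,linorder} ext \<Rightarrow> 'm ext \<Rightarrow> 'm ext"  (infixr "\<^bold>\<and>" 70)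
  where "\<alpha> \<^bold>\<and> \<beta> =
    (\<chi> S. \<Sum>T\<in>Pow S. (-1) ^ card {(i, j). i \<in> T \<and> j \<in> S - T \<and> j < i} * \<alpha> $ T * \<beta> $ (S - T))"

definition ext_one :: "'m::finite ext"
  where "ext_one = axis {} 1"

definition ext_vec :: "complex ^ 'm::finite \<Rightarrow> 'm ext"
  where "ext_vec v = (\<Sum>i\<in>UNIV. v $ i *s axis {i} 1)"

definition wedge_list :: "(complex ^ 'm::{finite,linorder}) list \<Rightarrow> 'm ext"
  where "wedge_list vs = foldr (\<lambda>v \<alpha>. ext_vec v \<^bold>\<and> \<alpha>) vs ext_one"

definition ext_power :: "nat \<Rightarrow> 'm::finite ext set"
  where "ext_power k = {\<alpha>. \<forall>S. card S \<noteq> k \<longrightarrow> \<alpha> $ S = 0}"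

definition ext_map :: "complex ^ 'm::{finite,linorder} ^ 'm::{finite,linorder} \<Rightarrow> 'm ext \<Rightarrow> 'm ext"
  where "ext_map g \<alpha> =
    (\<Sum>S\<in>UNIV. \<alpha> $ S *s wedge_list (map (\<lambda>i. g *v axis i 1) (sorted_list_of_set S)))"


section \<open>Polynomials in several variables\<close>

type_synonym ('v, 'a) mpoly = "('v \<Rightarrow>\<^sub>0 nat) \<Rightarrow>\<^sub>0 'a"

definition mpoly_const :: "'a::comm_ring_1 \<Rightarrow> ('v, 'a) mpoly"
  where "mpoly_const a = Poly_Mapping.single 0 a"

definition mpoly_var :: "'v \<Rightarrow> ('v, 'a::comm_ring_1) mpoly"
  where "mpoly_var i = Poly_Mapping.single (Poly_Mapping.single i 1) 1"

definition mpoly_eval :: "('v \<Rightarrow> 'a) \<Rightarrow> ('v, 'a::comm_ring_1) mpoly \<Rightarrow> 'a"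
  where "mpoly_eval c f =
    (\<Sum>m\<in>Poly_Mapping.keys f. Poly_Mapping.lookup f m *
       (\<Prod>i\<in>Poly_Mapping.keys m. c i ^ Poly_Mapping.lookup m i))"

definition homogeneous :: "('v, 'a::comm_ring_1) mpoly \<Rightarrow> bool"
  where "homogeneous f \<longleftrightarrow>
    (\<exists>d. \<forall>m\<in>Poly_Mapping.keys f. (\<Sum>i\<in>Poly_Mapping.keys m. Poly_Mapping.lookup m i) = d)"

definition mpoly_ring :: "('v, 'a::comm_ring_1) mpoly ring"
  where "mpoly_ring =
    \<lparr>carrier = UNIV, monoid.mult = (*), one = 1, ring.zero = 0, add = (+)\<rparr>"

definition homogeneous_ideal :: "('v, 'a::comm_ring_1) mpoly set \<Rightarrow> bool"
  where "homogeneous_ideal I \<longleftrightarrow>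
    ideal I mpoly_ring \<and> I = genideal mpoly_ring {f \<in> I. homogeneous f}"


section \<open>Non-degenerate four-forms and the varieties in question\<close>

definition zariski_open_in :: "(complex ^ 'k::finite) set \<Rightarrow> (complex ^ 'k) set \<Rightarrow> bool"
  where "zariski_open_in W U \<longleftrightarrow>
    (\<exists>F. U = {v \<in> W. \<exists>f\<in>F. mpoly_eval (\<lambda>i. v $ i) f \<noteq> 0})"

definition nondegenerate :: "7 ext \<Rightarrow> bool"
  where "nondegenerate \<omega> \<longleftrightarrow> \<omega> \<in> ext_power 4 \<and>
    zariski_open_in (ext_power 4) {ext_map g \<omega> | g. invertible g}"

text \<open>
  A subset of a projective space is represented by the set of all non-zero vectors
  whose classes belong to it.
\<close>

definition G_var :: "7 ext \<Rightarrow> 7 ext set"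
  where "G_var \<omega> =
    {\<alpha>. \<alpha> \<noteq> 0 \<and> (\<exists>v\<^sub>1 v\<^sub>2. \<alpha> = ext_vec v\<^sub>1 \<^bold>\<and> ext_vec v\<^sub>2) \<and> \<alpha> \<^bold>\<and> \<omega> = 0}"

definition is_basis :: "(nat \<Rightarrow> complex ^ 7) \<Rightarrow> bool"
  where "is_basis x \<longleftrightarrow>
    inj_on x {1..7} \<and> vec.independent (x ` {1..7}) \<and> vec.span (x ` {1..7}) = UNIV"

definition omega0 :: "(nat \<Rightarrow> complex ^ 7) \<Rightarrow> 7 ext"
  where "omega0 x =
    wedge_list [x 1, x 2, x 3, x 7] + wedge_list [x 4, x 5, x 6, x 7] +
    wedge_list [x 2, x 3, x 5, x 6] + wedge_list [x 1, x 3, x 4, x 6]"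

text \<open>
  A matrix \<open>M\<close> with this property is a choice of homogeneous coordinates on the linear span
  of the projective set \<open>X\<close>; in these coordinates \<open>X\<close> becomes the preimage of \<open>X\<close> under \<open>M\<close>.
\<close>

definition coordinates_of_span :: "complex ^ 'n::finite ^ 'k::finite \<Rightarrow> (complex ^ 'k) set \<Rightarrow> bool"
  where "coordinates_of_span M X \<longleftrightarrow> inj ((*v) M) \<and> range ((*v) M) = vec.span X"


section \<open>Flat modules\<close>

text \<open>
  The tensor product of \<open>J\<close> and \<open>M\<close> over \<open>R\<close> is the free abelian group on \<open>J \<times> M\<close> modulo the
  subgroup \<open>tensor_relations R J M\<close>. As one cannot quantify over all modules inside HOL, flatness
  is expressed by the injectivity of the canonical maps from \<open>J \<otimes>\<^sub>R M\<close> to \<open>M\<close> for all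
  ideals \<open>J\<close> of \<open>R\<close>.
\<close>

definition tensor_relations ::
    "('a, 'c) ring_scheme \<Rightarrow> 'a set \<Rightarrow> ('a, 'b, 'd) module_scheme \<Rightarrow> (('a \<times> 'b) \<Rightarrow>\<^sub>0 int) set"
  where "tensor_relations R J M =
    generate (free_Abelian_group (J \<times> carrier M))
      ({frag_of (a \<oplus>\<^bsub>R\<^esub> b, m) - frag_of (a, m) - frag_of (b, m) | a b m.
          a \<in> J \<and> b \<in> J \<and> m \<in> carrier M} \<union>
       {frag_of (a, m \<oplus>\<^bsub>M\<^esub> n) - frag_of (a, m) - frag_of (a, n) | a m n.
          a \<in> J \<and> m \<in> carrier M \<and> n \<in> carrier M} \<union>
       {frag_of (r \<otimes>\<^bsub>R\<^esub> a, m) - frag_of (a, r \<odot>\<^bsub>M\<^esub> m) | r a m.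
          r \<in> carrier R \<and> a \<in> J \<and> m \<in> carrier M})"

definition flat_module :: "('a, 'c) ring_scheme \<Rightarrow> ('a, 'b, 'd) module_scheme \<Rightarrow> bool"
  where "flat_module R M \<longleftrightarrow> Module.module R M \<and>
    (\<forall>J. ideal J R \<longrightarrow>
      (\<forall>t \<in> carrier (free_Abelian_group (J \<times> carrier M)).
        finsum M (\<lambda>(a, m). add_pow M (Poly_Mapping.lookup t (a, m)) (a \<odot>\<^bsub>M\<^esub> m))
          (Poly_Mapping.keys t) = \<zero>\<^bsub>M\<^esub>
        \<longrightarrow> t \<in> tensor_relations R J M))"


section \<open>Smooth affine curves\<close>

text \<open>
  An affine variety with coordinate ring \<open>\<complex>[y\<^sub>0, \<dots>, y\<^sub>n\<^sub>-\<^sub>1] / P'\<close> is given by the ideal \<open>P\<close> of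
  \<open>\<complex>[y\<^sub>0, y\<^sub>1, \<dots>]\<close> generated by \<open>P'\<close> and all the \<open>y\<^sub>i\<close> with \<open>i \<ge> n\<close>: the number \<open>n\<close> is
  arbitrary, and \<open>\<complex>[y\<^sub>0, y\<^sub>1, \<dots>] / P\<close> is the same coordinate ring.
\<close>

type_synonym base_poly = "(nat, complex) mpoly"

definition base_points :: "base_poly set \<Rightarrow> (nat \<Rightarrow> complex) set"
  where "base_points P = {c. \<forall>f\<in>P. mpoly_eval c f = 0}"

text \<open>The Zariski tangent space at \<open>c\<close>, that is, the kernel of the Jacobian matrix.\<close>

definition tangent_space :: "base_poly set \<Rightarrow> (nat \<Rightarrow> complex) \<Rightarrow> (nat \<Rightarrow> complex) set"
  where "tangent_space P c =
    {v. \<forall>f\<in>P. ((\<lambda>s. mpoly_eval (\<lambda>i. c i + s * v i) f) has_field_derivative 0) (at 0)}"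

text \<open>
  A smooth curve is connected if and only if it is integral, whence the prime ideal. The next two
  conditions on \<open>P\<close> say that the quotient ring has Krull dimension one, the last one that
  the tangent space at every point is one-dimensional.
\<close>

definition smooth_connected_curve :: "base_poly set \<Rightarrow> bool"
  where "smooth_connected_curve P \<longleftrightarrow>
    primeideal P mpoly_ring \<and>
    (\<exists>n. \<forall>i\<ge>n. mpoly_var i \<in> P) \<and>
    (\<exists>Q. primeideal Q mpoly_ring \<and> P \<subset> Q) \<and>
    \<not> (\<exists>Q Q'. primeideal Q mpoly_ring \<and> primeideal Q' mpoly_ring \<and> P \<subset> Q \<and> Q \<subset> Q') \<and>
    (\<forall>c \<in> base_points P. \<exists>u. u \<noteq> (\<lambda>_. 0) \<and> tangent_space P c = {\<lambda>i. s * u i | s. True})"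


section \<open>Closed subschemes of projective space and flat families\<close>

text \<open>
  A homogeneous ideal \<open>I\<close> defines a closed subscheme of projective space, whose part in the
  chart \<open>x\<^sub>i \<noteq> 0\<close> is the spectrum of the polynomial ring modulo \<open>chart_ideal I i\<close>.
\<close>

definition chart_ideal :: "('v, 'a::comm_ring_1) mpoly set \<Rightarrow> 'v \<Rightarrow> ('v, 'a) mpoly set"
  where "chart_ideal I i = genideal mpoly_ring (I \<union> {mpoly_var i - 1})"

definition same_subscheme :: "('v, 'a::comm_ring_1) mpoly set \<Rightarrow> ('v, 'a) mpoly set \<Rightarrow> bool"
  where "same_subscheme I J \<longleftrightarrow> (\<forall>i. chart_ideal I i = chart_ideal J i)"

definition vanishing_ideal :: "(complex ^ 'n::finite) set \<Rightarrow> ('n, complex) mpoly set"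
  where "vanishing_ideal X =
    genideal mpoly_ring {f. homogeneous f \<and> (\<forall>v\<in>X. mpoly_eval (\<lambda>i. v $ i) f = 0)}"

text \<open>
  A closed subscheme of \<open>\<P>\<^sup>n\<^sup>-\<^sup>1 \<times> C\<close>, where \<open>C\<close> is the curve defined by \<open>P\<close>, is given by an ideal
  that is homogeneous in the \<open>x\<^sub>i\<close> and contains \<open>P\<close>.
\<close>

definition family_over :: "base_poly set \<Rightarrow> ('n::finite, base_poly) mpoly set \<Rightarrow> bool"
  where "family_over P I \<longleftrightarrow> homogeneous_ideal I \<and> mpoly_const ` P \<subseteq> I"

definition fiber :: "(nat \<Rightarrow> complex) \<Rightarrow> ('n, base_poly) mpoly set \<Rightarrow> ('n, complex) mpoly set"
  where "fiber c I = Poly_Mapping.map (mpoly_eval c) ` I"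

definition quotient_module ::
    "('n, base_poly) mpoly set \<Rightarrow> (base_poly set, ('n, base_poly) mpoly set) module"
  where "quotient_module J =
    \<lparr>carrier = carrier (mpoly_ring Quot J), monoid.mult = monoid.mult (mpoly_ring Quot J),
     one = one (mpoly_ring Quot J), zero = zero (mpoly_ring Quot J),
     add = add (mpoly_ring Quot J),
     smult = (\<lambda>A B. \<Union>a\<in>A. \<Union>f\<in>B. a_r_coset mpoly_ring J (mpoly_const a * f))\<rparr>"

definition flat_family :: "base_poly set \<Rightarrow> ('n::finite, base_poly) mpoly set \<Rightarrow> bool"
  where "flat_family P I \<longleftrightarrow> family_over P I \<and>
    (\<forall>i. flat_module (mpoly_ring Quot P) (quotient_module (chart_ideal I i)))"

text \<open>
  \<open>X\<close> and \<open>Y\<close> are varieties, so they carry the reduced scheme structure. A base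
  curve can be replaced by an affine neighbourhood of the special point, which is again a smooth
  connected curve; so only affine curves are considered.
\<close>

definition flat_deformation :: "(complex ^ 'n::finite) set \<Rightarrow> (complex ^ 'n) set \<Rightarrow> bool"
  where "flat_deformation X Y \<longleftrightarrow>
    (\<exists>P I. \<exists>c\<^sub>0 \<in> base_points P.
      smooth_connected_curve P \<and> flat_family P I \<and>
      same_subscheme (fiber c\<^sub>0 I) (vanishing_ideal X) \<and>
      (\<forall>c \<in> base_points P - {c\<^sub>0}. \<exists>g :: complex ^ 'n ^ 'n. invertible g \<and>
        same_subscheme (fiber c I) (vanishing_ideal ((*v) g ` Y))))"

end

theory Submission
  imports Defs "HOL-Computational_Algebra.Fundamental_Theorem_Algebra"
begin

text \<open>
  The form \<open>\<omega>\<^sub>0\<close> deforms to \<open>\<omega>\<^sub>t = \<omega>\<^sub>0 + t x\<^sub>1 \<and> x\<^sub>2 \<and> x\<^sub>4 \<and> x\<^sub>5\<close>, which for \<open>t \<noteq> 0\<close> lies in the open orbit: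
  a diagonal matrix moves \<open>\<omega>\<^sub>t\<close> to \<open>\<omega>\<^sub>1\<close>, and the tangent space of the orbit of \<open>\<omega>\<^sub>1\<close> is everything.
  The linear span of \<open>G(\<omega>\<^sub>t)\<close> is given by seven equations with coefficients in \<open>\<complex>[t]\<close>, so the
  varieties \<open>G(\<omega>\<^sub>t)\<close> live in one \<open>\<P>\<^sup>1\<^sup>3\<close>. There the Pluecker relations yield 28 quadrics over
  \<open>\<complex>[t]\<close> with constant leading coefficients, by which every polynomial is congruent to a
  combination of standard monomials. For each \<open>t\<close>, including \<open>t = 0\<close>, the standard monomials are
  linearly independent on \<open>G(\<omega>\<^sub>t)\<close>, because their leading terms in a chart are distinct. So they are
  a basis of the coordinate ring of the family over \<open>\<complex>[t]\<close> and of the homogeneous coordinate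
  ring of each \<open>G(\<omega>\<^sub>t)\<close>. Hence the family is torsion-free, therefore flat over the affine
  line, and its fibre over \<open>t\<close> is the reduced scheme \<open>G(\<omega>\<^sub>t)\<close>.
\<close>

section \<open>Polynomials in several variables\<close>

text \<open>The danger in such a family is at \<open>t = 0\<close>: the ideal of all functions
  vanishing on every fibre may restrict there to an ideal smaller than that of the special variety,
  so that the limit is larger or non-reduced. Functions that generate over \<complex>[t] and are
  independent in every single fibre rule this out, and the same two properties give
  torsion-freeness. The locale \<open>based_family\<close> isolates them. Independence has to be
  uniform in \<open>t\<close>. Leading terms are therefore compared by growth: the chart parameters
  run through powers of six distinct primes, so the growth rate of a monomial is an integer whose
  factorization recovers the exponents of the leading term. The primes have such sizes that in no
  coordinate a term with a factor \<open>t\<close> leads. A surjective differential only gives a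
  Euclidean neighbourhood inside the orbit of \<open>\<omega>\<^sub>1\<close>, whereas
  non-degeneracy speaks of Zariski open sets; the two orbits are made to meet on the line joining
  the two forms.\<close>

abbreviation mdeg :: "('v \<Rightarrow>\<^sub>0 nat) \<Rightarrow> nat"
  where "mdeg m \<equiv> (\<Sum>i\<in>Poly_Mapping.keys m. Poly_Mapping.lookup m i)"

definition mon_eval :: "('v \<Rightarrow> 'a) \<Rightarrow> ('v \<Rightarrow>\<^sub>0 nat) \<Rightarrow> 'a::comm_ring_1"
  where "mon_eval c m = (\<Prod>i\<in>Poly_Mapping.keys m. c i ^ Poly_Mapping.lookup m i)"

lemma mon_eval_superset:
  assumes "finite A" "Poly_Mapping.keys m \<subseteq> A"
  shows "mon_eval c m = (\<Prod>i\<in>A. c i ^ Poly_Mapping.lookup m i)"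
  unfolding mon_eval_def
  by (rule prod.mono_neutral_left) (use assms in \<open>auto simp: in_keys_iff\<close>)

lemma mon_eval_0 [simp]: "mon_eval c 0 = 1"
  by (simp add: mon_eval_def)

lemma mon_eval_add: "mon_eval c (m + n) = mon_eval c m * mon_eval c n"
proof -
  let ?A = "Poly_Mapping.keys m \<union> Poly_Mapping.keys n"
  have "mon_eval c (m + n) = (\<Prod>i\<in>?A. c i ^ Poly_Mapping.lookup (m + n) i)"
    by (rule mon_eval_superset) (auto dest: Poly_Mapping.keys_add[THEN subsetD])
  moreover have "mon_eval c m = (\<Prod>i\<in>?A. c i ^ Poly_Mapping.lookup m i)"
    by (rule mon_eval_superset) auto
  moreover have "mon_eval c n = (\<Prod>i\<in>?A. c i ^ Poly_Mapping.lookup n i)"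
    by (rule mon_eval_superset) auto
  ultimately show ?thesis
    by (simp add: lookup_add power_add prod.distrib)
qed

lemma mon_eval_single: "mon_eval c (Poly_Mapping.single i k) = c i ^ k"
  by (cases "k = 0") (auto simp: mon_eval_def)

lemma mon_eval_scale: "mon_eval (\<lambda>i. s * c i) m = s ^ mdeg m * mon_eval c m"
  by (simp add: mon_eval_def power_mult_distrib prod.distrib power_sum)

lemma mpoly_eval_superset:
  assumes "finite A" "Poly_Mapping.keys f \<subseteq> A"
  shows "mpoly_eval c f = (\<Sum>m\<in>A. Poly_Mapping.lookup f m * mon_eval c m)"
  unfolding mpoly_eval_def mon_eval_def[symmetric]
  by (rule sum.mono_neutral_left) (use assms in \<open>auto simp: in_keys_iff\<close>)

lemma mpoly_eval_0 [simp]: "mpoly_eval c 0 = 0"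
  by (simp add: mpoly_eval_def)

lemma mpoly_eval_single: "mpoly_eval c (Poly_Mapping.single m a) = a * mon_eval c m"
  by (subst mpoly_eval_superset[of "{m}"]) auto

lemma mpoly_eval_1 [simp]: "mpoly_eval c 1 = 1"
  using mpoly_eval_single[of c 0 1] by simp

lemma mpoly_eval_add [simp]: "mpoly_eval c (f + g) = mpoly_eval c f + mpoly_eval c g"
proof -
  let ?A = "Poly_Mapping.keys f \<union> Poly_Mapping.keys g"
  have "mpoly_eval c (f + g) = (\<Sum>i\<in>?A. Poly_Mapping.lookup (f + g) i * mon_eval c i)"
    by (rule mpoly_eval_superset) (auto dest: Poly_Mapping.keys_add[THEN subsetD])
  moreover have "mpoly_eval c f = (\<Sum>i\<in>?A. Poly_Mapping.lookup f i * mon_eval c i)"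
    by (rule mpoly_eval_superset) auto
  moreover have "mpoly_eval c g = (\<Sum>i\<in>?A. Poly_Mapping.lookup g i * mon_eval c i)"
    by (rule mpoly_eval_superset) auto
  ultimately show ?thesis
    by (simp add: lookup_add distrib_right sum.distrib)
qed

lemma sum_single_lookup:
  "(\<Sum>m\<in>Poly_Mapping.keys f. Poly_Mapping.single m (Poly_Mapping.lookup f m)) = f"
  by (rule poly_mapping_eqI)
     (auto simp: lookup_sum lookup_single when_def sum.delta' in_keys_iff)

lemma poly_mapping_single_induct [case_names single add]:
  fixes f :: "'a \<Rightarrow>\<^sub>0 'b::comm_monoid_add"
  assumes single: "\<And>m a. P (Poly_Mapping.single m a)"
    and add: "\<And>f g. P f \<Longrightarrow> P g \<Longrightarrow> P (f + g)"
  shows "P f"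
proof -
  have "P (\<Sum>m\<in>A. Poly_Mapping.single m (Poly_Mapping.lookup f m))" if "finite A" for A
    using that
  proof induction
    case empty
    show ?case using single[of undefined 0] by simp
  qed (simp add: add single)
  from this[of "Poly_Mapping.keys f"] show ?thesis
    by (simp add: sum_single_lookup)
qed

lemma mpoly_eval_mult [simp]: "mpoly_eval c (f * g) = mpoly_eval c f * mpoly_eval c g"
proof (induction f rule: poly_mapping_single_induct)
  case (single m a)
  show ?case
  proof (induction g rule: poly_mapping_single_induct)
    case (single n b)
    show ?case
      by (simp add: mult_single mpoly_eval_single mon_eval_add)
  qed (simp add: algebra_simps)
qed (simp add: algebra_simps)

lemma mpoly_eval_const [simp]: "mpoly_eval c (mpoly_const a) = a"
  by (simp add: mpoly_const_def mpoly_eval_single)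

lemma mpoly_eval_var [simp]: "mpoly_eval c (mpoly_var i) = c i"
  by (simp add: mpoly_var_def mpoly_eval_single mon_eval_single)

lemma mpoly_eval_uminus [simp]: "mpoly_eval c (- f) = - mpoly_eval c f"
  using mpoly_eval_add[of c f "- f"] by (simp add: eq_neg_iff_add_eq_0 add.commute del: mpoly_eval_add)

lemma mpoly_eval_diff [simp]: "mpoly_eval c (f - g) = mpoly_eval c f - mpoly_eval c g"
  using mpoly_eval_add[of c f "- g"] by simp

lemma mpoly_eval_power [simp]: "mpoly_eval c (f ^ k) = mpoly_eval c f ^ k"
  by (induction k) simp_all

lemma mpoly_eval_sum [simp]: "mpoly_eval c (sum f A) = (\<Sum>i\<in>A. mpoly_eval c (f i))"
  by (induction A rule: infinite_finite_induct) simp_all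

lemma mpoly_eval_prod [simp]: "mpoly_eval c (prod f A) = (\<Prod>i\<in>A. mpoly_eval c (f i))"
  by (induction A rule: infinite_finite_induct) simp_all

text \<open>Multiplying by one variable at a time suits the later use with
  \<open>standard_span\<close>, where closure under multiplication by a single coordinate is at
  hand.\<close>

lemma mpoly_induct [case_names const add mult_var]:
  fixes f :: "('v, 'a::comm_ring_1) mpoly"
  assumes const: "\<And>a. P (mpoly_const a)"
    and add: "\<And>f g. P f \<Longrightarrow> P g \<Longrightarrow> P (f + g)"
    and mult_var: "\<And>f i. P f \<Longrightarrow> P (f * mpoly_var i)"
  shows "P f"
proof (induction f rule: poly_mapping_single_induct)
  case (single m a)
  have "P f \<Longrightarrow> P (f * Poly_Mapping.single m 1)" for f :: "('v, 'a) mpoly"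
  proof (induction m arbitrary: f rule: poly_mapping_single_induct)
    case (single i k)
    have "P (f * mpoly_var i ^ k)"
      using single by (induction k) (simp_all add: mult_var power_Suc2 mult.assoc[symmetric] del: power_Suc)
    moreover have "(mpoly_var i :: ('v, 'a) mpoly) ^ k = Poly_Mapping.single (Poly_Mapping.single i k) 1"
      by (induction k) (simp_all add: mpoly_var_def mult_single single_add[symmetric])
    ultimately show ?case
      by simp
  next
    case (add m n)
    have "Poly_Mapping.single (m + n) (1::'a) = Poly_Mapping.single m 1 * Poly_Mapping.single n 1"
      by (simp add: mult_single)
    with add show ?case
      by (metis mult.assoc)
  qed
  from this[OF const[of a]] show ?case
    by (simp add: mpoly_const_def mult_single)
qed (rule add)

lemma lookup_map: "h 0 = 0 \<Longrightarrow> Poly_Mapping.lookup (Poly_Mapping.map h f) k = h (Poly_Mapping.lookup f k)"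
  by transfer (auto simp: when_def)

lemma map_add:
  assumes "h 0 = 0" "\<And>a b. h (a + b) = h a + h b"
  shows "Poly_Mapping.map h (f + g) = Poly_Mapping.map h f + Poly_Mapping.map h g"
  by (rule poly_mapping_eqI) (simp add: lookup_map lookup_add assms)

lemma map_mult:
  fixes h :: "'a::comm_ring_1 \<Rightarrow> 'b::comm_ring_1" and f g :: "('v, 'a) mpoly"
  assumes h: "h 0 = 0" "\<And>a b. h (a + b) = h a + h b" "\<And>a b. h (a * b) = h a * h b"
  shows "Poly_Mapping.map h (f * g) = Poly_Mapping.map h f * Poly_Mapping.map h g"
proof (induction f rule: poly_mapping_single_induct)
  case (single m a)
  show ?case
  proof (induction g rule: poly_mapping_single_induct)
    case (single n b)
    show ?case
      by (simp add: mult_single h)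
  qed (simp add: algebra_simps map_add h)
qed (simp add: algebra_simps map_add h)


section \<open>Evaluation at a point of the base and a point of the fibre\<close>

definition family_eval :: "(nat \<Rightarrow> complex) \<Rightarrow> ('v \<Rightarrow> complex) \<Rightarrow> ('v, base_poly) mpoly \<Rightarrow> complex"
  where "family_eval c x f = mpoly_eval x (Poly_Mapping.map (mpoly_eval c) f)"

lemma family_eval_0 [simp]: "family_eval c x 0 = 0"
  by (simp add: family_eval_def map_eq_zero_iff[THEN iffD2])

lemma family_eval_add [simp]: "family_eval c x (f + g) = family_eval c x f + family_eval c x g"
  by (simp add: family_eval_def map_add)

lemma family_eval_mult [simp]: "family_eval c x (f * g) = family_eval c x f * family_eval c x g"
  by (simp add: family_eval_def map_mult)

lemma family_eval_const [simp]: "family_eval c x (mpoly_const a) = mpoly_eval c a"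
  by (simp add: family_eval_def mpoly_const_def mpoly_eval_single)

lemma family_eval_1 [simp]: "family_eval c x 1 = 1"
  using family_eval_const[of c x 1] by (simp add: mpoly_const_def)

lemma family_eval_var [simp]: "family_eval c x (mpoly_var i) = x i"
  by (simp add: family_eval_def mpoly_var_def mpoly_eval_single mon_eval_single)

lemma family_eval_uminus [simp]: "family_eval c x (- f) = - family_eval c x f"
  using family_eval_add[of c x f "- f"] by (simp add: eq_neg_iff_add_eq_0 add.commute del: family_eval_add)

lemma family_eval_diff [simp]: "family_eval c x (f - g) = family_eval c x f - family_eval c x g"
  using family_eval_add[of c x f "- g"] by simp

lemma family_eval_power [simp]: "family_eval c x (f ^ k) = family_eval c x f ^ k"
  by (induction k) simp_all

lemma family_eval_sum [simp]: "family_eval c x (sum f A) = (\<Sum>i\<in>A. family_eval c x (f i))"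
  by (induction A rule: infinite_finite_induct) simp_all


section \<open>Homogeneous parts\<close>

definition homogeneous_part :: "nat \<Rightarrow> ('v, 'a::comm_ring_1) mpoly \<Rightarrow> ('v, 'a) mpoly"
  where "homogeneous_part d f =
    (\<Sum>m | m \<in> Poly_Mapping.keys f \<and> mdeg m = d. Poly_Mapping.single m (Poly_Mapping.lookup f m))"

lemma lookup_homogeneous_part:
  "Poly_Mapping.lookup (homogeneous_part d f) m = (if mdeg m = d then Poly_Mapping.lookup f m else 0)"
  by (auto simp: homogeneous_part_def lookup_sum lookup_single when_def sum.delta' in_keys_iff)

lemma homogeneous_homogeneous_part: "homogeneous (homogeneous_part d f)"
  unfolding homogeneous_def
  by (rule exI[of _ d]) (auto simp: in_keys_iff lookup_homogeneous_part split: if_splits)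

lemma homogeneous_part_map:
  "h 0 = 0 \<Longrightarrow> homogeneous_part d (Poly_Mapping.map h f) = Poly_Mapping.map h (homogeneous_part d f)"
  by (rule poly_mapping_eqI) (simp add: lookup_homogeneous_part lookup_map)

definition total_degree :: "('v, 'a::zero) mpoly \<Rightarrow> nat"
  where "total_degree f = Max (insert 0 (mdeg ` Poly_Mapping.keys f))"

lemma mdeg_le_total_degree: "m \<in> Poly_Mapping.keys f \<Longrightarrow> mdeg m \<le> total_degree f"
  by (simp add: total_degree_def)

lemma sum_homogeneous_part:
  assumes "total_degree f \<le> D"
  shows "(\<Sum>d\<le>D. homogeneous_part d f) = f"
proof (rule poly_mapping_eqI)
  fix m
  show "Poly_Mapping.lookup (\<Sum>d\<le>D. homogeneous_part d f) m = Poly_Mapping.lookup f m"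
    using mdeg_le_total_degree[of m f] assms
    by (cases "Poly_Mapping.lookup f m = 0") (auto simp: lookup_sum lookup_homogeneous_part in_keys_iff)
qed

lemma mpoly_eval_scale_homogeneous_part:
  "mpoly_eval (\<lambda>i. s * x i) (homogeneous_part d f) = s ^ d * mpoly_eval x (homogeneous_part d f)"
  by (simp add: homogeneous_part_def mpoly_eval_single mon_eval_scale sum_distrib_left mult_ac)

text \<open>Along the ray through \<open>x\<close> the value of \<open>f\<close> is a polynomial in
  the scaling factor, whose coefficients are the values of the homogeneous parts. Vanishing off 0
  gives it infinitely many roots.\<close>

lemma mpoly_eval_homogeneous_part_eq_0:
  fixes f :: "('v, complex) mpoly"
  assumes "\<And>s. s \<noteq> 0 \<Longrightarrow> mpoly_eval (\<lambda>i. s * x i) f = 0"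
  shows "mpoly_eval x (homogeneous_part d f) = 0"
proof -
  \<comment> \<open>\<open>d\<close> may exceed the degree of \<open>f\<close>, and its coefficient
    still has to occur in \<open>p\<close>.\<close>
  define D where "D = max d (total_degree f)"
  define p where "p = (\<Sum>e\<le>D. Polynomial.monom (mpoly_eval x (homogeneous_part e f)) e)"
  have "poly p s = 0" if "s \<noteq> 0" for s
  proof -
    have "poly p s = (\<Sum>e\<le>D. s ^ e * mpoly_eval x (homogeneous_part e f))"
      by (simp add: p_def poly_sum poly_monom mult.commute)
    also have "\<dots> = mpoly_eval (\<lambda>i. s * x i) (\<Sum>e\<le>D. homogeneous_part e f)"
      by (simp add: mpoly_eval_scale_homogeneous_part)
    also have "\<dots> = 0"
      using assms[OF that] by (simp add: sum_homogeneous_part D_def)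
    finally show ?thesis .
  qed
  then have "- {0} \<subseteq> {s. poly p s = 0}"
    by auto
  moreover have "infinite (- {0 :: complex})"
    by (simp add: infinite_UNIV_char_0)
  ultimately have "p = 0"
    using poly_roots_finite finite_subset by blast
  moreover have "coeff p d = mpoly_eval x (homogeneous_part d f)"
    by (simp add: p_def coeff_sum D_def)
  ultimately show ?thesis
    by simp
qed

section \<open>Ideals of polynomial rings\<close>

lemma mpoly_ring_simps [simp]:
  "carrier mpoly_ring = UNIV" "a \<otimes>\<^bsub>mpoly_ring\<^esub> b = a * b" "a \<oplus>\<^bsub>mpoly_ring\<^esub> b = a + b"
  "\<one>\<^bsub>mpoly_ring\<^esub> = 1" "\<zero>\<^bsub>mpoly_ring\<^esub> = 0"
  by (simp_all add: mpoly_ring_def)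

lemma cring_mpoly_ring: "cring (mpoly_ring :: ('v, 'a::comm_ring_1) mpoly ring)"
proof (rule cringI)
  show "abelian_group (mpoly_ring :: ('v, 'a) mpoly ring)"
  proof (rule abelian_groupI)
    fix f :: "('v, 'a) mpoly"
    have "- f + f = 0" by simp
    then show "\<exists>g\<in>carrier mpoly_ring. g \<oplus>\<^bsub>mpoly_ring\<^esub> f = \<zero>\<^bsub>mpoly_ring\<^esub>"
      by (intro bexI[of _ "- f"]) simp_all
  qed (simp_all add: add_ac)
  show "comm_monoid (mpoly_ring :: ('v, 'a) mpoly ring)"
    by (rule comm_monoidI) (simp_all add: mult_ac)
qed (simp_all add: distrib_right)

lemma a_inv_mpoly_ring [simp]: "\<ominus>\<^bsub>mpoly_ring\<^esub> a = - a"
proof -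
  interpret cring "mpoly_ring :: ('a, 'b) mpoly ring"
    by (rule cring_mpoly_ring)
  show ?thesis
    by (rule minus_equality) simp_all
qed

lemma ideal_mpoly_ringI:
  fixes I :: "('v, 'a::comm_ring_1) mpoly set"
  assumes "0 \<in> I" "\<And>f g. f \<in> I \<Longrightarrow> g \<in> I \<Longrightarrow> f + g \<in> I" "\<And>f g. f \<in> I \<Longrightarrow> g * f \<in> I"
  shows "ideal I mpoly_ring"
proof (rule idealI)
  interpret cring "mpoly_ring :: ('v, 'a) mpoly ring"
    by (rule cring_mpoly_ring)
  show "ring (mpoly_ring :: ('v, 'a) mpoly ring)"
    by (rule ring_axioms)
  show "subgroup I (add_monoid mpoly_ring)"
  proof (rule subgroup.intro)
    fix f assume "f \<in> I"
    then have "(-1) * f \<in> I" by (rule assms(3))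
    then show "inv\<^bsub>add_monoid mpoly_ring\<^esub> f \<in> I"
      using a_inv_mpoly_ring[of f] by (simp add: a_inv_def)
  qed (use assms in auto)
  show "f \<otimes>\<^bsub>mpoly_ring\<^esub> g \<in> I" if "f \<in> I" for f g
    using assms(3)[OF that, of g] by (simp add: mult.commute)
qed (use assms in auto)

lemma ideal_mpoly_ringD:
  assumes "ideal I mpoly_ring"
  shows "0 \<in> I" "\<And>f g. f \<in> I \<Longrightarrow> g \<in> I \<Longrightarrow> f + g \<in> I" "\<And>f g. f \<in> I \<Longrightarrow> g * f \<in> I"
    "\<And>f g. f \<in> I \<Longrightarrow> g \<in> I \<Longrightarrow> f - g \<in> I"
proof -
  interpret ideal I mpoly_ring by (rule assms)
  show "0 \<in> I"
    using additive_subgroup.zero_closed[OF is_additive_subgroup] by simp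
  show add: "f + g \<in> I" if "f \<in> I" "g \<in> I" for f g
    using additive_subgroup.a_closed[OF is_additive_subgroup that] by simp
  show mult: "g * f \<in> I" if "f \<in> I" for f g
    using I_l_closed[OF that, of g] by simp
  show "f - g \<in> I" if "f \<in> I" "g \<in> I" for f g
    using add[OF that(1) mult[OF that(2), of "-1"]] by simp
qed

lemma ideal_mpoly_ring_sum:
  assumes "ideal I mpoly_ring" "\<And>i. i \<in> A \<Longrightarrow> f i \<in> I"
  shows "sum f A \<in> I"
  using assms(2)
  by (induction A rule: infinite_finite_induct) (auto intro: ideal_mpoly_ringD[OF assms(1)])

lemma ideal_genideal_mpoly_ring: "ideal (genideal mpoly_ring S) mpoly_ring"
  and genideal_mpoly_ring_superset: "S \<subseteq> genideal mpoly_ring S"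
  and genideal_mpoly_ring_subset: "ideal I mpoly_ring \<Longrightarrow> S \<subseteq> I \<Longrightarrow> genideal mpoly_ring S \<subseteq> I"
proof -
  interpret cring "mpoly_ring :: ('a, 'b) mpoly ring"
    by (rule cring_mpoly_ring)
  show "ideal (genideal mpoly_ring S) mpoly_ring" "S \<subseteq> genideal mpoly_ring S"
    using genideal_ideal[of S] genideal_self[of S] by simp_all
  show "ideal I mpoly_ring \<Longrightarrow> S \<subseteq> I \<Longrightarrow> genideal mpoly_ring S \<subseteq> I"
    by (rule genideal_minimal)
qed

lemma homogeneous_generation:
  assumes "ideal I mpoly_ring" "\<And>f d. f \<in> I \<Longrightarrow> homogeneous_part d f \<in> I"
  shows "genideal mpoly_ring {f \<in> I. homogeneous f} = I"
proof
  show "genideal mpoly_ring {f \<in> I. homogeneous f} \<subseteq> I"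
    by (rule genideal_mpoly_ring_subset) (use assms in auto)
  show "I \<subseteq> genideal mpoly_ring {f \<in> I. homogeneous f}"
  proof
    fix f assume f: "f \<in> I"
    have "(\<Sum>d\<le>total_degree f. homogeneous_part d f) \<in> genideal mpoly_ring {f \<in> I. homogeneous f}"
    proof (rule ideal_mpoly_ring_sum[OF ideal_genideal_mpoly_ring])
      fix d
      have "homogeneous_part d f \<in> {f \<in> I. homogeneous f}"
        using assms(2)[OF f] homogeneous_homogeneous_part by simp
      then show "homogeneous_part d f \<in> genideal mpoly_ring {f \<in> I. homogeneous f}"
        by (rule genideal_mpoly_ring_superset[THEN subsetD])
    qed
    then show "f \<in> genideal mpoly_ring {f \<in> I. homogeneous f}"
      by (simp add: sum_homogeneous_part)
  qed
qed

section \<open>Vanishing ideals of cones\<close>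

definition complex_cone :: "(complex ^ 'n) set \<Rightarrow> bool"
  where "complex_cone X \<longleftrightarrow> (\<forall>s v. s \<noteq> 0 \<longrightarrow> v \<in> X \<longrightarrow> s *s v \<in> X)"

text \<open>\<open>vanishing_ideal\<close> is generated by homogeneous polynomials. On a cone the
  homogeneous parts of a vanishing polynomial vanish too, which yields this pointwise
  description.\<close>

lemma vanishing_ideal_cone:
  assumes "complex_cone X"
  shows "vanishing_ideal X = {f. \<forall>v\<in>X. mpoly_eval (($) v) f = 0}"
proof -
  define I where "I = {f. \<forall>v\<in>X. mpoly_eval (($) v) f = 0}"
  have "ideal I mpoly_ring"
    by (rule ideal_mpoly_ringI) (auto simp: I_def)
  moreover have "homogeneous_part d f \<in> I" if "f \<in> I" for f d
  proof -
    have "mpoly_eval (\<lambda>i. s * v $ i) f = 0" if "v \<in> X" "s \<noteq> 0" for s v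
    proof -
      have "s *s v \<in> X"
        using assms that by (auto simp: complex_cone_def)
      moreover have "($) (s *s v) = (\<lambda>i. s * v $ i)"
        by auto
      ultimately show ?thesis
        using \<open>f \<in> I\<close> by (auto simp: I_def)
    qed
    then show ?thesis
      by (auto simp: I_def intro: mpoly_eval_homogeneous_part_eq_0)
  qed
  ultimately have "genideal mpoly_ring {f \<in> I. homogeneous f} = I"
    by (rule homogeneous_generation)
  moreover have "{f \<in> I. homogeneous f} = {f. homogeneous f \<and> (\<forall>v\<in>X. mpoly_eval (\<lambda>i. v $ i) f = 0)}"
    by (auto simp: I_def)
  ultimately show ?thesis
    by (simp add: vanishing_ideal_def I_def)
qed


section \<open>The affine line\<close>

definition line_point :: "complex \<Rightarrow> nat \<Rightarrow> complex"
  where "line_point t = (\<lambda>i. if i = 0 then t else 0)"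

text \<open>The affine line as the \<open>y\<^sub>0\<close>-axis in the space with coordinates
  indexed by \<open>nat\<close>.\<close>

definition line_ideal :: "base_poly set"
  where "line_ideal = {f. \<forall>t. mpoly_eval (line_point t) f = 0}"

text \<open>Restriction to the axis. Being surjective with kernel \<open>line_ideal\<close>, it
  identifies the coordinate ring with \<complex>[t] and makes division with remainder
  available.\<close>

definition line_poly :: "base_poly \<Rightarrow> complex poly"
  where "line_poly f =
    mpoly_eval (\<lambda>i. if i = 0 then [:0, 1:] else 0) (Poly_Mapping.map (\<lambda>a. [:a:]) f)"

lemma line_point_0 [simp]: "line_point t 0 = t"
  by (simp add: line_point_def)

lemma poly_line_poly: "poly (line_poly f) t = mpoly_eval (line_point t) f"
proof (induction f rule: mpoly_induct)
  case (const a)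
  have "line_poly (mpoly_const a) = [:a:]"
    by (simp add: line_poly_def mpoly_const_def mpoly_eval_single)
  then show ?case by simp
next
  case (add f g)
  have "line_poly (f + g) = line_poly f + line_poly g"
    by (simp add: line_poly_def map_add)
  with add show ?case by simp
next
  case (mult_var f i)
  have "Poly_Mapping.map (\<lambda>a. [:a:]) (f * mpoly_var i) =
      Poly_Mapping.map (\<lambda>a. [:a:]) f * Poly_Mapping.map (\<lambda>a. [:a:]) (mpoly_var i)"
    by (rule map_mult) simp_all
  moreover have "Poly_Mapping.map (\<lambda>a. [:a :: complex:]) (mpoly_var i) = mpoly_var i"
    by (simp add: mpoly_var_def one_pCons)
  ultimately have "line_poly (f * mpoly_var i) = line_poly f * (if i = 0 then [:0, 1:] else 0)"
    by (simp add: line_poly_def)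
  with mult_var show ?case by (simp add: line_point_def)
qed

lemma line_poly_eqI: "(\<And>t. mpoly_eval (line_point t) f = poly q t) \<Longrightarrow> line_poly f = q"
  by (metis poly_eq_poly_eq_iff poly_line_poly ext)

lemma line_poly_add [simp]: "line_poly (f + g) = line_poly f + line_poly g"
  and line_poly_diff [simp]: "line_poly (f - g) = line_poly f - line_poly g"
  and line_poly_mult [simp]: "line_poly (f * g) = line_poly f * line_poly g"
  and line_poly_const [simp]: "line_poly (mpoly_const a) = [:a:]"
  and line_poly_var [simp]: "line_poly (mpoly_var 0) = [:0, 1:]"
  by (rule line_poly_eqI; simp add: poly_line_poly)+

lemma in_line_ideal_iff: "f \<in> line_ideal \<longleftrightarrow> line_poly f = 0"
  by (simp add: line_ideal_def poly_line_poly[symmetric] poly_all_0_iff_0)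

lemma line_poly_surj: "\<exists>f. line_poly f = q"
proof (induction q)
  case 0
  show ?case
    by (rule exI[of _ "mpoly_const 0"]) simp
next
  case (pCons a q)
  then obtain f where "line_poly f = q" by blast
  then have "line_poly (mpoly_const a + mpoly_var 0 * f) = pCons a q"
    by simp
  then show ?case by blast
qed

lemma ideal_line_ideal: "ideal line_ideal mpoly_ring"
  by (rule ideal_mpoly_ringI) (auto simp: line_ideal_def)

lemma mpoly_const_mult: "mpoly_const a * mpoly_const b = mpoly_const (a * b)"
  by (simp add: mpoly_const_def mult_single)

lemma mpoly_const_1: "mpoly_const 1 = 1"
  by (simp add: mpoly_const_def)

lemma primeideal_mpoly_ringI:
  fixes I :: "('v, 'a::comm_ring_1) mpoly set"
  assumes "ideal I mpoly_ring" "1 \<notin> I" "\<And>f g. f * g \<in> I \<Longrightarrow> f \<in> I \<or> g \<in> I"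
  shows "primeideal I mpoly_ring"
  by (intro primeideal.intro primeideal_axioms.intro cring_mpoly_ring) (use assms in auto)

lemma const_notin_primeideal:
  fixes Q :: "('v, 'a::field) mpoly set"
  assumes "primeideal Q mpoly_ring" "a \<noteq> 0"
  shows "mpoly_const a \<notin> Q"
proof
  assume "mpoly_const a \<in> Q"
  have I: "ideal Q mpoly_ring"
    using assms(1) by (rule primeideal.axioms(1))
  have "mpoly_const (inverse a) * mpoly_const a \<in> Q"
    using \<open>mpoly_const a \<in> Q\<close> by (rule ideal_mpoly_ringD(3)[OF I])
  then have "1 \<in> Q"
    using assms(2) by (simp add: mpoly_const_mult mpoly_const_1)
  then have "f \<in> Q" for f
    using ideal_mpoly_ringD(3)[OF I, of 1 f] by simp
  then show False
    using primeideal.I_notcarr[OF assms(1)] by auto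
qed

lemma primeideal_line_ideal: "primeideal line_ideal mpoly_ring"
  by (rule primeideal_mpoly_ringI[OF ideal_line_ideal])
     (auto simp: in_line_ideal_iff mpoly_const_1[symmetric])

lemma base_points_line_ideal: "base_points line_ideal = range line_point"
proof
  show "base_points line_ideal \<subseteq> range line_point"
  proof
    fix c assume c: "c \<in> base_points line_ideal"
    have "c i = 0" if "i \<noteq> 0" for i
    proof -
      have "mpoly_var i \<in> line_ideal"
        using that by (simp add: line_ideal_def line_point_def)
      with c have "mpoly_eval c (mpoly_var i) = 0"
        unfolding base_points_def by blast
      then show ?thesis by simp
    qed
    then have "c = line_point (c 0)"
      by (auto simp: line_point_def)
    then show "c \<in> range line_point" by blast
  qed
qed (auto simp: base_points_def line_ideal_def)

text \<open>The functions \<open>y\<^sub>i\<close> with \<open>i \<noteq> 0\<close> exclude all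
  other directions, while a shift along the axis stays on it, where \<open>line_ideal\<close>
  vanishes identically.\<close>

lemma tangent_space_line: "tangent_space line_ideal (line_point t) = {\<lambda>i. s * line_point 1 i | s. True}"
proof
  show "tangent_space line_ideal (line_point t) \<subseteq> {\<lambda>i. s * line_point 1 i | s. True}"
  proof
    fix v assume v: "v \<in> tangent_space line_ideal (line_point t)"
    have "v i = 0" if "i \<noteq> 0" for i
    proof -
      have "mpoly_var i \<in> line_ideal"
        using that by (simp add: line_ideal_def line_point_def)
      with v have "((\<lambda>s. mpoly_eval (\<lambda>i. line_point t i + s * v i) (mpoly_var i)) has_field_derivative 0) (at 0)"
        unfolding tangent_space_def by blast
      moreover have "((\<lambda>s. line_point t i + s * v i) has_field_derivative v i) (at 0)"
        by (auto intro!: derivative_eq_intros)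
      ultimately show ?thesis
        using DERIV_unique by fastforce
    qed
    then have "v = (\<lambda>i. v 0 * line_point 1 i)"
      by (auto simp: line_point_def)
    then show "v \<in> {\<lambda>i. s * line_point 1 i | s. True}" by blast
  qed
  have "(\<lambda>i. line_point t i + h * (s * line_point 1 i)) = line_point (t + h * s)" for s h
    by (auto simp: line_point_def)
  then show "{\<lambda>i. s * line_point 1 i | s. True} \<subseteq> tangent_space line_ideal (line_point t)"
    by (auto simp: tangent_space_def line_ideal_def)
qed

text \<open>A root of \<open>line_poly f\<close> splits off a linear factor; by primality this
  factor lies in \<open>Q\<close>, or the cofactor of smaller degree does. The descent cannot end in
  a nonzero constant.\<close>

lemma prime_above_line_contains_point:
  assumes Q: "primeideal Q mpoly_ring" "line_ideal \<subseteq> Q" and "f \<in> Q" "line_poly f \<noteq> 0"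
  shows "\<exists>a. mpoly_var 0 - mpoly_const a \<in> Q"
  using assms(3,4)
proof (induction "degree (line_poly f)" arbitrary: f)
  case 0
  have I: "ideal Q mpoly_ring"
    using Q(1) by (rule primeideal.axioms(1))
  from 0 obtain k where k: "line_poly f = [:k:]"
    by (metis degree_eq_zeroE)
  then have "f - mpoly_const k \<in> Q"
    using Q(2) by (auto simp: in_line_ideal_iff)
  from ideal_mpoly_ringD(4)[OF I \<open>f \<in> Q\<close> this] have "mpoly_const k \<in> Q"
    by simp
  moreover have "k \<noteq> 0"
    using 0 k by auto
  ultimately show ?case
    using const_notin_primeideal[OF Q(1)] by blast
next
  case (Suc n)
  have I: "ideal Q mpoly_ring"
    using Q(1) by (rule primeideal.axioms(1))
  have "\<not> constant (poly (line_poly f))"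
    using Suc.hyps(2) by (simp add: constant_degree)
  then obtain a where "poly (line_poly f) a = 0"
    using fundamental_theorem_of_algebra by blast
  then obtain q where q: "line_poly f = [:- a, 1:] * q"
    by (auto simp: poly_eq_0_iff_dvd)
  obtain g where g: "line_poly g = q"
    using line_poly_surj by blast
  have "f - (mpoly_var 0 - mpoly_const a) * g \<in> Q"
    using Q(2) by (auto simp: in_line_ideal_iff q g)
  from ideal_mpoly_ringD(4)[OF I \<open>f \<in> Q\<close> this] have "(mpoly_var 0 - mpoly_const a) * g \<in> Q"
    by simp
  then consider "mpoly_var 0 - mpoly_const a \<in> Q" | "g \<in> Q"
    using primeideal.I_prime[OF Q(1)] by auto
  then show ?case
  proof cases
    case 2
    have "q \<noteq> 0"
      using Suc.prems(2) q by auto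
    then have "degree (line_poly f) = Suc (degree q)"
      unfolding q by (subst degree_mult_eq) auto
    then show ?thesis
      using Suc.hyps(1)[of g] Suc.hyps(2) 2 g \<open>q \<noteq> 0\<close> by simp
  qed blast
qed

lemma smooth_connected_curve_line: "smooth_connected_curve line_ideal"
  unfolding smooth_connected_curve_def
proof (intro conjI)
  show "primeideal line_ideal mpoly_ring"
    by (rule primeideal_line_ideal)
  show "\<exists>n. \<forall>i\<ge>n. mpoly_var i \<in> line_ideal"
    by (rule exI[of _ 1]) (auto simp: line_ideal_def line_point_def)
  show "\<exists>Q. primeideal Q mpoly_ring \<and> line_ideal \<subset> Q"
  proof (intro exI conjI)
    show "primeideal {f :: base_poly. mpoly_eval (line_point 0) f = 0} mpoly_ring"
      by (rule primeideal_mpoly_ringI) (auto intro: ideal_mpoly_ringI)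
    have "mpoly_var 0 \<notin> line_ideal"
      by (simp add: in_line_ideal_iff)
    moreover have "mpoly_var 0 \<in> {f :: base_poly. mpoly_eval (line_point 0) f = 0}"
      by simp
    moreover have "line_ideal \<subseteq> {f. mpoly_eval (line_point 0) f = 0}"
      by (auto simp: line_ideal_def)
    ultimately show "line_ideal \<subset> {f. mpoly_eval (line_point 0) f = 0}"
      by blast
  qed
  show "\<not> (\<exists>Q Q'. primeideal Q mpoly_ring \<and> primeideal Q' mpoly_ring \<and> line_ideal \<subset> Q \<and> Q \<subset> Q')"
  proof (intro notI, elim exE conjE)
    fix Q Q' :: "base_poly set"
    assume Q: "primeideal Q mpoly_ring" "line_ideal \<subset> Q" and Q': "primeideal Q' mpoly_ring" "Q \<subset> Q'"
    have I: "ideal Q mpoly_ring" and I': "ideal Q' mpoly_ring"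
      using Q(1) Q'(1) by (auto intro: primeideal.axioms(1))
    obtain f where "f \<in> Q" "f \<notin> line_ideal"
      using Q(2) by blast
    then obtain a where a: "mpoly_var 0 - mpoly_const a \<in> Q"
      using prime_above_line_contains_point[OF Q(1)] Q(2) by (auto simp: in_line_ideal_iff)
    obtain g where g: "g \<in> Q'" "g \<notin> Q"
      using Q'(2) by blast
    \<comment> \<open>\<open>Q\<close> contains the ideal of the point \<open>a\<close>, so modulo
      \<open>Q\<close> every \<open>g\<close> equals its value \<open>k\<close> there; for
      \<open>g\<close> outside \<open>Q\<close> this value is a nonzero constant lying in
      \<open>Q'\<close>.\<close>
    define k where "k = poly (line_poly g) a"
    have "poly (line_poly g - [:k:]) a = 0"
      by (simp add: k_def)
    then obtain q where q: "line_poly g - [:k:] = [:- a, 1:] * q"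
      by (auto simp only: poly_eq_0_iff_dvd)
    obtain h where h: "line_poly h = q"
      using line_poly_surj by blast
    have "g - mpoly_const k - h * (mpoly_var 0 - mpoly_const a) \<in> line_ideal"
      using q by (simp add: in_line_ideal_iff h)
    then have "g - mpoly_const k - h * (mpoly_var 0 - mpoly_const a) \<in> Q"
      using Q(2) by blast
    from ideal_mpoly_ringD(2)[OF I this ideal_mpoly_ringD(3)[OF I a, of h]]
    have gk: "g - mpoly_const k \<in> Q"
      by simp
    then have "k \<noteq> 0"
      using g by (auto simp: mpoly_const_def)
    moreover have "mpoly_const k \<in> Q'"
      using ideal_mpoly_ringD(4)[OF I' g(1), of "g - mpoly_const k"] gk Q'(2) by auto
    ultimately show False
      using const_notin_primeideal[OF Q'(1)] by blast
  qed
  show "\<forall>c\<in>base_points line_ideal. \<exists>u. u \<noteq> (\<lambda>_. 0) \<and> tangent_space line_ideal c = {\<lambda>i. s * u i | s. True}"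
  proof
    fix c assume "c \<in> base_points line_ideal"
    then obtain t where "c = line_point t"
      by (auto simp: base_points_line_ideal)
    moreover have "line_point 1 \<noteq> (\<lambda>_. 0)"
      by (metis line_point_0 zero_neq_one)
    ultimately show "\<exists>u. u \<noteq> (\<lambda>_. 0) \<and> tangent_space line_ideal c = {\<lambda>i. s * u i | s. True}"
      using tangent_space_line by blast
  qed
qed


section \<open>Flat modules over principal ideal rings\<close>

text \<open>Cancellation may make the support of \<open>t + u\<close> smaller than the union of the
  supports, so all products are first extended by trivial factors. In additive notation this is the
  additivity of the canonical map from \<open>J \<otimes> M\<close> to \<open>M\<close>.\<close>

lemma (in comm_group) finprod_keys_add:
  fixes t u :: "'c \<Rightarrow>\<^sub>0 int"
  assumes f: "f \<in> S \<rightarrow> carrier G" and S: "Poly_Mapping.keys t \<subseteq> S" "Poly_Mapping.keys u \<subseteq> S"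
  shows "finprod G (\<lambda>x. f x [^] Poly_Mapping.lookup (t + u) x) (Poly_Mapping.keys (t + u)) =
    finprod G (\<lambda>x. f x [^] Poly_Mapping.lookup t x) (Poly_Mapping.keys t) \<otimes>
    finprod G (\<lambda>x. f x [^] Poly_Mapping.lookup u x) (Poly_Mapping.keys u)"
proof -
  let ?A = "Poly_Mapping.keys t \<union> Poly_Mapping.keys u"
  have A: "?A \<subseteq> S"
    using S by auto
  have *: "finprod G (\<lambda>x. f x [^] Poly_Mapping.lookup v x) (Poly_Mapping.keys v) =
      finprod G (\<lambda>x. f x [^] Poly_Mapping.lookup v x) ?A"
    if "Poly_Mapping.keys v \<subseteq> ?A" for v :: "'c \<Rightarrow>\<^sub>0 int"
    by (rule finprod_mono_neutral_cong_left) (use that f A in \<open>auto simp: in_keys_iff\<close>)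
  have "finprod G (\<lambda>x. f x [^] Poly_Mapping.lookup (t + u) x) ?A =
      finprod G (\<lambda>x. f x [^] Poly_Mapping.lookup t x \<otimes> f x [^] Poly_Mapping.lookup u x) ?A"
    by (rule finprod_cong') (use f A in \<open>auto simp: lookup_add int_pow_mult Pi_iff subset_iff\<close>)
  also have "\<dots> = finprod G (\<lambda>x. f x [^] Poly_Mapping.lookup t x) ?A \<otimes>
      finprod G (\<lambda>x. f x [^] Poly_Mapping.lookup u x) ?A"
    by (rule finprod_multf) (use f A in auto)
  finally show ?thesis
    using *[of "t + u"] *[of t] *[of u] Poly_Mapping.keys_add[of t u] by simp
qed

lemma tensor_relations_closed:
  fixes R (structure) and M (structure)
  assumes "Module.module R M" "ideal J R"
  shows "t \<in> tensor_relations R J M \<Longrightarrow> u \<in> tensor_relations R J M \<Longrightarrow> t + u \<in> tensor_relations R J M"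
    and "t \<in> tensor_relations R J M \<Longrightarrow> - t \<in> tensor_relations R J M"
    and "a \<in> J \<Longrightarrow> b \<in> J \<Longrightarrow> m \<in> carrier M \<Longrightarrow>
      frag_of (a \<oplus> b, m) - frag_of (a, m) - frag_of (b, m) \<in> tensor_relations R J M"
    and "a \<in> J \<Longrightarrow> m \<in> carrier M \<Longrightarrow> n \<in> carrier M \<Longrightarrow>
      frag_of (a, m \<oplus>\<^bsub>M\<^esub> n) - frag_of (a, m) - frag_of (a, n) \<in> tensor_relations R J M"
    and "r \<in> carrier R \<Longrightarrow> a \<in> J \<Longrightarrow> m \<in> carrier M \<Longrightarrow>
      frag_of (r \<otimes> a, m) - frag_of (a, r \<odot>\<^bsub>M\<^esub> m) \<in> tensor_relations R J M"
proof -
  interpret module R M by (rule assms(1))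
  interpret J: ideal J R by (rule assms(2))
  let ?G = "free_Abelian_group (J \<times> carrier M)"
  let ?S = "{frag_of (a \<oplus>\<^bsub>R\<^esub> b, m) - frag_of (a, m) - frag_of (b, m) | a b m.
          a \<in> J \<and> b \<in> J \<and> m \<in> carrier M} \<union>
       {frag_of (a, m \<oplus>\<^bsub>M\<^esub> n) - frag_of (a, m) - frag_of (a, n) | a m n.
          a \<in> J \<and> m \<in> carrier M \<and> n \<in> carrier M} \<union>
       {frag_of (r \<otimes>\<^bsub>R\<^esub> a, m) - frag_of (a, r \<odot>\<^bsub>M\<^esub> m) | r a m.
          r \<in> carrier R \<and> a \<in> J \<and> m \<in> carrier M}"
  have diff: "x - y \<in> carrier ?G" if "x \<in> carrier ?G" "y \<in> carrier ?G" for x y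
    using that keys_diff[of x y] by auto
  have "?S \<subseteq> carrier ?G"
    by (auto intro!: diff simp del: carrier_free_Abelian_group_iff simp: J.I_l_closed)
  then have sub: "subgroup (tensor_relations R J M) ?G"
    unfolding tensor_relations_def by (rule group.generate_is_subgroup[OF group_free_Abelian_group])
  show "t + u \<in> tensor_relations R J M" if "t \<in> tensor_relations R J M" "u \<in> tensor_relations R J M"
    using subgroup.m_closed[OF sub that] by simp
  show "- t \<in> tensor_relations R J M" if "t \<in> tensor_relations R J M"
    using subgroup.m_inv_closed[OF sub that] subgroup.mem_carrier[OF sub that] by simp
  have incl: "x \<in> tensor_relations R J M" if "x \<in> ?S" for x
    unfolding tensor_relations_def using that by (rule generate.incl)
  show "frag_of (a \<oplus> b, m) - frag_of (a, m) - frag_of (b, m) \<in> tensor_relations R J M"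
    if "a \<in> J" "b \<in> J" "m \<in> carrier M"
    by (rule incl) (use that in blast)
  show "frag_of (a, m \<oplus>\<^bsub>M\<^esub> n) - frag_of (a, m) - frag_of (a, n) \<in> tensor_relations R J M"
    if "a \<in> J" "m \<in> carrier M" "n \<in> carrier M"
    by (rule incl) (use that in blast)
  show "frag_of (r \<otimes> a, m) - frag_of (a, r \<odot>\<^bsub>M\<^esub> m) \<in> tensor_relations R J M"
    if "r \<in> carrier R" "a \<in> J" "m \<in> carrier M"
    by (rule incl) (use that in blast)
qed

text \<open>
  Over a principal ideal \<open>J = (a)\<close> every element of \<open>J \<otimes> M\<close> is a pure tensor \<open>a \<otimes> m\<close>, and it is
  mapped to \<open>a m\<close>.
\<close>

lemma flat_module_principal:
  fixes R (structure) and M (structure)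
  assumes module: "Module.module R M"
    and principal: "\<And>J. ideal J R \<Longrightarrow> \<exists>a\<in>J. \<forall>b\<in>J. \<exists>r\<in>carrier R. b = r \<otimes> a"
    and torsion_free: "\<And>a m. a \<in> carrier R \<Longrightarrow> m \<in> carrier M \<Longrightarrow> a \<odot>\<^bsub>M\<^esub> m = \<zero>\<^bsub>M\<^esub> \<Longrightarrow> a = \<zero> \<or> m = \<zero>\<^bsub>M\<^esub>"
  shows "flat_module R M"
  unfolding flat_module_def
proof (intro conjI allI impI ballI)
  interpret module R M by (rule module)
  show "Module.module R M" by (rule module)
  fix J t
  assume J: "ideal J R" and t: "t \<in> carrier (free_Abelian_group (J \<times> carrier M))"
  define v where "v t = finsum M (\<lambda>(a, m). add_pow M (Poly_Mapping.lookup t (a, m)) (a \<odot>\<^bsub>M\<^esub> m))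
    (Poly_Mapping.keys t)" for t :: "_ \<Rightarrow>\<^sub>0 int"
  assume "finsum M (\<lambda>(a, m). add_pow M (Poly_Mapping.lookup t (a, m)) (a \<odot>\<^bsub>M\<^esub> m))
    (Poly_Mapping.keys t) = \<zero>\<^bsub>M\<^esub>"
  then have vt: "v t = \<zero>\<^bsub>M\<^esub>" by (simp add: v_def)
  interpret J: ideal J R by (rule J)
  let ?H = "tensor_relations R J M"
  note H = tensor_relations_closed[OF module J]
  have H_diff: "t - u \<in> ?H" if "t \<in> ?H" "u \<in> ?H" for t u
    using H(1)[OF that(1) H(2)[OF that(2)]] by simp
  have comm: "comm_group (add_monoid M)"
    by (rule M.a_comm_group)
  have v_add: "v (t + u) = v t \<oplus>\<^bsub>M\<^esub> v u"
    if "Poly_Mapping.keys t \<subseteq> J \<times> carrier M" "Poly_Mapping.keys u \<subseteq> J \<times> carrier M" for t u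
    using comm_group.finprod_keys_add[OF comm _ that, of "\<lambda>(a, m). a \<odot>\<^bsub>M\<^esub> m"] J.Icarr
    by (auto simp: v_def finsum_def add_pow_def case_prod_beta' Pi_iff)
  have v_closed: "v t \<in> carrier M" if "Poly_Mapping.keys t \<subseteq> J \<times> carrier M" for t
    unfolding v_def by (rule M.finsum_closed) (use that J.Icarr in \<open>auto intro!: M.add.int_pow_closed\<close>)
  have v_diff: "v (t - u) = v t \<ominus>\<^bsub>M\<^esub> v u"
    if "Poly_Mapping.keys t \<subseteq> J \<times> carrier M" "Poly_Mapping.keys u \<subseteq> J \<times> carrier M" for t u
  proof -
    have k: "Poly_Mapping.keys (t - u) \<subseteq> J \<times> carrier M"
      using that keys_diff[of t u] by blast
    have "v t = v (t - u) \<oplus>\<^bsub>M\<^esub> v u"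
      using v_add[OF k that(2)] by simp
    then show ?thesis
      using v_closed[OF k] v_closed[OF that(2)]
      by (simp add: M.minus_eq M.add.m_assoc M.r_neg)
  qed
  have v_frag: "v (frag_of (a, m)) = a \<odot>\<^bsub>M\<^esub> m" if "a \<in> J" "m \<in> carrier M" for a m
    using that J.Icarr by (simp add: v_def M.finsum_singleton)
  obtain a where a: "a \<in> J" "\<And>b. b \<in> J \<Longrightarrow> \<exists>r\<in>carrier R. b = r \<otimes> a"
    using principal[OF J] by blast
  have aR: "a \<in> carrier R"
    using a(1) by (rule J.Icarr)
  \<comment> \<open>The relation for \<open>0 + 0 = 0\<close> in the second slot is the negative of
    \<open>a \<otimes> 0\<close>.\<close>
  have zero: "frag_of (a, \<zero>\<^bsub>M\<^esub>) \<in> ?H"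
    using H(2)[OF H(4)[OF a(1), of "\<zero>\<^bsub>M\<^esub>" "\<zero>\<^bsub>M\<^esub>"]] by simp
  \<comment> \<open>Reduction to a pure tensor. The induction principle builds \<open>t\<close> from
    generators by differences, so pure tensors have to be subtracted.\<close>
  have "\<exists>m\<in>carrier M. t - frag_of (a, m) \<in> ?H \<and> v t = a \<odot>\<^bsub>M\<^esub> m"
    using t[unfolded carrier_free_Abelian_group_iff]
  proof (induction t rule: free_Abelian_group_induct[consumes 1])
    case 1
    show ?case
      using H(2)[OF zero] aR by (intro bexI[of _ "\<zero>\<^bsub>M\<^esub>"]) (auto simp: v_def M.finsum_empty)
  next
    case (2 x y)
    then obtain m n where m: "m \<in> carrier M" "x - frag_of (a, m) \<in> ?H" "v x = a \<odot>\<^bsub>M\<^esub> m"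
      and n: "n \<in> carrier M" "y - frag_of (a, n) \<in> ?H" "v y = a \<odot>\<^bsub>M\<^esub> n"
      by blast
    have mn: "m \<ominus>\<^bsub>M\<^esub> n \<in> carrier M" and sum: "(m \<ominus>\<^bsub>M\<^esub> n) \<oplus>\<^bsub>M\<^esub> n = m"
      using m(1) n(1) by (simp_all add: M.minus_eq M.add.m_assoc M.l_neg)
    have "frag_of (a, m) - frag_of (a, m \<ominus>\<^bsub>M\<^esub> n) - frag_of (a, n) \<in> ?H"
      using H(4)[OF a(1) mn n(1)] sum by simp
    from H(1)[OF H_diff[OF m(2) n(2)] this] have "x - y - frag_of (a, m \<ominus>\<^bsub>M\<^esub> n) \<in> ?H"
      by (simp add: algebra_simps)
    moreover have "v (x - y) = a \<odot>\<^bsub>M\<^esub> (m \<ominus>\<^bsub>M\<^esub> n)"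
      using v_diff[OF 2(1,2)] m n aR by (simp add: M.minus_eq smult_r_distr smult_r_minus)
    ultimately show ?case
      using mn by blast
  next
    case (3 p)
    then obtain b m where p: "p = (b, m)" "b \<in> J" "m \<in> carrier M"
      by auto
    obtain r where r: "r \<in> carrier R" "b = r \<otimes> a"
      using a(2)[OF p(2)] by blast
    have "v (frag_of p) = a \<odot>\<^bsub>M\<^esub> (r \<odot>\<^bsub>M\<^esub> m)"
      using v_frag[OF p(2,3)] p r aR by (simp add: R.m_comm smult_assoc1)
    then show ?case
      using H(5)[OF r(1) a(1) p(3)] p r by blast
  qed
  then obtain m where m: "m \<in> carrier M" "t - frag_of (a, m) \<in> ?H" "v t = a \<odot>\<^bsub>M\<^esub> m"
    by blast
  have "a \<odot>\<^bsub>M\<^esub> m = \<zero>\<^bsub>M\<^esub>"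
    using m(3) vt by simp
  then consider "a = \<zero>" | "m = \<zero>\<^bsub>M\<^esub>"
    using torsion_free[OF aR m(1)] by blast
  then have "frag_of (a, m) \<in> ?H"
  proof cases
    case 1
    then show ?thesis
      using H(2)[OF H(3)[OF a(1) a(1) m(1)]] by simp
  qed (use zero in simp)
  from H(1)[OF m(2) this] show "t \<in> ?H"
    by simp
qed


section \<open>Families with a basis\<close>

abbreviation mpoly_coset :: "('v, 'a::comm_ring_1) mpoly set \<Rightarrow> ('v, 'a) mpoly \<Rightarrow> ('v, 'a) mpoly set"
  where "mpoly_coset I f \<equiv> a_r_coset mpoly_ring I f"

lemma mem_mpoly_coset_iff: "g \<in> mpoly_coset I f \<longleftrightarrow> g - f \<in> I"
proof -
  have "g \<in> mpoly_coset I f \<longleftrightarrow> (\<exists>h\<in>I. g = h + f)"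
    by (auto simp: a_r_coset_def r_coset_def)
  also have "\<dots> \<longleftrightarrow> g - f \<in> I"
    by (metis add_diff_cancel_right' diff_add_cancel)
  finally show ?thesis .
qed

lemma mpoly_coset_eq_iff:
  assumes "ideal I mpoly_ring"
  shows "mpoly_coset I f = mpoly_coset I g \<longleftrightarrow> f - g \<in> I"
proof
  assume "mpoly_coset I f = mpoly_coset I g"
  moreover have "f \<in> mpoly_coset I f"
    using ideal_mpoly_ringD(1)[OF assms] by (simp add: mem_mpoly_coset_iff)
  ultimately show "f - g \<in> I"
    by (simp add: mem_mpoly_coset_iff)
next
  assume *: "f - g \<in> I"
  have "h - f \<in> I \<longleftrightarrow> h - g \<in> I" for h
    using ideal_mpoly_ringD(2)[OF assms _ *, of "h - f"] ideal_mpoly_ringD(4)[OF assms _ *, of "h - g"]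
    by auto
  then show "mpoly_coset I f = mpoly_coset I g"
    by (auto simp: mem_mpoly_coset_iff)
qed

lemma mpoly_quotient:
  assumes "ideal I mpoly_ring"
  shows "carrier (mpoly_ring Quot I) = range (mpoly_coset I)"
    and "mpoly_coset I f \<oplus>\<^bsub>mpoly_ring Quot I\<^esub> mpoly_coset I g = mpoly_coset I (f + g)"
    and "mpoly_coset I f \<otimes>\<^bsub>mpoly_ring Quot I\<^esub> mpoly_coset I g = mpoly_coset I (f * g)"
    and "\<one>\<^bsub>mpoly_ring Quot I\<^esub> = mpoly_coset I 1"
    and "\<zero>\<^bsub>mpoly_ring Quot I\<^esub> = mpoly_coset I 0"
proof -
  interpret ideal I mpoly_ring by (rule assms)
  show "carrier (mpoly_ring Quot I) = range (mpoly_coset I)"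
    by (auto simp: FactRing_def A_RCOSETS_def' )
  show "mpoly_coset I f \<oplus>\<^bsub>mpoly_ring Quot I\<^esub> mpoly_coset I g = mpoly_coset I (f + g)"
    using a_rcos_sum[of f g] by (simp add: FactRing_def)
  show "mpoly_coset I f \<otimes>\<^bsub>mpoly_ring Quot I\<^esub> mpoly_coset I g = mpoly_coset I (f * g)"
    using rcoset_mult_add[of f g] by (simp add: FactRing_def)
  show "\<one>\<^bsub>mpoly_ring Quot I\<^esub> = mpoly_coset I 1"
    by (simp add: FactRing_def)
  show "\<zero>\<^bsub>mpoly_ring Quot I\<^esub> = mpoly_coset I 0"
    by (auto simp: FactRing_def mem_mpoly_coset_iff)
qed

lemma mpoly_const_add: "mpoly_const (a + b) = mpoly_const a + mpoly_const b"
  by (simp add: mpoly_const_def single_add)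

lemma mpoly_const_diff: "mpoly_const (a - b) = mpoly_const a - mpoly_const b"
  by (simp add: mpoly_const_def single_diff)

text \<open>The scalar multiplication is a union over representatives. All of them give one coset:
  \<open>a' f' - a f\<close> is \<open>(a' - a) f' + a (f' - f)\<close>, and the constants from
  \<open>P\<close> lie in \<open>J\<close>.\<close>

lemma smult_quotient_module:
  assumes P: "ideal P mpoly_ring" and J: "ideal J mpoly_ring" and sub: "mpoly_const ` P \<subseteq> J"
  shows "mpoly_coset P a \<odot>\<^bsub>quotient_module J\<^esub> mpoly_coset J f = mpoly_coset J (mpoly_const a * f)"
proof -
  have "mpoly_coset J (mpoly_const a' * f') = mpoly_coset J (mpoly_const a * f)"
    if "a' \<in> mpoly_coset P a" "f' \<in> mpoly_coset J f" for a' f'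
  proof -
    have "mpoly_const (a' - a) \<in> J"
      using that(1) sub by (auto simp: mem_mpoly_coset_iff)
    from ideal_mpoly_ringD(2)[OF J ideal_mpoly_ringD(3)[OF J this, of f']
        ideal_mpoly_ringD(3)[OF J that(2)[unfolded mem_mpoly_coset_iff], of "mpoly_const a"]]
    show ?thesis
      by (simp add: mpoly_coset_eq_iff[OF J] mpoly_const_diff algebra_simps)
  qed
  moreover have "a \<in> mpoly_coset P a" "f \<in> mpoly_coset J f"
    using ideal_mpoly_ringD(1)[OF P] ideal_mpoly_ringD(1)[OF J] by (simp_all add: mem_mpoly_coset_iff)
  ultimately have "(\<Union>a'\<in>mpoly_coset P a. \<Union>f'\<in>mpoly_coset J f. mpoly_coset J (mpoly_const a' * f')) =
      mpoly_coset J (mpoly_const a * f)"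
    by blast
  then show ?thesis
    by (simp add: quotient_module_def)
qed

lemma module_quotient_module:
  assumes P: "ideal P mpoly_ring" and J: "ideal J mpoly_ring" and sub: "mpoly_const ` P \<subseteq> J"
  shows "Module.module (mpoly_ring Quot P) (quotient_module J)"
proof -
  note smult = smult_quotient_module[OF assms]
  have carrier: "carrier (quotient_module J) = range (mpoly_coset J)"
    and add: "mpoly_coset J f \<oplus>\<^bsub>quotient_module J\<^esub> mpoly_coset J g = mpoly_coset J (f + g)"
    and zero: "\<zero>\<^bsub>quotient_module J\<^esub> = mpoly_coset J 0" for f g
    by (simp_all add: quotient_module_def mpoly_quotient[OF J])
  show ?thesis
  proof (rule moduleI)
    show "cring (mpoly_ring Quot P)"
      by (rule ideal.quotient_is_cring[OF P cring_mpoly_ring])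
    show "abelian_group (quotient_module J)"
    proof (rule abelian_groupI)
      fix A assume "A \<in> carrier (quotient_module J)"
      then obtain f where "A = mpoly_coset J f"
        by (auto simp: carrier)
      then have "mpoly_coset J (- f) \<oplus>\<^bsub>quotient_module J\<^esub> A = \<zero>\<^bsub>quotient_module J\<^esub>"
        by (simp add: add zero)
      then show "\<exists>B\<in>carrier (quotient_module J). B \<oplus>\<^bsub>quotient_module J\<^esub> A = \<zero>\<^bsub>quotient_module J\<^esub>"
        by (auto simp: carrier)
    qed (auto simp: carrier add zero add_ac)
  qed (auto simp: carrier add smult mpoly_quotient[OF P] mpoly_const_add mpoly_const_1
      mpoly_const_mult[symmetric] algebra_simps)
qed

text \<open>Division with remainder in \<complex>[t], carried over by \<open>line_poly\<close>: an
  element of least degree among the nonzero ones generates.\<close>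

lemma line_quotient_principal:
  assumes "ideal J (mpoly_ring Quot line_ideal)"
  shows "\<exists>A\<in>J. \<forall>B\<in>J. \<exists>R\<in>carrier (mpoly_ring Quot line_ideal). B = R \<otimes>\<^bsub>mpoly_ring Quot line_ideal\<^esub> A"
proof -
  let ?Q = "mpoly_ring Quot line_ideal"
  note quot = mpoly_quotient[OF ideal_line_ideal]
  note coset_eq = mpoly_coset_eq_iff[OF ideal_line_ideal]
  interpret J: ideal J ?Q by (rule assms)
  have zero: "mpoly_coset line_ideal 0 \<in> J"
    using additive_subgroup.zero_closed[OF J.is_additive_subgroup] by (simp only: quot)
  have carrier: "\<exists>f. A = mpoly_coset line_ideal f" if "A \<in> J" for A
    using J.Icarr[OF that] by (auto simp: quot)
  have lc: "mpoly_coset line_ideal (f - g * h) \<in> J"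
    if "mpoly_coset line_ideal f \<in> J" "mpoly_coset line_ideal h \<in> J" for f g h
  proof -
    have "mpoly_coset line_ideal (- g) \<otimes>\<^bsub>?Q\<^esub> mpoly_coset line_ideal h \<in> J"
      by (rule J.I_l_closed[OF that(2)]) (simp add: quot)
    from additive_subgroup.a_closed[OF J.is_additive_subgroup that(1) this] show ?thesis
      by (simp add: quot)
  qed
  show ?thesis
  proof (cases "\<exists>f. mpoly_coset line_ideal f \<in> J \<and> line_poly f \<noteq> 0")
    case False
    have "B = mpoly_coset line_ideal 0 \<otimes>\<^bsub>?Q\<^esub> mpoly_coset line_ideal 0" if B: "B \<in> J" for B
    proof -
      obtain f where f: "B = mpoly_coset line_ideal f"
        using carrier[OF B] by blast
      then have "f \<in> line_ideal"
        using False B by (auto simp: in_line_ideal_iff)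
      then show ?thesis
        by (simp add: f quot coset_eq)
    qed
    moreover have "mpoly_coset line_ideal 0 \<in> carrier ?Q"
      by (simp add: quot)
    ultimately show ?thesis
      using zero by blast
  next
    case True
    then obtain h where h: "mpoly_coset line_ideal h \<in> J" "line_poly h \<noteq> 0"
      and min: "\<And>f. mpoly_coset line_ideal f \<in> J \<Longrightarrow> line_poly f \<noteq> 0 \<Longrightarrow>
        degree (line_poly h) \<le> degree (line_poly f)"
      using ex_has_least_nat[of "\<lambda>f. mpoly_coset line_ideal f \<in> J \<and> line_poly f \<noteq> 0" _
          "\<lambda>f. degree (line_poly f)"] by blast
    have "\<exists>R\<in>carrier ?Q. B = R \<otimes>\<^bsub>?Q\<^esub> mpoly_coset line_ideal h" if B: "B \<in> J" for B
    proof -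
      obtain f where f: "B = mpoly_coset line_ideal f"
        using carrier[OF B] by blast
      obtain g where g: "line_poly g = line_poly f div line_poly h"
        using line_poly_surj by blast
      have rem: "line_poly (f - g * h) = line_poly f mod line_poly h"
        by (simp add: g minus_div_mult_eq_mod)
      have "line_poly (f - g * h) = 0"
        using min[OF lc[OF B[unfolded f] h(1), of g]] degree_mod_less[OF h(2), of "line_poly f"]
        by (metis not_le rem)
      then have "B = mpoly_coset line_ideal g \<otimes>\<^bsub>?Q\<^esub> mpoly_coset line_ideal h"
        by (simp add: f quot coset_eq in_line_ideal_iff)
      then show ?thesis
        by (auto simp: quot)
    qed
    then show ?thesis
      using h(1) by blast
  qed
qed


text \<open>The ideal of the total space, the union of all \<open>{t} \<times> K t\<close>. That its
  fibre at \<open>t\<close> is the whole vanishing ideal of \<open>K t\<close> is not automatic;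
  this is where \<open>based_family\<close> enters.\<close>

definition family_ideal :: "(complex \<Rightarrow> (complex ^ 'n) set) \<Rightarrow> ('n, base_poly) mpoly set"
  where "family_ideal K = {f. \<forall>t. \<forall>x\<in>K t. family_eval (line_point t) (($) x) f = 0}"

text \<open>The ideal of the total space in the chart \<open>x\<^sub>i \<noteq> 0\<close>, whose
  points are normalized to \<open>x\<^sub>i = 1\<close>.\<close>

definition dehomogenized_family_ideal ::
    "(complex \<Rightarrow> (complex ^ 'n) set) \<Rightarrow> 'n \<Rightarrow> ('n, base_poly) mpoly set"
  where "dehomogenized_family_ideal K i =
    {f. \<forall>t. \<forall>x\<in>K t. x $ i = 1 \<longrightarrow> family_eval (line_point t) (($) x) f = 0}"

text \<open>The degree is raised by one more than necessary, so that the result vanishes where \<open>x\<^sub>i = 0\<close>.\<close>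

definition homogenize :: "'v \<Rightarrow> ('v, 'a::comm_ring_1) mpoly \<Rightarrow> ('v, 'a) mpoly"
  where "homogenize i f = (\<Sum>d\<le>total_degree f. mpoly_var i ^ (Suc (total_degree f) - d) * homogeneous_part d f)"

lemma family_eval_scale_homogeneous_part:
  "family_eval c (\<lambda>j. s * x j) (homogeneous_part d f) = s ^ d * family_eval c x (homogeneous_part d f)"
  by (simp add: family_eval_def homogeneous_part_map[symmetric] mpoly_eval_scale_homogeneous_part)

lemma family_eval_homogenize:
  assumes "x i \<noteq> 0"
  shows "family_eval c x (homogenize i f) =
    x i ^ Suc (total_degree f) * family_eval c (\<lambda>j. inverse (x i) * x j) f"
proof -
  let ?D = "Suc (total_degree f)" and ?y = "\<lambda>j. inverse (x i) * x j"
  have x: "x = (\<lambda>j. x i * ?y j)"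
    using assms by (simp add: field_simps)
  have "family_eval c x (homogenize i f) =
      (\<Sum>d\<le>total_degree f. x i ^ (?D - d) * family_eval c x (homogeneous_part d f))"
    by (simp add: homogenize_def)
  also have "\<dots> = (\<Sum>d\<le>total_degree f. x i ^ ?D * family_eval c ?y (homogeneous_part d f))"
  proof (rule sum.cong)
    fix d assume "d \<in> {..total_degree f}"
    then have "x i ^ ?D = x i ^ (?D - d) * x i ^ d"
      by (simp add: power_add[symmetric])
    moreover have "family_eval c x (homogeneous_part d f) = x i ^ d * family_eval c ?y (homogeneous_part d f)"
      using family_eval_scale_homogeneous_part[of c "x i" ?y d f] x by simp
    ultimately show "x i ^ (?D - d) * family_eval c x (homogeneous_part d f) =
        x i ^ ?D * family_eval c ?y (homogeneous_part d f)"
      by (simp only: mult.assoc)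
  qed simp
  also have "\<dots> = x i ^ ?D * family_eval c ?y (\<Sum>d\<le>total_degree f. homogeneous_part d f)"
    by (simp add: sum_distrib_left)
  finally show ?thesis
    by (simp add: sum_homogeneous_part)
qed

lemma family_eval_homogenize_0: "x i = 0 \<Longrightarrow> family_eval c x (homogenize i f) = 0"
  by (auto simp: homogenize_def power_0_left)

lemma ideal_family_ideal: "ideal (family_ideal K) mpoly_ring"
  by (rule ideal_mpoly_ringI) (auto simp: family_ideal_def)

lemma ideal_dehomogenized_family_ideal: "ideal (dehomogenized_family_ideal K i) mpoly_ring"
  by (rule ideal_mpoly_ringI) (auto simp: dehomogenized_family_ideal_def)

lemma complex_cone_scale:
  assumes "complex_cone X" "v \<in> X" "s \<noteq> 0"
  obtains w where "w \<in> X" "($) w = (\<lambda>i. s * v $ i)"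
proof
  show "s *s v \<in> X"
    using assms by (auto simp: complex_cone_def)
qed auto

text \<open>A point with \<open>x\<^sub>i \<noteq> 0\<close> is rescaled into the chart. At the
  other points the homogenization vanishes, since each of its summands keeps a factor
  \<open>x\<^sub>i\<close>.\<close>

lemma homogenize_in_family_ideal_iff:
  assumes "\<And>t. complex_cone (K t)"
  shows "homogenize i f \<in> family_ideal K \<longleftrightarrow> f \<in> dehomogenized_family_ideal K i"
proof
  assume *: "homogenize i f \<in> family_ideal K"
  show "f \<in> dehomogenized_family_ideal K i"
    unfolding dehomogenized_family_ideal_def
  proof safe
    fix t x assume x: "x \<in> K t" "x $ i = 1"
    with * have "family_eval (line_point t) (($) x) (homogenize i f) = 0"
      by (auto simp: family_ideal_def)
    then show "family_eval (line_point t) (($) x) f = 0"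
      using x(2) by (simp add: family_eval_homogenize)
  qed
next
  assume *: "f \<in> dehomogenized_family_ideal K i"
  show "homogenize i f \<in> family_ideal K"
    unfolding family_ideal_def
  proof safe
    fix t x assume x: "x \<in> K t"
    show "family_eval (line_point t) (($) x) (homogenize i f) = 0"
    proof (cases "x $ i = 0")
      case False
      then obtain y where y: "y \<in> K t" "($) y = (\<lambda>j. inverse (x $ i) * x $ j)"
        using complex_cone_scale[OF assms x] by (metis inverse_nonzero_iff_nonzero)
      then have "y $ i = 1"
        using False by simp
      with y * have "family_eval (line_point t) (($) y) f = 0"
        unfolding dehomogenized_family_ideal_def by blast
      then show ?thesis
        using False y by (simp add: family_eval_homogenize)
    qed (simp add: family_eval_homogenize_0)
  qed
qed

text \<open>Modulo \<open>x\<^sub>i - 1\<close> a polynomial agrees with its homogenization, and the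
  latter lies in the family ideal.\<close>

lemma chart_ideal_family_ideal:
  assumes "\<And>t. complex_cone (K t)"
  shows "chart_ideal (family_ideal K) i = dehomogenized_family_ideal K i"
proof
  show "chart_ideal (family_ideal K) i \<subseteq> dehomogenized_family_ideal K i"
    unfolding chart_ideal_def
    by (rule genideal_mpoly_ring_subset[OF ideal_dehomogenized_family_ideal])
       (auto simp: family_ideal_def dehomogenized_family_ideal_def)
  show "dehomogenized_family_ideal K i \<subseteq> chart_ideal (family_ideal K) i"
  proof
    fix f assume f: "f \<in> dehomogenized_family_ideal K i"
    have C: "ideal (chart_ideal (family_ideal K) i) mpoly_ring"
      unfolding chart_ideal_def by (rule ideal_genideal_mpoly_ring)
    have generators: "family_ideal K \<union> {mpoly_var i - 1} \<subseteq> chart_ideal (family_ideal K) i"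
      unfolding chart_ideal_def by (rule genideal_mpoly_ring_superset)
    have "homogenize i f \<in> family_ideal K"
      using f homogenize_in_family_ideal_iff[of K, OF assms] by simp
    then have "homogenize i f \<in> chart_ideal (family_ideal K) i"
      using generators by blast
    moreover have "f - homogenize i f \<in> chart_ideal (family_ideal K) i"
    proof -
      have x1: "mpoly_var i - 1 \<in> chart_ideal (family_ideal K) i"
        using generators by blast
      let ?D = "Suc (total_degree f)"
      have "f - homogenize i f =
          (\<Sum>d\<le>total_degree f. homogeneous_part d f) - homogenize i f"
        by (simp add: sum_homogeneous_part)
      also have "\<dots> = (\<Sum>d\<le>total_degree f. (1 - mpoly_var i ^ (?D - d)) * homogeneous_part d f)"
        by (simp add: homogenize_def sum_subtractf algebra_simps)
      also have "\<dots> \<in> chart_ideal (family_ideal K) i"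
      proof (rule ideal_mpoly_ring_sum[OF C])
        fix d
        have "(1 - mpoly_var i ^ (?D - d)) * homogeneous_part d f =
            (- (\<Sum>k<?D - d. mpoly_var i ^ k) * homogeneous_part d f) * (mpoly_var i - 1)"
          unfolding one_diff_power_eq by (simp add: algebra_simps)
        then show "(1 - mpoly_var i ^ (?D - d)) * homogeneous_part d f \<in> chart_ideal (family_ideal K) i"
          using ideal_mpoly_ringD(3)[OF C x1] by metis
      qed
      finally show ?thesis .
    qed
    ultimately show "f \<in> chart_ideal (family_ideal K) i"
      using ideal_mpoly_ringD(2)[OF C] by (metis add.commute diff_add_cancel)
  qed
qed

lemma family_over_family_ideal:
  fixes K :: "complex \<Rightarrow> (complex ^ 'n::finite) set"
  assumes "\<And>t. complex_cone (K t)"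
  shows "family_over line_ideal (family_ideal K)"
  unfolding family_over_def homogeneous_ideal_def
proof (intro conjI)
  show "ideal (family_ideal K) mpoly_ring"
    by (rule ideal_family_ideal)
  show "mpoly_const ` line_ideal \<subseteq> family_ideal K"
    by (auto simp: family_ideal_def line_ideal_def)
  have "homogeneous_part d f \<in> family_ideal K" if f: "f \<in> family_ideal K" for f d
    unfolding family_ideal_def
  proof safe
    fix t x assume x: "x \<in> K t"
    have "mpoly_eval (\<lambda>i. s * x $ i) (Poly_Mapping.map (mpoly_eval (line_point t)) f) = 0"
      if s: "s \<noteq> 0" for s
    proof -
      obtain w where w: "w \<in> K t" "($) w = (\<lambda>i. s * x $ i)"
        using complex_cone_scale[OF assms x s] by blast
      then have "family_eval (line_point t) (($) w) f = 0"
        using f unfolding family_ideal_def by blast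
      then show ?thesis
        by (simp add: family_eval_def w)
    qed
    then show "family_eval (line_point t) (($) x) (homogeneous_part d f) = 0"
      unfolding family_eval_def homogeneous_part_map[of "mpoly_eval (line_point t)", OF mpoly_eval_0, symmetric]
      by (rule mpoly_eval_homogeneous_part_eq_0)
  qed
  then show "family_ideal K = genideal mpoly_ring {f \<in> family_ideal K. homogeneous f}"
    by (rule homogeneous_generation[OF ideal_family_ideal, symmetric])
qed

text \<open>
  The polynomials \<open>e m\<close>, \<open>m \<in> B\<close>, represent a basis of the coordinate ring of the family over
  \<open>\<complex>[t]\<close> that remains a basis in every fibre.
\<close>

locale based_family =
  fixes K :: "complex \<Rightarrow> (complex ^ 'n::finite) set" and e :: "'b \<Rightarrow> ('n, complex) mpoly" and B :: "'b set"
  assumes complex_cone: "complex_cone (K t)"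
    and spanning: "\<exists>F r. finite F \<and> F \<subseteq> B \<and> (\<forall>t. \<forall>x\<in>K t.
      family_eval (line_point t) (($) x) f = (\<Sum>m\<in>F. poly (r m) t * mpoly_eval (($) x) (e m)))"
    and independent: "finite F \<Longrightarrow> F \<subseteq> B \<Longrightarrow>
      (\<And>x. x \<in> K t \<Longrightarrow> (\<Sum>m\<in>F. \<beta> m * mpoly_eval (($) x) (e m)) = 0) \<Longrightarrow> m \<in> F \<Longrightarrow> \<beta> m = 0"
begin

text \<open>The coefficients of \<open>a f\<close> are those of \<open>f\<close> times
  \<open>line_poly a\<close>. Independence in each fibre makes all their values vanish, and
  \<complex>[t] has no zero divisors.\<close>

lemma torsion_free:
  assumes "mpoly_const a * f \<in> family_ideal K" "a \<notin> line_ideal"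
  shows "f \<in> family_ideal K"
proof -
  obtain F r where F: "finite F" "F \<subseteq> B" and
    r: "\<And>t x. x \<in> K t \<Longrightarrow> family_eval (line_point t) (($) x) f = (\<Sum>m\<in>F. poly (r m) t * mpoly_eval (($) x) (e m))"
    using spanning by metis
  have "poly (line_poly a * r m) t = 0" if "m \<in> F" for m t
  proof -
    have "(\<Sum>m\<in>F. poly (line_poly a * r m) t * mpoly_eval (($) x) (e m)) = 0" if "x \<in> K t" for x
    proof -
      have "(\<Sum>m\<in>F. poly (line_poly a * r m) t * mpoly_eval (($) x) (e m)) =
          family_eval (line_point t) (($) x) (mpoly_const a * f)"
        by (simp add: r[OF that] poly_line_poly sum_distrib_left mult.assoc)
      also have "\<dots> = 0"
        using assms(1) that unfolding family_ideal_def by blast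
      finally show ?thesis .
    qed
    from independent[OF F this \<open>m \<in> F\<close>] show ?thesis .
  qed
  then have "line_poly a * r m = 0" if "m \<in> F" for m
    using that by (metis poly_all_0_iff_0)
  then have "r m = 0" if "m \<in> F" for m
    using that assms(2) by (auto simp: in_line_ideal_iff)
  then show ?thesis
    by (auto simp: family_ideal_def r)
qed

lemma flat_family: "flat_family line_ideal (family_ideal K)"
  unfolding flat_family_def
proof (intro conjI allI)
  show "family_over line_ideal (family_ideal K)"
    by (rule family_over_family_ideal[OF complex_cone])
  fix i
  let ?J = "chart_ideal (family_ideal K) i"
  have J: "?J = dehomogenized_family_ideal K i"
    by (rule chart_ideal_family_ideal[OF complex_cone])
  have ideal: "ideal ?J mpoly_ring" and sub: "mpoly_const ` line_ideal \<subseteq> ?J"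
    unfolding J by (rule ideal_dehomogenized_family_ideal)
      (auto simp: dehomogenized_family_ideal_def line_ideal_def)
  show "flat_module (mpoly_ring Quot line_ideal) (quotient_module ?J)"
  proof (rule flat_module_principal)
    show "Module.module (mpoly_ring Quot line_ideal) (quotient_module ?J)"
      by (rule module_quotient_module[OF ideal_line_ideal ideal sub])
    show "\<exists>A\<in>L. \<forall>B\<in>L. \<exists>R\<in>carrier (mpoly_ring Quot line_ideal). B = R \<otimes>\<^bsub>mpoly_ring Quot line_ideal\<^esub> A"
      if "ideal L (mpoly_ring Quot line_ideal)" for L
      by (rule line_quotient_principal[OF that])
    fix A M
    assume "A \<in> carrier (mpoly_ring Quot line_ideal)" "M \<in> carrier (quotient_module ?J)"
    then obtain a f where a: "A = mpoly_coset line_ideal a" and f: "M = mpoly_coset ?J f"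
      by (auto simp: quotient_module_def mpoly_quotient[OF ideal] mpoly_quotient[OF ideal_line_ideal])
    have zero: "\<zero>\<^bsub>quotient_module ?J\<^esub> = mpoly_coset ?J 0"
      by (simp add: quotient_module_def mpoly_quotient[OF ideal])
    assume "A \<odot>\<^bsub>quotient_module ?J\<^esub> M = \<zero>\<^bsub>quotient_module ?J\<^esub>"
    then have af: "mpoly_const a * f \<in> ?J"
      by (simp add: a f smult_quotient_module[OF ideal_line_ideal ideal sub] zero mpoly_coset_eq_iff[OF ideal])
    show "A = \<zero>\<^bsub>mpoly_ring Quot line_ideal\<^esub> \<or> M = \<zero>\<^bsub>quotient_module ?J\<^esub>"
    proof (cases "a \<in> line_ideal")
      case True
      then show ?thesis
        by (simp add: a mpoly_quotient[OF ideal_line_ideal] mpoly_coset_eq_iff[OF ideal_line_ideal])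
    next
      case False
      \<comment> \<open>Torsion-freeness is known for the homogeneous ideal, so the relation in the
        chart is homogenized first.\<close>
      have "mpoly_const a * homogenize i f \<in> family_ideal K"
        unfolding family_ideal_def
      proof safe
        fix t x assume x: "x \<in> K t"
        show "family_eval (line_point t) (($) x) (mpoly_const a * homogenize i f) = 0"
        proof (cases "x $ i = 0")
          case False
          then obtain y where y: "y \<in> K t" "($) y = (\<lambda>j. inverse (x $ i) * x $ j)"
            using complex_cone_scale[OF complex_cone x] by (metis inverse_nonzero_iff_nonzero)
          then have "y $ i = 1"
            using False by simp
          with y af have "family_eval (line_point t) (($) y) (mpoly_const a * f) = 0"
            unfolding J dehomogenized_family_ideal_def by blast
          then show ?thesis
            using False y by (simp add: family_eval_homogenize)
        qed (simp add: family_eval_homogenize_0)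
      qed
      then have "homogenize i f \<in> family_ideal K"
        using torsion_free False by blast
      then have "f \<in> ?J"
        using homogenize_in_family_ideal_iff[of K, OF complex_cone] J by simp
      then show ?thesis
        by (simp add: f zero mpoly_coset_eq_iff[OF ideal])
    qed
  qed
qed

text \<open>For the harder inclusion \<open>f\<close> is lifted with constant coefficients. As
  \<open>f\<close> vanishes on \<open>K t\<close>, the coefficients \<open>r m\<close> of the
  expansion of the lift vanish at \<open>t\<close>. Subtracting this expansion makes the lift vanish
  on the whole family and changes nothing over \<open>t\<close>.\<close>

lemma fiber_family_ideal: "fiber (line_point t) (family_ideal K) = vanishing_ideal (K t)"
proof
  show "fiber (line_point t) (family_ideal K) \<subseteq> vanishing_ideal (K t)"
    by (auto simp: fiber_def vanishing_ideal_cone[OF complex_cone] family_ideal_def family_eval_def)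
  show "vanishing_ideal (K t) \<subseteq> fiber (line_point t) (family_ideal K)"
  proof
    fix f assume f: "f \<in> vanishing_ideal (K t)"
    define lift where "lift = (Poly_Mapping.map mpoly_const :: ('n, complex) mpoly \<Rightarrow> ('n, base_poly) mpoly)"
    let ?\<phi> = "\<lambda>s. Poly_Mapping.map (mpoly_eval (line_point s)) :: ('n, base_poly) mpoly \<Rightarrow> ('n, complex) mpoly"
    have \<phi>_lift: "?\<phi> s (lift h) = h" for s h
      unfolding lift_def by (rule poly_mapping_eqI) (simp add: lookup_map mpoly_const_def mpoly_eval_single)
    then have eval_lift: "family_eval (line_point s) x (lift h) = mpoly_eval x h" for s x h
      by (simp add: family_eval_def)
    obtain F r where F: "finite F" "F \<subseteq> B" and
      r: "\<And>t x. x \<in> K t \<Longrightarrow> family_eval (line_point t) (($) x) (lift f) =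
        (\<Sum>m\<in>F. poly (r m) t * mpoly_eval (($) x) (e m))"
      using spanning by metis
    have r0: "poly (r m) t = 0" if "m \<in> F" for m
      by (rule independent[where t = t, OF F _ that])
         (use f in \<open>simp add: r[symmetric] eval_lift vanishing_ideal_cone[OF complex_cone]\<close>)
    define b where "b m = (SOME b. line_poly b = r m)" for m
    have b: "line_poly (b m) = r m" for m
      unfolding b_def by (rule someI_ex[OF line_poly_surj])
    define g where "g = lift f - (\<Sum>m\<in>F. mpoly_const (b m) * lift (e m))"
    have "g \<in> family_ideal K"
      unfolding family_ideal_def
    proof safe
      fix s x assume "x \<in> K s"
      from r[OF this] show "family_eval (line_point s) (($) x) g = 0"
        by (simp add: g_def eval_lift poly_line_poly[symmetric] b)
    qed
    moreover have "?\<phi> t g = f"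
    proof -
      have \<phi>_sum: "?\<phi> t (\<Sum>m\<in>A. h m) = (\<Sum>m\<in>A. ?\<phi> t (h m))" for A :: "'b set" and h
        by (rule poly_mapping_eqI) (simp add: lookup_map lookup_sum)
      have "?\<phi> t g = ?\<phi> t (lift f) - ?\<phi> t (\<Sum>m\<in>F. mpoly_const (b m) * lift (e m))"
        unfolding g_def by (rule poly_mapping_eqI) (simp add: lookup_map lookup_minus)
      also have "?\<phi> t (\<Sum>m\<in>F. mpoly_const (b m) * lift (e m)) = (\<Sum>m\<in>F. 0)"
        unfolding \<phi>_sum
      proof (rule sum.cong)
        fix m assume "m \<in> F"
        have "?\<phi> t (mpoly_const (b m)) = 0"
          using r0[OF \<open>m \<in> F\<close>] by (simp add: mpoly_const_def poly_line_poly[symmetric] b)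
        then show "?\<phi> t (mpoly_const (b m) * lift (e m)) = 0"
          by (simp add: map_mult)
      qed simp
      finally show ?thesis
        by (simp add: \<phi>_lift)
    qed
    ultimately show "f \<in> fiber (line_point t) (family_ideal K)"
      unfolding fiber_def by blast
  qed
qed

lemma flat_deformation:
  assumes "\<And>t. t \<noteq> 0 \<Longrightarrow> \<exists>g :: complex ^ 'n ^ 'n. invertible g \<and> K t = (*v) g ` Y"
  shows "flat_deformation (K 0) Y"
  unfolding flat_deformation_def
proof (intro exI[of _ line_ideal] exI[of _ "family_ideal K"] bexI[of _ "line_point 0"] conjI ballI)
  show "smooth_connected_curve line_ideal"
    by (rule smooth_connected_curve_line)
  show "flat_family line_ideal (family_ideal K)"
    by (rule flat_family)
  show "same_subscheme (fiber (line_point 0) (family_ideal K)) (vanishing_ideal (K 0))"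
    by (simp add: fiber_family_ideal same_subscheme_def)
  show "line_point 0 \<in> base_points line_ideal"
    by (simp add: base_points_line_ideal)
  fix c assume "c \<in> base_points line_ideal - {line_point 0}"
  then obtain t where t: "c = line_point t" "t \<noteq> 0"
    by (auto simp: base_points_line_ideal)
  obtain g :: "complex ^ 'n ^ 'n" where "invertible g" "K t = (*v) g ` Y"
    using assms[OF t(2)] by blast
  then show "\<exists>g :: complex ^ 'n ^ 'n. invertible g \<and>
      same_subscheme (fiber c (family_ideal K)) (vanishing_ideal ((*v) g ` Y))"
    by (metis fiber_family_ideal same_subscheme_def t(1))
qed

end


section \<open>The exterior algebra\<close>

definition inversions :: "'m::{finite,linorder} set \<Rightarrow> 'm set \<Rightarrow> nat"
  where "inversions A B = card {(i, j). i \<in> A \<and> j \<in> B \<and> j < i}"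

lemma inversions_empty [simp]: "inversions {} B = 0" "inversions A {} = 0"
  by (simp_all add: inversions_def)

lemma inversions_union_left:
  "A \<inter> B = {} \<Longrightarrow> inversions (A \<union> B) C = inversions A C + inversions B C"
  unfolding inversions_def by (subst card_Un_disjoint[symmetric]) (auto intro!: arg_cong[of _ _ card])

lemma inversions_union_right:
  "B \<inter> C = {} \<Longrightarrow> inversions A (B \<union> C) = inversions A B + inversions A C"
  unfolding inversions_def by (subst card_Un_disjoint[symmetric]) (auto intro!: arg_cong[of _ _ card])

lemma inversions_singleton_left: "inversions {i} B = card {j \<in> B. j < i}"
  unfolding inversions_def
  by (rule bij_betw_same_card[of snd]) (auto simp: bij_betw_def inj_on_def image_iff)

lemma wedge_nth:
  "(\<alpha> \<^bold>\<and> \<beta>) $ S = (\<Sum>T\<in>Pow S. (-1) ^ inversions T (S - T) * \<alpha> $ T * \<beta> $ (S - T))"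
  by (simp add: wedge_def inversions_def)

lemma wedge_add_left: "(\<alpha> + \<beta>) \<^bold>\<and> \<gamma> = \<alpha> \<^bold>\<and> \<gamma> + \<beta> \<^bold>\<and> \<gamma>"
  by (simp add: vec_eq_iff wedge_nth algebra_simps sum.distrib)

lemma wedge_add_right: "\<alpha> \<^bold>\<and> (\<beta> + \<gamma>) = \<alpha> \<^bold>\<and> \<beta> + \<alpha> \<^bold>\<and> \<gamma>"
  by (simp add: vec_eq_iff wedge_nth algebra_simps sum.distrib)

lemma wedge_scale_left: "(c *s \<alpha>) \<^bold>\<and> \<beta> = c *s (\<alpha> \<^bold>\<and> \<beta>)"
  by (simp add: vec_eq_iff wedge_nth sum_distrib_left mult_ac)

lemma wedge_scale_right: "\<alpha> \<^bold>\<and> (c *s \<beta>) = c *s (\<alpha> \<^bold>\<and> \<beta>)"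
  by (simp add: vec_eq_iff wedge_nth sum_distrib_left mult_ac)

lemma wedge_zero_left [simp]: "0 \<^bold>\<and> \<beta> = 0"
  by (simp add: vec_eq_iff wedge_nth)

lemma wedge_zero_right [simp]: "\<alpha> \<^bold>\<and> 0 = 0"
  by (simp add: vec_eq_iff wedge_nth)

lemma wedge_sum_left: "(\<Sum>i\<in>I. f i) \<^bold>\<and> \<beta> = (\<Sum>i\<in>I. f i \<^bold>\<and> \<beta>)"
  by (induction I rule: infinite_finite_induct) (simp_all add: wedge_add_left)

lemma wedge_sum_right: "\<alpha> \<^bold>\<and> (\<Sum>i\<in>I. f i) = (\<Sum>i\<in>I. \<alpha> \<^bold>\<and> f i)"
  by (induction I rule: infinite_finite_induct) (simp_all add: wedge_add_right)

text \<open>Both sides are sums over the splittings of \<open>S\<close> into three blocks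
  \<open>U\<close>, \<open>V\<close>, \<open>W\<close>, and either sign counts the inversions
  between all pairs of blocks.\<close>

lemma wedge_assoc: "(\<alpha> \<^bold>\<and> \<beta>) \<^bold>\<and> \<gamma> = \<alpha> \<^bold>\<and> (\<beta> \<^bold>\<and> \<gamma>)"
proof -
  have "((\<alpha> \<^bold>\<and> \<beta>) \<^bold>\<and> \<gamma>) $ S = (\<alpha> \<^bold>\<and> (\<beta> \<^bold>\<and> \<gamma>)) $ S" for S
  proof -
    have "((\<alpha> \<^bold>\<and> \<beta>) \<^bold>\<and> \<gamma>) $ S =
        (\<Sum>T\<in>Pow S. \<Sum>U\<in>Pow T. (-1) ^ inversions T (S - T) *
          ((-1) ^ inversions U (T - U) * \<alpha> $ U * \<beta> $ (T - U)) * \<gamma> $ (S - T))"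
      by (simp add: wedge_nth sum_distrib_left sum_distrib_right)
    also have "\<dots> = (\<Sum>(T, U)\<in>Sigma (Pow S) Pow. (-1) ^ inversions T (S - T) *
          ((-1) ^ inversions U (T - U) * \<alpha> $ U * \<beta> $ (T - U)) * \<gamma> $ (S - T))"
      by (rule sum.Sigma) auto
    also have "\<dots> = (\<Sum>(U, V)\<in>Sigma (Pow S) (\<lambda>U. Pow (S - U)). (-1) ^ inversions U (S - U) *
          \<alpha> $ U * ((-1) ^ inversions V (S - U - V) * \<beta> $ V * \<gamma> $ (S - U - V)))"
    proof (rule sum.reindex_bij_witness[of _ "\<lambda>(U, V). (U \<union> V, U)" "\<lambda>(T, U). (U, T - U)"], goal_cases)
      case (5 x)
      then obtain T U where x: "x = (T, U)" "T \<subseteq> S" "U \<subseteq> T"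
        by auto
      define V W where "V = T - U" and "W = S - T"
      have sets: "T - U = V" "S - T = W" "S - U = V \<union> W" "V \<union> W - V = W" "T = U \<union> V"
        using x by (auto simp: V_def W_def)
      have disj: "U \<inter> V = {}" "V \<inter> W = {}"
        using x by (auto simp: V_def W_def)
      have "inversions T W + inversions U V = inversions U (V \<union> W) + inversions V W"
        by (simp add: sets(5) inversions_union_left inversions_union_right disj)
      then have sign: "((-1) :: complex) ^ inversions T W * (-1) ^ inversions U V =
          (-1) ^ inversions U (V \<union> W) * (-1) ^ inversions V W"
        by (simp only: power_add[symmetric])
      have "(-1) ^ inversions U (V \<union> W) * \<alpha> $ U * ((-1) ^ inversions V W * \<beta> $ V * \<gamma> $ W) =
          ((-1) ^ inversions U (V \<union> W) * (-1) ^ inversions V W) * (\<alpha> $ U * \<beta> $ V * \<gamma> $ W)"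
        by (simp only: mult_ac)
      also have "\<dots> = (-1) ^ inversions T W * ((-1) ^ inversions U V * \<alpha> $ U * \<beta> $ V) * \<gamma> $ W"
        unfolding sign[symmetric] by (simp only: mult_ac)
      finally show ?case
        by (simp only: x(1) prod.case sets(1-4))
    qed auto
    also have "\<dots> = (\<Sum>U\<in>Pow S. \<Sum>V\<in>Pow (S - U). (-1) ^ inversions U (S - U) *
          \<alpha> $ U * ((-1) ^ inversions V (S - U - V) * \<beta> $ V * \<gamma> $ (S - U - V)))"
      by (rule sum.Sigma[symmetric]) auto
    also have "\<dots> = (\<alpha> \<^bold>\<and> (\<beta> \<^bold>\<and> \<gamma>)) $ S"
      by (simp add: wedge_nth sum_distrib_left)
    finally show ?thesis .
  qed
  then show ?thesis
    by (simp add: vec_eq_iff)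
qed

lemma wedge_axis:
  "axis A 1 \<^bold>\<and> axis B 1 = (if A \<inter> B = {} then (-1) ^ inversions A B *s axis (A \<union> B) 1 else 0)"
proof -
  have "(axis A 1 \<^bold>\<and> axis B 1) $ S =
    (if A \<inter> B = {} then (-1) ^ inversions A B *s axis (A \<union> B) 1 else 0 :: 'a ext) $ S" for S
  proof -
    have "(axis A 1 \<^bold>\<and> axis B 1) $ S =
        (\<Sum>T\<in>Pow S. if T = A then if S - A = B then (-1) ^ inversions A B else 0 else 0)"
      unfolding wedge_nth by (rule sum.cong) (auto simp: axis_def)
    also have "\<dots> = (if A \<subseteq> S \<and> S - A = B then (-1) ^ inversions A B else 0)"
      by (simp add: sum.delta)
    also have "A \<subseteq> S \<and> S - A = B \<longleftrightarrow> A \<inter> B = {} \<and> S = A \<union> B"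
      by auto
    finally show ?thesis
      by (auto simp: axis_def)
  qed
  then show ?thesis
    by (simp add: vec_eq_iff)
qed

lemma ext_one_wedge [simp]: "ext_one \<^bold>\<and> \<alpha> = \<alpha>"
proof -
  have "ext_one \<^bold>\<and> (\<Sum>S\<in>UNIV. \<alpha> $ S *s axis S 1) = (\<Sum>S\<in>UNIV. \<alpha> $ S *s axis S 1)"
    by (simp add: ext_one_def wedge_sum_right wedge_scale_right wedge_axis)
  then show ?thesis
    by (simp add: basis_expansion)
qed

lemma wedge_ext_one [simp]: "\<alpha> \<^bold>\<and> ext_one = \<alpha>"
proof -
  have "(\<Sum>S\<in>UNIV. \<alpha> $ S *s axis S 1) \<^bold>\<and> ext_one = (\<Sum>S\<in>UNIV. \<alpha> $ S *s axis S 1)"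
    by (simp add: ext_one_def wedge_sum_left wedge_scale_left wedge_axis)
  then show ?thesis
    by (simp add: basis_expansion)
qed

section \<open>Products of vectors\<close>

lemma ext_vec_add: "ext_vec (v + w) = ext_vec v + ext_vec w"
  by (simp add: ext_vec_def vec.scale_left_distrib sum.distrib)

lemma ext_vec_scale: "ext_vec (c *s v) = c *s ext_vec v"
  by (simp add: ext_vec_def vec.scale_sum_right)

lemma ext_vec_axis [simp]: "ext_vec (axis i 1) = axis {i} 1"
proof -
  have "ext_vec (axis i 1) = (\<Sum>j\<in>UNIV. if j = i then axis {i} 1 else 0)"
    unfolding ext_vec_def by (rule sum.cong) (auto simp: axis_def)
  then show ?thesis by simp
qed

lemma wedge_axis_singletons:
  "axis {i} 1 \<^bold>\<and> axis {j} 1 = - (axis {j} 1 \<^bold>\<and> axis {i} (1 :: complex))"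
  by (cases i j rule: linorder_cases)
     (auto simp: wedge_axis inversions_singleton_left insert_commute Collect_conv_if)

lemma ext_vec_wedge_ext_vec:
  "ext_vec v \<^bold>\<and> ext_vec w = (\<Sum>j\<in>UNIV. \<Sum>i\<in>UNIV. (v $ i * w $ j) *s (axis {i} 1 \<^bold>\<and> axis {j} 1))"
proof -
  have "ext_vec v \<^bold>\<and> ext_vec w = (\<Sum>j\<in>UNIV. w $ j *s (ext_vec v \<^bold>\<and> axis {j} 1))"
    by (simp add: ext_vec_def[of w] wedge_sum_right wedge_scale_right)
  also have "\<dots> = (\<Sum>j\<in>UNIV. \<Sum>i\<in>UNIV. (v $ i * w $ j) *s (axis {i} 1 \<^bold>\<and> axis {j} 1))"
    by (simp add: ext_vec_def[of v] wedge_sum_left wedge_scale_left vec.scale_sum_right mult.commute)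
  finally show ?thesis .
qed

lemma ext_vec_anticommute: "ext_vec v \<^bold>\<and> ext_vec w = - (ext_vec w \<^bold>\<and> ext_vec v)"
proof -
  have "ext_vec v \<^bold>\<and> ext_vec w =
      (\<Sum>j\<in>UNIV. \<Sum>i\<in>UNIV. - ((w $ j * v $ i) *s (axis {j} 1 \<^bold>\<and> axis {i} 1)))"
    unfolding ext_vec_wedge_ext_vec
    by (intro sum.cong refl, subst wedge_axis_singletons) (simp add: mult.commute)
  also have "\<dots> = (\<Sum>i\<in>UNIV. \<Sum>j\<in>UNIV. - ((w $ j * v $ i) *s (axis {j} 1 \<^bold>\<and> axis {i} 1)))"
    by (rule sum.swap)
  also have "\<dots> = - (ext_vec w \<^bold>\<and> ext_vec v)"
    by (simp add: ext_vec_wedge_ext_vec sum_negf)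
  finally show ?thesis .
qed

lemma ext_vec_wedge_self [simp]: "ext_vec v \<^bold>\<and> ext_vec v = 0"
  using ext_vec_anticommute[of v v] by (simp add: vec_eq_iff)

lemma ext_vec_wedge_self' [simp]: "ext_vec v \<^bold>\<and> ext_vec v \<^bold>\<and> \<alpha> = 0"
  by (simp add: wedge_assoc[symmetric])

lemma wedge_minus_left: "(- \<alpha>) \<^bold>\<and> \<beta> = - (\<alpha> \<^bold>\<and> \<beta>)"
  by (simp add: vec_eq_iff wedge_nth sum_negf)

lemma wedge_minus_right: "\<alpha> \<^bold>\<and> (- \<beta>) = - (\<alpha> \<^bold>\<and> \<beta>)"
  by (simp add: vec_eq_iff wedge_nth sum_negf)

lemma ext_vec_left_anticommute:
  "ext_vec v \<^bold>\<and> ext_vec w \<^bold>\<and> \<alpha> = - (ext_vec w \<^bold>\<and> ext_vec v \<^bold>\<and> \<alpha>)"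
  by (metis ext_vec_anticommute wedge_assoc wedge_minus_left)

lemma axis_insert_min:
  assumes "\<forall>j\<in>S. i < j"
  shows "axis (insert i S) 1 = ext_vec (axis i 1) \<^bold>\<and> axis S 1"
proof -
  have *: "{j \<in> S. j < i} = {}" and "i \<notin> S"
    using assms by auto
  then show ?thesis
    by (simp add: wedge_axis inversions_singleton_left *)
qed

lemma wedge_list_simps [simp]:
  "wedge_list [] = ext_one"
  "wedge_list (v # vs) = ext_vec v \<^bold>\<and> wedge_list vs"
  by (simp_all add: wedge_list_def)


section \<open>Functoriality of the exterior algebra\<close>

lemma ext_map_add: "ext_map g (\<alpha> + \<beta>) = ext_map g \<alpha> + ext_map g \<beta>"
  by (simp add: ext_map_def vec.scale_left_distrib sum.distrib)

lemma ext_map_scale: "ext_map g (c *s \<alpha>) = c *s ext_map g \<alpha>"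
  by (simp add: ext_map_def vec.scale_sum_right)

lemma ext_map_0 [simp]: "ext_map g 0 = 0"
  by (simp add: ext_map_def)

lemma ext_map_minus: "ext_map g (- \<alpha>) = - ext_map g \<alpha>"
  using ext_map_scale[of g "-1" \<alpha>] by (simp add: vec_eq_iff)

lemma ext_map_sum: "ext_map g (\<Sum>i\<in>I. f i) = (\<Sum>i\<in>I. ext_map g (f i))"
  by (induction I rule: infinite_finite_induct) (simp_all add: ext_map_add)

lemma ext_map_axis:
  "ext_map g (axis S 1) = wedge_list (map (\<lambda>i. g *v axis i 1) (sorted_list_of_set S))"
proof -
  have "ext_map g (axis S 1) =
      (\<Sum>T\<in>UNIV. if T = S then wedge_list (map (\<lambda>i. g *v axis i 1) (sorted_list_of_set S)) else 0)"
    unfolding ext_map_def by (rule sum.cong) (auto simp: axis_def)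
  then show ?thesis by simp
qed

lemma ext_map_axis_insert_min:
  assumes "\<forall>j\<in>S. i < j"
  shows "ext_map g (axis (insert i S) 1) = ext_vec (g *v axis i 1) \<^bold>\<and> ext_map g (axis S 1)"
proof -
  have "sorted_list_of_set (insert i S) = i # sorted_list_of_set S"
    by (rule sorted_list_of_set_unique[THEN iffD1])
       (use assms in \<open>auto simp: strict_sorted_iff[symmetric] less_imp_le\<close>)
  then show ?thesis
    by (simp add: ext_map_axis)
qed

text \<open>\<open>ext_map\<close> is defined by sorted products. A vector below all of
  \<open>S\<close> keeps the product sorted, a repetition of the minimum \<open>b\<close> kills both
  sides, and any other vector is exchanged with \<open>b\<close>, behind which the induction
  hypothesis applies.\<close>

lemma ext_map_axis_wedge_axis:
  "ext_map g (ext_vec (axis i 1) \<^bold>\<and> axis S 1) = ext_vec (g *v axis i 1) \<^bold>\<and> ext_map g (axis S 1)"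
proof (induction S arbitrary: i rule: finite_linorder_min_induct[OF finite])
  case 1
  have "ext_vec (axis i 1) \<^bold>\<and> axis {} 1 = (axis {i} 1 :: 'a ext)"
    by (simp add: wedge_axis)
  then show ?case
    by (simp add: ext_map_axis)
next
  case (2 b A)
  consider "i < b" | "i = b" | "b < i"
    by (rule linorder_cases)
  then show ?case
  proof cases
    case 1
    then have "\<forall>j\<in>insert b A. i < j"
      using 2 by auto
    then show ?thesis
      using ext_map_axis_insert_min axis_insert_min by metis
  next
    case 2
    have "ext_vec (axis b 1) \<^bold>\<and> axis (insert b A) 1 = 0"
      unfolding axis_insert_min[OF \<open>\<forall>a\<in>A. b < a\<close>] by (rule ext_vec_wedge_self')
    moreover have "ext_vec (g *v axis b 1) \<^bold>\<and> ext_map g (axis (insert b A) 1) = 0"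
      unfolding ext_map_axis_insert_min[OF \<open>\<forall>a\<in>A. b < a\<close>] by (rule ext_vec_wedge_self')
    ultimately show ?thesis
      by (simp add: \<open>i = b\<close> del: ext_vec_axis)
  next
    case 3
    have b: "\<forall>a\<in>insert i A. b < a"
      using 2 3 by auto
    have "ext_map g (ext_vec (axis b 1) \<^bold>\<and> ext_vec (axis i 1) \<^bold>\<and> axis A 1) =
        ext_vec (g *v axis b 1) \<^bold>\<and> ext_map g (ext_vec (axis i 1) \<^bold>\<and> axis A 1)"
    proof (cases "i \<in> A")
      case False
      then have "ext_vec (axis i 1) \<^bold>\<and> axis A 1 = (-1) ^ inversions {i} A *s (axis (insert i A) 1 :: 'a ext)"
        by (simp add: wedge_axis)
      then show ?thesis
        by (simp add: wedge_scale_right ext_map_scale ext_map_axis_insert_min[OF b]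
            axis_insert_min[OF b, symmetric] del: ext_vec_axis)
    qed (simp add: wedge_axis)
    then show ?thesis
      using 2(2,3)
      by (simp add: axis_insert_min ext_map_axis_insert_min ext_vec_left_anticommute[of "axis i 1" "axis b 1"]
          ext_vec_left_anticommute[of "g *v axis i 1" "g *v axis b 1"] ext_map_minus del: ext_vec_axis)
  qed
qed

lemma ext_vec_expansion: "ext_vec v = (\<Sum>i\<in>UNIV. v $ i *s ext_vec (axis i 1))"
  unfolding ext_vec_axis by (rule ext_vec_def)

lemma ext_vec_sum: "ext_vec (\<Sum>i\<in>I. f i) = (\<Sum>i\<in>I. ext_vec (f i))"
proof (induction I rule: infinite_finite_induct)
  case empty
  show ?case by (simp add: ext_vec_def)
next
  case (infinite I)
  then show ?case by (simp add: ext_vec_def)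
qed (simp add: ext_vec_add)

lemma matrix_vector_mult_sum: "A *v (\<Sum>i\<in>I. f i) = (\<Sum>i\<in>I. A *v f i)"
  by (induction I rule: infinite_finite_induct) (simp_all add: matrix_vector_right_distrib)

lemma ext_vec_matrix: "ext_vec (g *v v) = (\<Sum>i\<in>UNIV. v $ i *s ext_vec (g *v axis i 1))"
proof -
  have "g *v v = g *v (\<Sum>i\<in>UNIV. v $ i *s axis i 1)"
    by (simp add: basis_expansion)
  also have "\<dots> = (\<Sum>i\<in>UNIV. v $ i *s (g *v axis i 1))"
    by (simp add: matrix_vector_mult_sum vector_scalar_commute)
  finally show ?thesis
    by (simp add: ext_vec_sum ext_vec_scale)
qed

lemma ext_map_ext_vec_wedge: "ext_map g (ext_vec v \<^bold>\<and> \<alpha>) = ext_vec (g *v v) \<^bold>\<and> ext_map g \<alpha>"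
proof -
  have "ext_map g (ext_vec v \<^bold>\<and> (\<Sum>S\<in>UNIV. \<alpha> $ S *s axis S 1)) =
      ext_vec (g *v v) \<^bold>\<and> ext_map g (\<Sum>S\<in>UNIV. \<alpha> $ S *s axis S 1)"
    unfolding ext_vec_matrix[of g v] ext_vec_expansion[of v]
    by (simp only: wedge_sum_left wedge_sum_right wedge_scale_left wedge_scale_right
        ext_map_sum ext_map_scale ext_map_axis_wedge_axis)
  then show ?thesis
    by (simp add: basis_expansion)
qed

lemma ext_map_ext_one [simp]: "ext_map g ext_one = ext_one"
  by (simp add: ext_one_def ext_map_axis)

lemma ext_map_wedge_list: "ext_map g (wedge_list vs) = wedge_list (map ((*v) g) vs)"
  by (induction vs) (simp_all add: ext_map_ext_vec_wedge)

lemma ext_map_ext_vec: "ext_map g (ext_vec v) = ext_vec (g *v v)"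
  using ext_map_wedge_list[of g "[v]"] by simp

lemma ext_map_wedge: "ext_map g (\<alpha> \<^bold>\<and> \<beta>) = ext_map g \<alpha> \<^bold>\<and> ext_map g \<beta>"
proof -
  have axis: "ext_map g (axis S 1 \<^bold>\<and> \<beta>) = ext_map g (axis S 1) \<^bold>\<and> ext_map g \<beta>" for S
  proof (induction S rule: finite_linorder_min_induct[OF finite])
    case 1
    show ?case
      by (simp add: ext_one_def[symmetric])
  next
    case (2 b A)
    then show ?case
      by (simp add: axis_insert_min ext_map_ext_vec_wedge wedge_assoc del: ext_vec_axis)
  qed
  have "ext_map g ((\<Sum>S\<in>UNIV. \<alpha> $ S *s axis S 1) \<^bold>\<and> \<beta>) =
      ext_map g (\<Sum>S\<in>UNIV. \<alpha> $ S *s axis S 1) \<^bold>\<and> ext_map g \<beta>"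
    by (simp add: wedge_sum_left wedge_scale_left ext_map_sum ext_map_scale axis)
  then show ?thesis
    by (simp add: basis_expansion)
qed

lemma wedge_list_axis_sorted: "wedge_list (map (\<lambda>i. axis i 1) (sorted_list_of_set S)) = axis S 1"
proof (induction S rule: finite_linorder_min_induct[OF finite])
  case 1
  show ?case by (simp add: ext_one_def)
next
  case (2 b A)
  have "sorted_list_of_set (insert b A) = b # sorted_list_of_set A"
    by (rule sorted_list_of_set_unique[THEN iffD1])
       (use 2 in \<open>auto simp: strict_sorted_iff[symmetric] less_imp_le\<close>)
  with 2 show ?case
    by (simp add: axis_insert_min del: ext_vec_axis)
qed

lemma ext_map_id: "ext_map (mat 1) \<alpha> = \<alpha>"
  by (simp add: ext_map_def wedge_list_axis_sorted basis_expansion)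

lemma ext_map_comp: "ext_map g (ext_map h \<alpha>) = ext_map (g ** h) \<alpha>"
  unfolding ext_map_def[of h] ext_map_def[of "g ** h"]
  by (simp add: ext_map_sum ext_map_scale ext_map_wedge_list comp_def matrix_vector_mul_assoc)

lemma ext_map_inverse:
  assumes "invertible g"
  obtains h where "invertible h" "\<And>\<alpha>. ext_map h (ext_map g \<alpha>) = \<alpha>" "\<And>\<alpha>. ext_map g (ext_map h \<alpha>) = \<alpha>"
proof -
  obtain h where "g ** h = mat 1" "h ** g = mat 1"
    using assms unfolding invertible_def by blast
  then show thesis
    using that[of h] by (auto simp: ext_map_comp ext_map_id invertible_def)
qed

section \<open>Degrees of forms\<close>

lemma wedge_ext_power:
  assumes "\<alpha> \<in> ext_power p" "\<beta> \<in> ext_power q"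
  shows "\<alpha> \<^bold>\<and> \<beta> \<in> ext_power (p + q)"
  unfolding ext_power_def
proof safe
  fix S :: "'a set" assume S: "card S \<noteq> p + q"
  have "\<alpha> $ T * \<beta> $ (S - T) = 0" if "T \<subseteq> S" for T
  proof -
    have "card S = card T + card (S - T)"
      using that by (metis card_Diff_subset card_mono finite le_add_diff_inverse)
    with S have "card T \<noteq> p \<or> card (S - T) \<noteq> q"
      by auto
    then show ?thesis
      using assms by (auto simp: ext_power_def)
  qed
  then show "(\<alpha> \<^bold>\<and> \<beta>) $ S = 0"
    unfolding wedge_nth by (intro sum.neutral) (auto simp: mult.assoc)
qed

lemma ext_power_add: "\<alpha> \<in> ext_power k \<Longrightarrow> \<beta> \<in> ext_power k \<Longrightarrow> \<alpha> + \<beta> \<in> ext_power k"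
  by (simp add: ext_power_def)

lemma ext_power_scale: "\<alpha> \<in> ext_power k \<Longrightarrow> c *s \<alpha> \<in> ext_power k"
  by (simp add: ext_power_def)

lemma ext_power_sum: "(\<And>i. i \<in> I \<Longrightarrow> f i \<in> ext_power k) \<Longrightarrow> sum f I \<in> ext_power k"
  by (induction I rule: infinite_finite_induct) (auto simp: ext_power_def)

lemma axis_ext_power: "axis S 1 \<in> ext_power (card S)"
  by (auto simp: ext_power_def axis_def)

lemma ext_vec_ext_power: "ext_vec v \<in> ext_power 1"
proof -
  have "axis {i :: 'a} 1 \<in> ext_power 1" for i
    using axis_ext_power[of "{i}"] by simp
  then show ?thesis
    unfolding ext_vec_def by (intro ext_power_sum ext_power_scale)
qed

lemma wedge_list_ext_power: "wedge_list vs \<in> ext_power (length vs)"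
proof (induction vs)
  case Nil
  show ?case
    using axis_ext_power[of "{}"] by (simp add: ext_one_def)
next
  case (Cons v vs)
  then show ?case
    using wedge_ext_power[OF ext_vec_ext_power] by simp
qed

lemma ext_map_ext_power: "\<alpha> \<in> ext_power k \<Longrightarrow> ext_map g \<alpha> \<in> ext_power k"
  unfolding ext_map_def
proof (rule ext_power_sum)
  fix S assume \<alpha>: "\<alpha> \<in> ext_power k"
  show "\<alpha> $ S *s wedge_list (map (\<lambda>i. g *v axis i 1) (sorted_list_of_set S)) \<in> ext_power k"
  proof (cases "card S = k")
    case True
    then show ?thesis
      using wedge_list_ext_power[of "map (\<lambda>i. g *v axis i 1) (sorted_list_of_set S)"]
      by (intro ext_power_scale) simp
  next
    case False
    with \<alpha> show ?thesis by (simp add: ext_power_def)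
  qed
qed

text \<open>One inclusion is the invariance of the defining conditions under invertible maps; the
  other is the same inclusion for the inverse map.\<close>

lemma G_var_ext_map:
  assumes "invertible g"
  shows "G_var (ext_map g \<omega>) = ext_map g ` G_var \<omega>"
proof -
  have sub: "ext_map g ` G_var \<omega> \<subseteq> G_var (ext_map g \<omega>)" if g: "invertible g" for g \<omega>
  proof -
    obtain h where h: "\<And>\<alpha>. ext_map h (ext_map g \<alpha>) = \<alpha>"
      using ext_map_inverse[OF g] by metis
    show ?thesis
    proof
      fix \<beta> assume "\<beta> \<in> ext_map g ` G_var \<omega>"
      then obtain \<alpha> v w where \<alpha>: "\<beta> = ext_map g \<alpha>" "\<alpha> \<noteq> 0" "\<alpha> = ext_vec v \<^bold>\<and> ext_vec w" "\<alpha> \<^bold>\<and> \<omega> = 0"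
        unfolding G_var_def by blast
      have "\<beta> \<noteq> 0"
        using h[of \<alpha>] \<alpha> by auto
      moreover have "\<beta> = ext_vec (g *v v) \<^bold>\<and> ext_vec (g *v w)"
        by (simp add: \<alpha>(1,3) ext_map_wedge ext_map_ext_vec)
      moreover have "\<beta> \<^bold>\<and> ext_map g \<omega> = 0"
        using \<alpha>(1,4) by (simp add: ext_map_wedge[symmetric])
      ultimately show "\<beta> \<in> G_var (ext_map g \<omega>)"
        unfolding G_var_def by blast
    qed
  qed
  obtain h where h: "invertible h" "\<And>\<alpha>. ext_map h (ext_map g \<alpha>) = \<alpha>" "\<And>\<alpha>. ext_map g (ext_map h \<alpha>) = \<alpha>"
    using ext_map_inverse[OF assms] by metis
  have "G_var (ext_map g \<omega>) = ext_map g ` ext_map h ` G_var (ext_map g \<omega>)"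
    by (simp add: image_image h)
  also have "\<dots> \<subseteq> ext_map g ` G_var \<omega>"
    using sub[OF h(1), of "ext_map g \<omega>"] by (simp add: h image_mono)
  finally show ?thesis
    using sub[OF assms] by blast
qed


section \<open>A degeneration of four-forms\<close>

text \<open>The basis vectors \<open>e\<^sub>1, \<dots>, e\<^sub>7\<close> are indexed by the elements \<open>0 < 1 < \<dots> < 6\<close> of the type \<open>7\<close>.\<close>

lemma UNIV_7: "(UNIV :: 7 set) = {0, 1, 2, 3, 4, 5, 6}"
proof -
  have "card {0, 1, 2, 3, 4, 5, 6 :: 7} = card (UNIV :: 7 set)"
    by simp
  then show ?thesis
    by (metis card_subset_eq finite subset_UNIV)
qed

lemma all_7: "(\<forall>i::7. P i) \<longleftrightarrow> P 0 \<and> P 1 \<and> P 2 \<and> P 3 \<and> P 4 \<and> P 5 \<and> P 6"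
proof -
  have "(\<forall>i::7. P i) \<longleftrightarrow> (\<forall>i\<in>{0, 1, 2, 3, 4, 5, 6}. P i)"
    by (metis UNIV_7 UNIV_I)
  then show ?thesis by simp
qed

lemma set_7_eq_iff:
  fixes S T :: "7 set"
  shows "S = T \<longleftrightarrow> (0 \<in> S \<longleftrightarrow> 0 \<in> T) \<and> (1 \<in> S \<longleftrightarrow> 1 \<in> T) \<and> (2 \<in> S \<longleftrightarrow> 2 \<in> T) \<and>
    (3 \<in> S \<longleftrightarrow> 3 \<in> T) \<and> (4 \<in> S \<longleftrightarrow> 4 \<in> T) \<and> (5 \<in> S \<longleftrightarrow> 5 \<in> T) \<and> (6 \<in> S \<longleftrightarrow> 6 \<in> T)"
  unfolding set_eq_iff all_7 by blast

lemma less_7 [simp]: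
  "(0::7) < 1" "(0::7) < 2" "(0::7) < 3" "(0::7) < 4" "(0::7) < 5" "(0::7) < 6"
  "\<not> (1::7) < 0" "(1::7) < 2" "(1::7) < 3" "(1::7) < 4" "(1::7) < 5" "(1::7) < 6"
  "\<not> (2::7) < 0" "\<not> (2::7) < 1" "(2::7) < 3" "(2::7) < 4" "(2::7) < 5" "(2::7) < 6"
  "\<not> (3::7) < 0" "\<not> (3::7) < 1" "\<not> (3::7) < 2" "(3::7) < 4" "(3::7) < 5" "(3::7) < 6"
  "\<not> (4::7) < 0" "\<not> (4::7) < 1" "\<not> (4::7) < 2" "\<not> (4::7) < 3" "(4::7) < 5" "(4::7) < 6"
  "\<not> (5::7) < 0" "\<not> (5::7) < 1" "\<not> (5::7) < 2" "\<not> (5::7) < 3" "\<not> (5::7) < 4" "(5::7) < 6"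
  "\<not> (6::7) < 0" "\<not> (6::7) < 1" "\<not> (6::7) < 2" "\<not> (6::7) < 3" "\<not> (6::7) < 4" "\<not> (6::7) < 5"
  by (simp_all add: less_bit1_def bit1.Rep_numeral bit1.Rep_0 bit1.Rep_1)

lemma inversions_singleton_insert:
  "k \<notin> B \<Longrightarrow> inversions {a} (insert k B) = (if k < a then 1 else 0) + inversions {a} B"
  using inversions_union_right[of "{k}" B "{a}"] by (simp add: inversions_singleton_left Collect_conv_if)

lemma inversions_pair: "a \<noteq> b \<Longrightarrow> inversions {a, b} B = inversions {a} B + inversions {b} B"
  using inversions_union_left[of "{a}" "{b}" B] by (simp add: insert_commute)

lemma wedge_axis_nth:
  "(\<alpha> \<^bold>\<and> axis Q 1) $ S = (if Q \<subseteq> S then (-1) ^ inversions (S - Q) Q * \<alpha> $ (S - Q) else 0)"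
proof -
  have "(\<alpha> \<^bold>\<and> axis Q 1) $ S =
      (\<Sum>T\<in>Pow S. if T = S - Q then if Q \<subseteq> S then (-1) ^ inversions (S - Q) Q * \<alpha> $ (S - Q) else 0 else 0)"
    unfolding wedge_nth
  proof (rule sum.cong)
    fix T assume "T \<in> Pow S"
    then have "S - T = Q \<longleftrightarrow> T = S - Q \<and> Q \<subseteq> S"
      by auto
    then show "(-1) ^ inversions T (S - T) * \<alpha> $ T * axis Q 1 $ (S - T) =
        (if T = S - Q then if Q \<subseteq> S then (-1) ^ inversions (S - Q) Q * \<alpha> $ (S - Q) else 0 else 0)"
      by (auto simp: axis_def)
  qed simp
  then show ?thesis
    by (simp add: sum.delta)
qed

lemma ext_vec_nth [simp]: "ext_vec v $ {i} = v $ i" "ext_vec v $ {} = 0"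
  by (simp_all add: ext_vec_def axis_def if_distrib[where f = "(*) _"] cong: if_cong)

lemma ext_vec_wedge_nth:
  assumes "i < j"
  shows "(ext_vec v \<^bold>\<and> ext_vec w) $ {i, j} = v $ i * w $ j - v $ j * w $ i"
proof -
  have "inversions {i} {j} = 0" "inversions {j} {i} = 1"
    using assms by (auto simp: inversions_singleton_left Collect_conv_if)
  moreover have "{i, j} - {j} = {i}" "{i, j} - {i} = {j}"
    using assms by auto
  moreover have "Pow {i, j} = {{}, {i}, {j}, {i, j}}" "{i} \<noteq> {j}" "{i} \<noteq> {i, j}" "{j} \<noteq> {i, j}"
    using assms by (auto simp: Pow_insert)
  ultimately show ?thesis
    by (simp add: wedge_nth)
qed


text \<open>\<open>\<omega>\<^sub>t = e\<^sub>1\<^sub>2\<^sub>3\<^sub>7 + e\<^sub>4\<^sub>5\<^sub>6\<^sub>7 + e\<^sub>2\<^sub>3\<^sub>5\<^sub>6 + e\<^sub>1\<^sub>3\<^sub>4\<^sub>6 + t e\<^sub>1\<^sub>2\<^sub>4\<^sub>5\<close>\<close>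

definition omega_family :: "complex \<Rightarrow> 7 ext"
  where "omega_family t = axis {0, 1, 2, 6} 1 + axis {3, 4, 5, 6} 1 + axis {1, 2, 4, 5} 1 +
    axis {0, 2, 3, 5} 1 + t *s axis {0, 1, 3, 4} 1"

lemma omega_family_ext_power: "omega_family t \<in> ext_power 4"
proof -
  have "axis S 1 \<in> ext_power 4" if "card S = 4" for S :: "7 set"
    using axis_ext_power[of S] that by simp
  then show ?thesis
    unfolding omega_family_def by (intro ext_power_add ext_power_scale) simp_all
qed

lemma card_6_7:
  fixes S :: "7 set"
  assumes "card S = 6"
  shows "\<exists>k. S = - {k}"
proof -
  have "card (- S) = 1"
    using assms by (simp add: Compl_eq_Diff_UNIV card_Diff_subset)
  then show ?thesis
    by (metis card_1_singletonE double_complement)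
qed

text \<open>A six-form has seven coefficients, one for each omitted index. Every summand of
  \<open>omega_family t\<close> avoiding that index contributes the coefficient of \<alpha> at the
  complementary pair.\<close>

lemma wedge_omega_family_eq_0_iff:
  assumes "\<alpha> \<in> ext_power 2"
  shows "\<alpha> \<^bold>\<and> omega_family t = 0 \<longleftrightarrow>
    \<alpha> $ {1, 2} + \<alpha> $ {3, 6} = 0 \<and> \<alpha> $ {0, 2} - \<alpha> $ {4, 6} = 0 \<and> \<alpha> $ {0, 1} + t * \<alpha> $ {5, 6} = 0 \<and>
    \<alpha> $ {4, 5} + \<alpha> $ {0, 6} = 0 \<and> \<alpha> $ {3, 5} - \<alpha> $ {1, 6} = 0 \<and> \<alpha> $ {3, 4} + t * \<alpha> $ {2, 6} = 0 \<and>
    \<alpha> $ {0, 3} + \<alpha> $ {1, 4} + t * \<alpha> $ {2, 5} = 0"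
proof -
  have "\<alpha> \<^bold>\<and> omega_family t \<in> ext_power 6"
    using wedge_ext_power[OF assms omega_family_ext_power] by simp
  then have all: "\<alpha> \<^bold>\<and> omega_family t = 0 \<longleftrightarrow> (\<forall>k. (\<alpha> \<^bold>\<and> omega_family t) $ (- {k}) = 0)"
    unfolding vec_eq_iff ext_power_def using card_6_7 by fastforce

  have "- {0} - {3, 4, 5, 6} = ({1, 2} :: 7 set)" "- {0} - {1, 2, 4, 5} = ({3, 6} :: 7 set)"
    unfolding set_7_eq_iff by simp_all
  then have *: "(\<alpha> \<^bold>\<and> omega_family t) $ (- {0}) = \<alpha> $ {1, 2} + \<alpha> $ {3, 6}"
    by (simp add: omega_family_def wedge_add_right wedge_scale_right wedge_axis_nth inversions_pair inversions_singleton_insert)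
  note coefficients = *

  have "- {1} - {3, 4, 5, 6} = ({0, 2} :: 7 set)" "- {1} - {0, 2, 3, 5} = ({4, 6} :: 7 set)"
    unfolding set_7_eq_iff by simp_all
  then have *: "(\<alpha> \<^bold>\<and> omega_family t) $ (- {1}) = \<alpha> $ {0, 2} - \<alpha> $ {4, 6}"
    by (simp add: omega_family_def wedge_add_right wedge_scale_right wedge_axis_nth inversions_pair inversions_singleton_insert)
  note coefficients = coefficients *

  have "- {2} - {3, 4, 5, 6} = ({0, 1} :: 7 set)" "- {2} - {0, 1, 3, 4} = ({5, 6} :: 7 set)"
    unfolding set_7_eq_iff by simp_all
  then have *: "(\<alpha> \<^bold>\<and> omega_family t) $ (- {2}) = \<alpha> $ {0, 1} + t * \<alpha> $ {5, 6}"
    by (simp add: omega_family_def wedge_add_right wedge_scale_right wedge_axis_nth inversions_pair inversions_singleton_insert)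
  note coefficients = coefficients *

  have "- {3} - {0, 1, 2, 6} = ({4, 5} :: 7 set)" "- {3} - {1, 2, 4, 5} = ({0, 6} :: 7 set)"
    unfolding set_7_eq_iff by simp_all
  then have *: "(\<alpha> \<^bold>\<and> omega_family t) $ (- {3}) = \<alpha> $ {4, 5} + \<alpha> $ {0, 6}"
    by (simp add: omega_family_def wedge_add_right wedge_scale_right wedge_axis_nth inversions_pair inversions_singleton_insert)
  note coefficients = coefficients *

  have "- {4} - {0, 1, 2, 6} = ({3, 5} :: 7 set)" "- {4} - {0, 2, 3, 5} = ({1, 6} :: 7 set)"
    unfolding set_7_eq_iff by simp_all
  then have *: "(\<alpha> \<^bold>\<and> omega_family t) $ (- {4}) = \<alpha> $ {3, 5} - \<alpha> $ {1, 6}"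
    by (simp add: omega_family_def wedge_add_right wedge_scale_right wedge_axis_nth inversions_pair inversions_singleton_insert)
  note coefficients = coefficients *

  have "- {5} - {0, 1, 2, 6} = ({3, 4} :: 7 set)" "- {5} - {0, 1, 3, 4} = ({2, 6} :: 7 set)"
    unfolding set_7_eq_iff by simp_all
  then have *: "(\<alpha> \<^bold>\<and> omega_family t) $ (- {5}) = \<alpha> $ {3, 4} + t * \<alpha> $ {2, 6}"
    by (simp add: omega_family_def wedge_add_right wedge_scale_right wedge_axis_nth inversions_pair inversions_singleton_insert)
  note coefficients = coefficients *

  have "- {6} - {1, 2, 4, 5} = ({0, 3} :: 7 set)" "- {6} - {0, 2, 3, 5} = ({1, 4} :: 7 set)" "- {6} - {0, 1, 3, 4} = ({2, 5} :: 7 set)"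
    unfolding set_7_eq_iff by simp_all
  then have *: "(\<alpha> \<^bold>\<and> omega_family t) $ (- {6}) = \<alpha> $ {0, 3} + \<alpha> $ {1, 4} + t * \<alpha> $ {2, 5}"
    by (simp add: omega_family_def wedge_add_right wedge_scale_right wedge_axis_nth inversions_pair inversions_singleton_insert)
  note coefficients = coefficients *
  show ?thesis
    unfolding all all_7 coefficients by (simp add: add.commute)
qed


text \<open>
  For \<open>t = 0\<close> the variety is the closure of the image of \<open>\<P>\<^sup>5\<close> under the quadrics through a twisted cubic:
  up to signs, \<open>Y0, Y1, Y2\<close> are \<open>y\<^sup>2, y z, z\<^sup>2\<close>, the next eight coordinates are the products of \<open>y\<close>
  and of \<open>z\<close> with \<open>p, q, r, s\<close>, and \<open>D1, D2, D3\<close> are the minors \<open>p r + q\<^sup>2\<close>, \<open>p s - q r\<close>, \<open>r\<^sup>2 + q s\<close>.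
\<close>

datatype coord = Y0 | Y1 | Y2 | Pp | Pq | Pr | Ps | Zp | Zq | Zr | Zs | D1 | D2 | D3

lemma UNIV_coord: "UNIV = {Y0, Y1, Y2, Pp, Pq, Pr, Ps, Zp, Zq, Zr, Zs, D1, D2, D3}"
  using coord.exhaust by blast

instance coord :: finite
  by standard (simp add: UNIV_coord)

text \<open>The general solution of the seven linear equations in
  \<open>wedge_omega_family_eq_0_iff\<close>. Of the 21 coefficients of a two-form 14 are free, and
  the same ones can be taken for every \<open>t\<close>; this puts all the varieties into one
  projective space.\<close>

definition span_form :: "complex \<Rightarrow> complex ^ coord \<Rightarrow> 7 ext"
  where "span_form t z =
    (- (t * z $ D3)) *s axis {0, 1} 1 +
    (z $ Pq) *s axis {0, 2} 1 +
    (z $ Y1) *s axis {0, 3} 1 +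
    (z $ Y0) *s axis {0, 4} 1 +
    (z $ Ps) *s axis {0, 5} 1 +
    (z $ Pr) *s axis {0, 6} 1 +
    (z $ Zq) *s axis {1, 2} 1 +
    (z $ Y2) *s axis {1, 3} 1 +
    (- (z $ Y1) - t * z $ D2) *s axis {1, 4} 1 +
    (z $ Zs) *s axis {1, 5} 1 +
    (z $ Zr) *s axis {1, 6} 1 +
    (z $ Zp) *s axis {2, 3} 1 +
    (z $ Pp) *s axis {2, 4} 1 +
    (z $ D2) *s axis {2, 5} 1 +
    (z $ D1) *s axis {2, 6} 1 +
    (- (t * z $ D1)) *s axis {3, 4} 1 +
    (z $ Zr) *s axis {3, 5} 1 +
    (- (z $ Zq)) *s axis {3, 6} 1 +
    (- (z $ Pr)) *s axis {4, 5} 1 +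
    (z $ Pq) *s axis {4, 6} 1 +
    (z $ D3) *s axis {5, 6} 1"

definition form_coords :: "7 ext \<Rightarrow> complex ^ coord"
  where "form_coords \<alpha> = (\<chi> c. case c of
    Y0 \<Rightarrow> \<alpha> $ {0, 4} | Y1 \<Rightarrow> \<alpha> $ {0, 3} | Y2 \<Rightarrow> \<alpha> $ {1, 3} | Pp \<Rightarrow> \<alpha> $ {2, 4} | Pq \<Rightarrow> \<alpha> $ {0, 2} | Pr \<Rightarrow> \<alpha> $ {0, 6} | Ps \<Rightarrow> \<alpha> $ {0, 5} | Zp \<Rightarrow> \<alpha> $ {2, 3} | Zq \<Rightarrow> \<alpha> $ {1, 2} | Zr \<Rightarrow> \<alpha> $ {1, 6} | Zs \<Rightarrow> \<alpha> $ {1, 5} | D1 \<Rightarrow> \<alpha> $ {2, 6} | D2 \<Rightarrow> \<alpha> $ {2, 5} | D3 \<Rightarrow> \<alpha> $ {5, 6})"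

lemma form_coords_nth [simp]:
  "form_coords \<alpha> $ Y0 = \<alpha> $ {0, 4}"
  "form_coords \<alpha> $ Y1 = \<alpha> $ {0, 3}"
  "form_coords \<alpha> $ Y2 = \<alpha> $ {1, 3}"
  "form_coords \<alpha> $ Pp = \<alpha> $ {2, 4}"
  "form_coords \<alpha> $ Pq = \<alpha> $ {0, 2}"
  "form_coords \<alpha> $ Pr = \<alpha> $ {0, 6}"
  "form_coords \<alpha> $ Ps = \<alpha> $ {0, 5}"
  "form_coords \<alpha> $ Zp = \<alpha> $ {2, 3}"
  "form_coords \<alpha> $ Zq = \<alpha> $ {1, 2}"
  "form_coords \<alpha> $ Zr = \<alpha> $ {1, 6}"
  "form_coords \<alpha> $ Zs = \<alpha> $ {1, 5}"
  "form_coords \<alpha> $ D1 = \<alpha> $ {2, 6}"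
  "form_coords \<alpha> $ D2 = \<alpha> $ {2, 5}"
  "form_coords \<alpha> $ D3 = \<alpha> $ {5, 6}"
  by (simp_all add: form_coords_def)

lemma axis_7_nth:
  "axis S 1 $ T = (if (0 \<in> S \<longleftrightarrow> 0 \<in> T) \<and> (1 \<in> S \<longleftrightarrow> 1 \<in> T) \<and> (2 \<in> S \<longleftrightarrow> 2 \<in> T) \<and>
    (3 \<in> S \<longleftrightarrow> 3 \<in> T) \<and> (4 \<in> S \<longleftrightarrow> 4 \<in> T) \<and> (5 \<in> S \<longleftrightarrow> 5 \<in> T) \<and> (6 \<in> S \<longleftrightarrow> 6 \<in> T) then 1 else 0)"
  for S T :: "7 set"
  unfolding axis_def set_7_eq_iff[symmetric] by simp

lemma span_form_nth [simp]:
  "span_form t z $ {0, 1} = - (t * z $ D3)"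
  "span_form t z $ {0, 2} = z $ Pq"
  "span_form t z $ {0, 3} = z $ Y1"
  "span_form t z $ {0, 4} = z $ Y0"
  "span_form t z $ {0, 5} = z $ Ps"
  "span_form t z $ {0, 6} = z $ Pr"
  "span_form t z $ {1, 2} = z $ Zq"
  "span_form t z $ {1, 3} = z $ Y2"
  "span_form t z $ {1, 4} = - (z $ Y1) - t * z $ D2"
  "span_form t z $ {1, 5} = z $ Zs"
  "span_form t z $ {1, 6} = z $ Zr"
  "span_form t z $ {2, 3} = z $ Zp"
  "span_form t z $ {2, 4} = z $ Pp"
  "span_form t z $ {2, 5} = z $ D2"
  "span_form t z $ {2, 6} = z $ D1"
  "span_form t z $ {3, 4} = - (t * z $ D1)"
  "span_form t z $ {3, 5} = z $ Zr"
  "span_form t z $ {3, 6} = - (z $ Zq)"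
  "span_form t z $ {4, 5} = - (z $ Pr)"
  "span_form t z $ {4, 6} = z $ Pq"
  "span_form t z $ {5, 6} = z $ D3"
  by (simp_all add: span_form_def axis_7_nth)

lemma form_coords_span_form [simp]: "form_coords (span_form t z) = z"
  by (simp add: vec_eq_iff form_coords_def split: coord.split)

lemma span_form_ext_power: "span_form t z \<in> ext_power 2"
proof -
  have "axis S 1 \<in> ext_power 2" if "card S = 2" for S :: "7 set"
    using axis_ext_power[of S] that by simp
  then show ?thesis
    unfolding span_form_def by (intro ext_power_add ext_power_scale) simp_all
qed

lemma span_form_wedge_omega_family [simp]: "span_form t z \<^bold>\<and> omega_family t = 0"
  by (simp add: wedge_omega_family_eq_0_iff[OF span_form_ext_power])

lemma span_form_form_coords:
  assumes "\<alpha> \<in> ext_power 2" "\<alpha> \<^bold>\<and> omega_family t = 0"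
  shows "span_form t (form_coords \<alpha>) = \<alpha>"
proof -
  have linear: "\<alpha> $ {3, 6} = - (\<alpha> $ {1, 2})" "\<alpha> $ {4, 6} = \<alpha> $ {0, 2}" "\<alpha> $ {0, 1} = - (t * \<alpha> $ {5, 6})"
    "\<alpha> $ {4, 5} = - (\<alpha> $ {0, 6})" "\<alpha> $ {3, 5} = \<alpha> $ {1, 6}" "\<alpha> $ {3, 4} = - (t * \<alpha> $ {2, 6})"
    "\<alpha> $ {1, 4} = - (\<alpha> $ {0, 3}) - t * \<alpha> $ {2, 5}"
    using assms(2)[unfolded wedge_omega_family_eq_0_iff[OF assms(1)]]
    by (simp_all add: eq_neg_iff_add_eq_0 eq_diff_eq add_ac)
  have pairs: "\<forall>i j. i < j \<longrightarrow> span_form t (form_coords \<alpha>) $ {i, j} = \<alpha> $ {i, j}"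
    unfolding all_7 by (simp add: linear)
  have "span_form t (form_coords \<alpha>) $ S = \<alpha> $ S" for S
  proof (cases "card S = 2")
    case True
    then obtain i j where "S = {i, j}" "i < j"
      by (metis card_2_iff insert_commute neq_iff)
    with pairs show ?thesis
      by blast
  next
    case False
    then show ?thesis
      using assms(1) span_form_ext_power[of t "form_coords \<alpha>"] by (simp add: ext_power_def)
  qed
  then show ?thesis
    by (simp add: vec_eq_iff)
qed


section \<open>Straightening of quadratic monomials\<close>

lemma span_form_scale: "span_form t (s *s z) = s *s span_form t z"
  by (simp add: span_form_def vec_eq_iff algebra_simps)

lemma span_form_add: "span_form t (y + z) = span_form t y + span_form t z"
  by (simp add: span_form_def vec_eq_iff algebra_simps)

lemma span_form_0 [simp]: "span_form t 0 = 0"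
  using span_form_scale[of t 0 0] by simp

definition G_family :: "complex \<Rightarrow> (complex ^ coord) set"
  where "G_family t = {z. span_form t z \<in> G_var (omega_family t)}"

text \<open>The linear equations hold identically on \<open>span_form t\<close>, so only
  decomposability remains.\<close>

lemma G_family_iff:
  "z \<in> G_family t \<longleftrightarrow> z \<noteq> 0 \<and> (\<exists>v w. span_form t z = ext_vec v \<^bold>\<and> ext_vec w)"
proof -
  have "span_form t z = 0 \<longleftrightarrow> z = 0"
    by (metis form_coords_span_form span_form_0)
  then show ?thesis
    by (simp add: G_family_def G_var_def)
qed

lemma complex_cone_G_family: "complex_cone (G_family t)"
  unfolding complex_cone_def
proof (intro allI impI)
  fix s :: complex and z
  assume s: "s \<noteq> 0" and "z \<in> G_family t"
  then obtain v w where "z \<noteq> 0" "span_form t z = ext_vec v \<^bold>\<and> ext_vec w"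
    by (auto simp: G_family_iff)
  then have "s *s z \<noteq> 0" "span_form t (s *s z) = ext_vec (s *s v) \<^bold>\<and> ext_vec w"
    using s by (simp_all add: span_form_scale ext_vec_scale wedge_scale_left)
  then show "s *s z \<in> G_family t"
    by (auto simp: G_family_iff)
qed

text \<open>
  An entry \<open>(a, b, rhs)\<close> rewrites the product of the coordinates \<open>a\<close> and \<open>b\<close>. For \<open>t = 0\<close> these are
  28 independent quadrics through the variety.
\<close>

definition straightening :: "(coord \<times> coord \<times> (complex poly \<times> coord \<times> coord) list) list"
  where "straightening = [
    (Y0, D1, [([:1:], Pq, Pq), ([:1:], Pp, Pr)]),
    (Y0, D2, [([:1:], Pp, Ps), ([:- 1:], Pq, Pr)]),
    (Y0, D3, [([:1:], Pq, Ps), ([:1:], Pr, Pr)]),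
    (Y1, D1, [([:1:], Pr, Zp), ([:- 1:], Pq, Zq)]),
    (Y1, D2, [([:1:], Pq, Zr), ([:1:], Ps, Zp)]),
    (Y1, D3, [([:- 1:], Ps, Zq), ([:- 1:], Pr, Zr)]),
    (Y2, D1, [([:1:], Zp, Zr), ([:- 1:], Zq, Zq)]),
    (Y2, D2, [([:1:], Zq, Zr), ([:1:], Zp, Zs)]),
    (Y2, D3, [([:- 1:], Zq, Zs), ([:- 1:], Zr, Zr)]),
    (Y0, Y2, [([:- 1:], Y1, Y1), ([:0, - 1:], Y1, D2), ([:0, 0, - 1:], D1, D3)]),
    (Y1, Pp, [([:1:], Y0, Zp), ([:0, - 1:], Pq, D1)]),
    (Y1, Pq, [([:- 1:], Y0, Zq), ([:0, 1:], Pr, D1)]),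
    (Y1, Pr, [([:- 1:], Y0, Zr), ([:0, - 1:], Ps, D1)]),
    (Y1, Ps, [([:- 1:], Y0, Zs), ([:0, 1:], Pr, D3), ([:0, - 1:], Ps, D2)]),
    (Y2, Pp, [([:- 1:], Y1, Zp), ([:0, - 1:], Zp, D2), ([:0, - 1:], Zq, D1)]),
    (Y2, Pq, [([:1:], Y1, Zq), ([:0, - 1:], Zp, D3)]),
    (Y2, Pr, [([:1:], Y1, Zr), ([:0, - 1:], Zq, D3)]),
    (Y2, Ps, [([:1:], Y1, Zs), ([:0, 1:], Zr, D3)]),
    (Pp, D3, [([:1:], Pq, D2), ([:1:], Pr, D1)]),
    (Zp, D3, [([:- 1:], Zq, D2), ([:- 1:], Zr, D1)]),
    (Pr, D2, [([:1:], Ps, D1), ([:- 1:], Pq, D3)]),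
    (Zr, D2, [([:1:], Zs, D1), ([:- 1:], Zq, D3)]),
    (Pr, Zp, [([:- 1:], Pp, Zr), ([:0, - 1:], D1, D2)]),
    (Pq, Zp, [([:- 1:], Pp, Zq), ([:0, 1:], D1, D1)]),
    (Ps, Zp, [([:- 1:], Pp, Zs), ([:0, 1:], D1, D3), ([:0, - 1:], D2, D2)]),
    (Pr, Zq, [([:1:], Pq, Zr), ([:0, 1:], D1, D3)]),
    (Ps, Zq, [([:1:], Pq, Zs), ([:0, 1:], D2, D3)]),
    (Ps, Zr, [([:1:], Pr, Zs), ([:0, - 1:], D3, D3)])]"

lemma straightening_G_family:
  assumes "(a, b, rhs) \<in> set straightening" "z \<in> G_family t"
  shows "z $ a * z $ b = (\<Sum>(c, a', b')\<leftarrow>rhs. poly c t * (z $ a' * z $ b'))"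
proof -
  obtain v w where vw: "span_form t z = ext_vec v \<^bold>\<and> ext_vec w"
    using assms(2) by (auto simp: G_family_iff)
  \<comment> \<open>The 2 by 2 minors: they satisfy the Pluecker relations identically, and for
    \<open>i < j\<close> they are coefficients of \<open>span_form t z\<close>.\<close>
  define p where "p i j = v $ i * w $ j - v $ j * w $ i" for i j
  have p: "i < j \<Longrightarrow> p i j = span_form t z $ {i, j}" for i j
    by (simp add: vw ext_vec_wedge_nth p_def)
  define pl where "pl a b c d = p a b * p c d - p a c * p b d + p a d * p b c" for a b c d
  have pl: "pl a b c d = 0" for a b c d
    by (simp add: pl_def p_def algebra_simps)
  \<comment> \<open>Each rule is a single Pluecker relation up to sign, except the one for
    \<open>Ps\<close> and \<open>Zp\<close>: there the sum of three relations cancels the products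
    \<open>Y1 D2\<close>, \<open>Pq Zr\<close> and \<open>Pr Zq\<close>.\<close>
  have straighten:
    "z $ Y0 * z $ D1 = z $ Pq * z $ Pq + z $ Pp * z $ Pr - pl 0 2 4 6"
    "z $ Y0 * z $ D2 = z $ Pp * z $ Ps - z $ Pq * z $ Pr - pl 0 2 4 5"
    "z $ Y0 * z $ D3 = z $ Pq * z $ Ps + z $ Pr * z $ Pr + pl 0 4 5 6"
    "z $ Y1 * z $ D1 = z $ Pr * z $ Zp - z $ Pq * z $ Zq - pl 0 2 3 6"
    "z $ Y1 * z $ D2 = z $ Pq * z $ Zr + z $ Ps * z $ Zp - pl 0 2 3 5"
    "z $ Y1 * z $ D3 = - (z $ Ps * z $ Zq) - z $ Pr * z $ Zr + pl 0 3 5 6"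
    "z $ Y2 * z $ D1 = z $ Zp * z $ Zr - z $ Zq * z $ Zq - pl 1 2 3 6"
    "z $ Y2 * z $ D2 = z $ Zq * z $ Zr + z $ Zp * z $ Zs - pl 1 2 3 5"
    "z $ Y2 * z $ D3 = - (z $ Zq * z $ Zs) - z $ Zr * z $ Zr + pl 1 3 5 6"
    "z $ Y0 * z $ Y2 = - (z $ Y1 * z $ Y1) - t * (z $ Y1 * z $ D2) - t * t * (z $ D1 * z $ D3) + pl 0 1 3 4"
    "z $ Y1 * z $ Pp = z $ Y0 * z $ Zp - t * (z $ Pq * z $ D1) - pl 0 2 3 4"
    "z $ Y1 * z $ Pq = - (z $ Y0 * z $ Zq) + t * (z $ Pr * z $ D1) + pl 0 3 4 6"
    "z $ Y1 * z $ Pr = - (z $ Y0 * z $ Zr) - t * (z $ Ps * z $ D1) - pl 0 3 4 5"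
    "z $ Y1 * z $ Ps = - (z $ Y0 * z $ Zs) + t * (z $ Pr * z $ D3) - t * (z $ Ps * z $ D2) - pl 0 1 4 5"
    "z $ Y2 * z $ Pp = - (z $ Y1 * z $ Zp) - t * (z $ Zp * z $ D2) - t * (z $ Zq * z $ D1) - pl 1 2 3 4"
    "z $ Y2 * z $ Pq = z $ Y1 * z $ Zq - t * (z $ Zp * z $ D3) - pl 0 1 2 3"
    "z $ Y2 * z $ Pr = z $ Y1 * z $ Zr - t * (z $ Zq * z $ D3) + pl 0 1 3 6"
    "z $ Y2 * z $ Ps = z $ Y1 * z $ Zs + t * (z $ Zr * z $ D3) + pl 0 1 3 5"
    "z $ Pp * z $ D3 = z $ Pq * z $ D2 + z $ Pr * z $ D1 + pl 2 4 5 6"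
    "z $ Zp * z $ D3 = - (z $ Zq * z $ D2) - z $ Zr * z $ D1 + pl 2 3 5 6"
    "z $ Pr * z $ D2 = z $ Ps * z $ D1 - z $ Pq * z $ D3 + pl 0 2 5 6"
    "z $ Zr * z $ D2 = z $ Zs * z $ D1 - z $ Zq * z $ D3 + pl 1 2 5 6"
    "z $ Pr * z $ Zp = - (z $ Pp * z $ Zr) - t * (z $ D1 * z $ D2) - pl 2 3 4 5"
    "z $ Pq * z $ Zp = - (z $ Pp * z $ Zq) + t * (z $ D1 * z $ D1) + pl 2 3 4 6"
    "z $ Ps * z $ Zp = - (z $ Pp * z $ Zs) + t * (z $ D1 * z $ D3) - t * (z $ D2 * z $ D2) + pl 0 2 3 5 + pl 1 2 4 5 + pl 3 4 5 6"
    "z $ Pr * z $ Zq = z $ Pq * z $ Zr + t * (z $ D1 * z $ D3) + pl 3 4 5 6"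
    "z $ Ps * z $ Zq = z $ Pq * z $ Zs + t * (z $ D2 * z $ D3) + pl 0 1 2 5"
    "z $ Ps * z $ Zr = z $ Pr * z $ Zs - t * (z $ D3 * z $ D3) - pl 0 1 5 6"
    by (simp_all add: pl_def p algebra_simps)
  have "\<forall>(a, b, rhs)\<in>set straightening.
      z $ a * z $ b = (\<Sum>(c, a', b')\<leftarrow>rhs. poly c t * (z $ a' * z $ b'))"
    unfolding straightening_def list.set ball_simps prod.case
    by (intro conjI TrueI; rule straighten[THEN trans]; simp add: pl mult.assoc)
  with assms(1) show ?thesis by blast
qed

text \<open>A solution of the linear inequalities in \<open>straightening_weight\<close>, which make straightening terminate.\<close>

definition weight :: "coord \<Rightarrow> nat"
  where "weight c = (case c of
    Y0 \<Rightarrow> 12 | Y1 \<Rightarrow> 14 | Y2 \<Rightarrow> 17 | Pp \<Rightarrow> 4 | Pq \<Rightarrow> 1 | Pr \<Rightarrow> 5 | Ps \<Rightarrow> 6 | Zp \<Rightarrow> 5 | Zq \<Rightarrow> 0 | Zr \<Rightarrow> 1 | Zs \<Rightarrow> 0 | D1 \<Rightarrow> 0 | D2 \<Rightarrow> 3 | D3 \<Rightarrow> 2)"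

lemma straightening_weight:
  assumes "(a, b, rhs) \<in> set straightening" "(c, a', b') \<in> set rhs"
  shows "weight a' + weight b' < weight a + weight b"
proof -
  have "\<forall>(a, b, rhs)\<in>set straightening. \<forall>(c, a', b')\<in>set rhs. weight a' + weight b' < weight a + weight b"
    by (simp add: straightening_def weight_def)
  with assms show ?thesis by blast
qed

text \<open>Serves to lower two separate exponents when a rule is applied, and to see that every
  single coordinate is standard.\<close>

lemma straightening_distinct: "(a, b, rhs) \<in> set straightening \<Longrightarrow> a \<noteq> b"
  by (auto simp: straightening_def)


section \<open>Standard monomials\<close>

definition monomial :: "(coord \<Rightarrow> nat) \<Rightarrow> complex ^ coord \<Rightarrow> complex"
  where "monomial m z = (\<Prod>c\<in>UNIV. z $ c ^ m c)"

definition standard :: "(coord \<Rightarrow> nat) \<Rightarrow> bool"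
  where "standard m \<longleftrightarrow> (\<forall>(a, b, rhs)\<in>set straightening. m a = 0 \<or> m b = 0)"

lemma monomial_incr: "monomial (m(c := Suc (m c))) z = z $ c * monomial m z"
proof -
  have "(\<Prod>d\<in>UNIV. z $ d ^ (m(c := Suc (m c))) d) = (\<Prod>d\<in>UNIV. (if d = c then z $ c else 1) * z $ d ^ m d)"
    by (rule prod.cong) auto
  then show ?thesis
    by (simp add: monomial_def prod.distrib prod.delta)
qed

definition total_weight :: "(coord \<Rightarrow> nat) \<Rightarrow> nat"
  where "total_weight m = (\<Sum>c\<in>UNIV. m c * weight c)"

lemma total_weight_incr: "total_weight (m(c := Suc (m c))) = weight c + total_weight m"
proof -
  have "(\<Sum>d\<in>UNIV. (m(c := Suc (m c))) d * weight d) = (\<Sum>d\<in>UNIV. (if d = c then weight c else 0) + m d * weight d)"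
    by (rule sum.cong) auto
  then show ?thesis
    by (simp add: total_weight_def sum.distrib sum.delta)
qed

text \<open>Functions on the total space in the \<complex>[t]-span of the standard monomials. One
  finite set and one choice of polynomial coefficients must serve all \<open>t\<close> at once, as
  the assumption \<open>spanning\<close> of \<open>based_family\<close> demands.\<close>

definition standard_span :: "(complex \<Rightarrow> complex ^ coord \<Rightarrow> complex) set"
  where "standard_span = {h. \<exists>F r. finite F \<and> F \<subseteq> Collect standard \<and>
    (\<forall>t. \<forall>z\<in>G_family t. h t z = (\<Sum>m\<in>F. poly (r m) t * monomial m z))}"

lemma standard_span_cong:
  assumes "h \<in> standard_span" "\<And>t z. z \<in> G_family t \<Longrightarrow> h' t z = h t z"
  shows "h' \<in> standard_span"
  using assms unfolding standard_span_def by (auto; metis)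

lemma standard_span_add:
  assumes "h \<in> standard_span" "h' \<in> standard_span"
  shows "(\<lambda>t z. h t z + h' t z) \<in> standard_span"
proof -
  obtain F r where F: "finite F" "F \<subseteq> Collect standard"
    "\<And>t z. z \<in> G_family t \<Longrightarrow> h t z = (\<Sum>m\<in>F. poly (r m) t * monomial m z)"
    using assms(1) unfolding standard_span_def by blast
  obtain F' r' where F': "finite F'" "F' \<subseteq> Collect standard"
    "\<And>t z. z \<in> G_family t \<Longrightarrow> h' t z = (\<Sum>m\<in>F'. poly (r' m) t * monomial m z)"
    using assms(2) unfolding standard_span_def by blast
  define r'' where "r'' m = (if m \<in> F then r m else 0) + (if m \<in> F' then r' m else 0)" for m
  have "h t z + h' t z = (\<Sum>m\<in>F \<union> F'. poly (r'' m) t * monomial m z)" if "z \<in> G_family t" for t z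
  proof -
    have "(\<Sum>m\<in>F. poly (r m) t * monomial m z) =
        (\<Sum>m\<in>F \<union> F'. poly (if m \<in> F then r m else 0) t * monomial m z)"
      by (rule sum.mono_neutral_cong_left) (use F F' in auto)
    moreover have "(\<Sum>m\<in>F'. poly (r' m) t * monomial m z) =
        (\<Sum>m\<in>F \<union> F'. poly (if m \<in> F' then r' m else 0) t * monomial m z)"
      by (rule sum.mono_neutral_cong_left) (use F F' in auto)
    ultimately show ?thesis
      using F(3)[OF that] F'(3)[OF that]
      by (simp add: r''_def distrib_right sum.distrib del: if_distrib)
  qed
  with F F' show ?thesis
    unfolding standard_span_def by (intro CollectI exI[of _ "F \<union> F'"] exI[of _ r'']) auto
qed

lemma standard_span_mult_poly:
  assumes "h \<in> standard_span"
  shows "(\<lambda>t z. poly q t * h t z) \<in> standard_span"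
proof -
  obtain F r where F: "finite F" "F \<subseteq> Collect standard"
    "\<And>t z. z \<in> G_family t \<Longrightarrow> h t z = (\<Sum>m\<in>F. poly (r m) t * monomial m z)"
    using assms unfolding standard_span_def by blast
  have "poly q t * h t z = (\<Sum>m\<in>F. poly (q * r m) t * monomial m z)" if "z \<in> G_family t" for t z
    by (simp add: F(3)[OF that] sum_distrib_left mult.assoc)
  with F(1,2) show ?thesis
    unfolding standard_span_def by (intro CollectI exI[of _ F] exI[of _ "\<lambda>m. q * r m"]) auto
qed

lemma standard_span_0: "(\<lambda>t z. 0) \<in> standard_span"
  unfolding standard_span_def by (intro CollectI exI[of _ "{}"]) auto

lemma standard_span_sum_list:
  assumes "\<And>x. x \<in> set xs \<Longrightarrow> h x \<in> standard_span"
  shows "(\<lambda>t z. \<Sum>x\<leftarrow>xs. h x t z) \<in> standard_span"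
  using assms by (induction xs) (auto intro!: standard_span_0 standard_span_add)

lemma standard_span_sum:
  assumes "\<And>x. x \<in> A \<Longrightarrow> h x \<in> standard_span"
  shows "(\<lambda>t z. \<Sum>x\<in>A. h x t z) \<in> standard_span"
  using assms by (induction A rule: infinite_finite_induct) (auto intro!: standard_span_0 standard_span_add)

text \<open>A non-standard monomial contains the product rewritten by some rule; the replacement
  consists of monomials of smaller total weight, so rewriting terminates.\<close>

lemma monomial_in_standard_span: "(\<lambda>t. monomial m) \<in> standard_span"
proof (induction "total_weight m" arbitrary: m rule: less_induct)
  case less
  show ?case
  proof (cases "standard m")
    case True
    then show ?thesis
      unfolding standard_span_def by (intro CollectI exI[of _ "{m}"] exI[of _ "\<lambda>_. 1"]) auto
  next
    case False
    then obtain a b rhs where rule: "(a, b, rhs) \<in> set straightening" and ab: "m a \<noteq> 0" "m b \<noteq> 0"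
      by (auto simp: standard_def)
    have "a \<noteq> b"
      using straightening_distinct[OF rule] .
    let ?incr = "\<lambda>m c. m(c := Suc (m c))"
    define k where "k = m(a := m a - 1, b := m b - 1)"
    have m: "m = ?incr (?incr k b) a"
      using ab \<open>a \<noteq> b\<close> by (auto simp: k_def fun_eq_iff)
    define h where "h x t z = poly (fst x) t * monomial (?incr (?incr k (snd (snd x))) (fst (snd x))) z"
      for x :: "complex poly \<times> coord \<times> coord" and t z
    have "h x \<in> standard_span" if x: "x \<in> set rhs" for x
      unfolding h_def
    proof (rule standard_span_mult_poly, rule less)
      show "total_weight (?incr (?incr k (snd (snd x))) (fst (snd x))) < total_weight m"
        using straightening_weight[OF rule, of "fst x" "fst (snd x)" "snd (snd x)"] x
        by (subst m) (simp only: total_weight_incr prod.collapse add.assoc[symmetric] add_less_cancel_right)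
    qed
    then have "(\<lambda>t z. \<Sum>x\<leftarrow>rhs. h x t z) \<in> standard_span"
      by (rule standard_span_sum_list)
    then show ?thesis
    proof (rule standard_span_cong)
      fix t z assume z: "z \<in> G_family t"
      have "monomial m z = z $ a * z $ b * monomial k z"
        by (subst m) (simp only: monomial_incr mult.assoc)
      also have "\<dots> = (\<Sum>(c, a', b')\<leftarrow>rhs. poly c t * (z $ a' * z $ b')) * monomial k z"
        by (simp add: straightening_G_family[OF rule z])
      also have "\<dots> = (\<Sum>x\<leftarrow>rhs. h x t z)"
        by (simp add: h_def sum_list_mult_const[symmetric] monomial_incr case_prod_beta' mult.assoc del: fun_upd_apply)
      finally show "monomial m z = (\<Sum>x\<leftarrow>rhs. h x t z)" .
    qed
  qed
qed

lemma standard_span_mult_coord: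
  assumes "h \<in> standard_span"
  shows "(\<lambda>t z. z $ c * h t z) \<in> standard_span"
proof -
  obtain F r where F: "\<And>t z. z \<in> G_family t \<Longrightarrow> h t z = (\<Sum>m\<in>F. poly (r m) t * monomial m z)"
    using assms unfolding standard_span_def by blast
  have "(\<lambda>t z. \<Sum>m\<in>F. poly (r m) t * monomial (m(c := Suc (m c))) z) \<in> standard_span"
    by (intro standard_span_sum standard_span_mult_poly monomial_in_standard_span)
  then show ?thesis
    by (rule standard_span_cong) (simp add: F monomial_incr sum_distrib_left mult.left_commute)
qed


text \<open>The leading term of a sequence is \<open>c N^n\<close>. The value \<open>c = 0\<close>
  is allowed and then only says that \<open>f\<close> grows more slowly; this occurs below at
  \<open>t = 0\<close>.\<close>

definition grows_like :: "(nat \<Rightarrow> complex) \<Rightarrow> nat \<Rightarrow> complex \<Rightarrow> bool"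
  where "grows_like f N c \<longleftrightarrow> (\<lambda>n. f n / of_nat N ^ n) \<longlonglongrightarrow> c"

lemma grows_like_power: "N \<noteq> 0 \<Longrightarrow> grows_like (\<lambda>n. of_nat N ^ n) N 1"
  by (simp add: grows_like_def)

lemma grows_like_mult:
  assumes "grows_like f N c" "grows_like g M d"
  shows "grows_like (\<lambda>n. f n * g n) (N * M) (c * d)"
  using tendsto_mult[OF assms[unfolded grows_like_def]]
  by (simp add: grows_like_def power_mult_distrib)

lemma grows_like_add:
  assumes "grows_like f N c" "grows_like g N d"
  shows "grows_like (\<lambda>n. f n + g n) N (c + d)"
  using tendsto_add[OF assms[unfolded grows_like_def]] by (simp add: grows_like_def add_divide_distrib)

lemma grows_like_diff:
  assumes "grows_like f N c" "grows_like g N d"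
  shows "grows_like (\<lambda>n. f n - g n) N (c - d)"
  using tendsto_diff[OF assms[unfolded grows_like_def]] by (simp add: grows_like_def diff_divide_distrib)

lemma grows_like_const_mult:
  assumes "grows_like f N c"
  shows "grows_like (\<lambda>n. k * f n) N (k * c)"
  using tendsto_mult_left[OF assms[unfolded grows_like_def]] by (simp add: grows_like_def)

lemma grows_like_dominated:
  assumes "grows_like f N c" "0 < N" "N < M"
  shows "grows_like f M 0"
proof -
  have "(\<lambda>n. (of_nat N / of_nat M :: complex) ^ n) \<longlonglongrightarrow> 0"
    by (rule LIMSEQ_power_zero) (use assms(2,3) in \<open>simp add: norm_divide\<close>)
  from tendsto_mult[OF assms(1)[unfolded grows_like_def] this] show ?thesis
    using assms(2) by (simp add: grows_like_def power_divide)
qed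

lemma grows_like_add_dominated:
  assumes "grows_like f N c" "grows_like g M d" "0 < M" "M < N"
  shows "grows_like (\<lambda>n. f n + g n) N c"
  using grows_like_add[OF assms(1) grows_like_dominated[OF assms(2-)]] by simp

lemma grows_like_diff_dominated:
  assumes "grows_like f N c" "grows_like g M d" "0 < M" "M < N"
  shows "grows_like (\<lambda>n. f n - g n) N c"
  using grows_like_diff[OF assms(1) grows_like_dominated[OF assms(2-)]] by simp

lemma grows_like_uminus: "grows_like f N c \<Longrightarrow> grows_like (\<lambda>n. - f n) N (- c)"
  using grows_like_const_mult[of f N c "- 1"] by simp

lemma grows_like_pow:
  assumes "grows_like f N c"
  shows "grows_like (\<lambda>n. f n ^ k) (N ^ k) (c ^ k)"
proof (induction k)
  case 0
  show ?case using grows_like_power[of 1] by simp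
next
  case (Suc k)
  then show ?case using grows_like_mult[OF assms Suc] by simp
qed

lemma grows_like_prod:
  assumes "\<And>i. i \<in> A \<Longrightarrow> grows_like (f i) (N i) (c i)"
  shows "grows_like (\<lambda>n. \<Prod>i\<in>A. f i n) (\<Prod>i\<in>A. N i) (\<Prod>i\<in>A. c i)"
  using assms
proof (induction A rule: infinite_finite_induct)
  case (insert i A)
  then show ?case using grows_like_mult[of "f i" "N i" "c i"] by simp
qed (use grows_like_power[of 1] in simp_all)

text \<open>Among the terms with nonzero coefficients the largest rate is attained only once, and
  after division by its power just that term survives in the limit.\<close>

lemma grows_like_independent:
  assumes "finite F" "inj_on N F" and f: "\<And>i. i \<in> F \<Longrightarrow> grows_like (f i) (N i) (c i)"
    and pos: "\<And>i. i \<in> F \<Longrightarrow> N i > 0" and c: "\<And>i. i \<in> F \<Longrightarrow> c i \<noteq> 0"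
    and sum: "\<And>n. (\<Sum>i\<in>F. \<beta> i * f i n) = 0" and "i \<in> F"
  shows "\<beta> i = 0"
proof (rule ccontr)
  assume "\<beta> i \<noteq> 0"
  define F' where "F' = {i \<in> F. \<beta> i \<noteq> 0}"
  have "finite (N ` F')" "N ` F' \<noteq> {}"
    using assms(1) \<open>i \<in> F\<close> \<open>\<beta> i \<noteq> 0\<close> by (auto simp: F'_def)
  from Max_in[OF this] obtain k where k: "k \<in> F'" "Max (N ` F') = N k"
    by auto
  have le: "N j \<le> N k" if "j \<in> F'" for j
    using Max_ge[OF \<open>finite (N ` F')\<close>, of "N j"] that k by auto
  have "grows_like (\<lambda>n. \<beta> j * f j n) (N k) (if j = k then \<beta> k * c k else 0)" if "j \<in> F'" for j
  proof (cases "j = k")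
    case True
    then show ?thesis
      using grows_like_const_mult[OF f] k by (auto simp: F'_def)
  next
    case False
    then have "N j < N k"
      using le[OF that] assms(2) that k(1) by (fastforce simp: F'_def inj_on_def)
    then show ?thesis
      using grows_like_dominated[OF grows_like_const_mult[OF f]] pos that False by (auto simp: F'_def)
  qed
  then have "(\<lambda>n. \<Sum>j\<in>F'. \<beta> j * f j n / of_nat (N k) ^ n) \<longlonglongrightarrow> (\<Sum>j\<in>F'. if j = k then \<beta> k * c k else 0)"
    unfolding grows_like_def by (rule tendsto_sum)
  moreover have "(\<Sum>j\<in>F'. if j = k then \<beta> k * c k else 0) = \<beta> k * c k"
    using k(1) assms(1) by (simp add: F'_def)
  moreover have "(\<Sum>j\<in>F'. \<beta> j * f j n / of_nat (N k) ^ n) = 0" for n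
  proof -
    have "(\<Sum>j\<in>F'. \<beta> j * f j n) = (\<Sum>j\<in>F. \<beta> j * f j n)"
      by (rule sum.mono_neutral_left) (use assms(1) in \<open>auto simp: F'_def\<close>)
    then show ?thesis
      by (simp add: sum_divide_distrib[symmetric] sum)
  qed
  ultimately have "\<beta> k * c k = 0"
    by (simp add: LIMSEQ_const_iff)
  then show False
    using k(1) c by (auto simp: F'_def)
qed


text \<open>
  Along the curve \<open>u = 11\<^sup>n, z = 37\<^sup>n, p = 7\<^sup>n, q = 3\<^sup>n, r = 2\<^sup>n, s = 5\<^sup>n\<close> of points of the chart
  \<open>y = 1\<close>, scaled by \<open>u\<close>, every coordinate grows like \<open>N\<^sup>n\<close>, where \<open>N\<close> is the product of the following
  primes, whatever the value of \<open>t\<close> is. By unique factorization, distinct standard monomials have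
  distinct growth rates.
\<close>

fun growth_primes :: "coord \<Rightarrow> nat list" where
  "growth_primes Y0 = [11]"
| "growth_primes Y1 = [11, 37]"
| "growth_primes Y2 = [11, 37, 37]"
| "growth_primes Pp = [11, 7]"
| "growth_primes Pq = [11, 3]"
| "growth_primes Pr = [11, 2]"
| "growth_primes Ps = [11, 5]"
| "growth_primes Zp = [11, 37, 7]"
| "growth_primes Zq = [11, 37, 3]"
| "growth_primes Zr = [11, 37, 2]"
| "growth_primes Zs = [11, 37, 5]"
| "growth_primes D1 = [11, 7, 2]"
| "growth_primes D2 = [11, 7, 5]"
| "growth_primes D3 = [11, 3, 5]"

definition growth :: "coord \<Rightarrow> nat"
  where "growth c = prod_list (growth_primes c)"

lemma prime_growth_primes: "p \<in> set (growth_primes c) \<Longrightarrow> prime p"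
  by (cases c) auto

lemma multiplicity_prod_list_primes:
  assumes "prime p" "\<And>q. q \<in> set xs \<Longrightarrow> prime q"
  shows "multiplicity p (prod_list xs :: nat) = count_list xs p"
  using assms(2)
proof (induction xs)
  case (Cons q xs)
  have "0 \<notin> set xs"
    using Cons.prems[of 0] by auto
  then have "prod_list xs \<noteq> 0"
    by (simp add: prod_list_zero_iff)
  moreover have "q \<noteq> 0"
    by (metis Cons.prems list.set_intros(1) not_prime_0)
  moreover have "multiplicity p q = (if p = q then 1 else 0)"
    using assms(1) Cons.prems by (auto simp: primes_dvd_imp_eq prime_multiplicity_other)
  ultimately show ?case
    using Cons assms(1) by (simp add: prime_elem_multiplicity_mult_distrib)
qed simp

lemma growth_pos: "growth c > 0"
  using prime_growth_primes by (force simp: growth_def prod_list_zero_iff intro: Nat.gr0I)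

lemma multiplicity_growth_prod:
  assumes "prime p"
  shows "multiplicity p (\<Prod>c\<in>UNIV. growth c ^ m c) = (\<Sum>c\<in>UNIV. m c * count_list (growth_primes c) p)"
proof -
  have nz: "growth c \<noteq> 0" for c
    using growth_pos[of c] by simp
  have "multiplicity p (\<Prod>c\<in>UNIV. growth c ^ m c) = (\<Sum>c\<in>UNIV. multiplicity p (growth c ^ m c))"
    by (rule prime_elem_multiplicity_prod_distrib) (auto simp: assms nz)
  also have "\<dots> = (\<Sum>c\<in>UNIV. m c * multiplicity p (growth c))"
    by (intro sum.cong refl prime_elem_multiplicity_power_distrib) (auto simp: assms nz)
  finally show ?thesis
    using multiplicity_prod_list_primes[OF assms prime_growth_primes] by (simp add: growth_def)
qed

text \<open>Turns a full block of rules into a single alternative about exponents, which keeps the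
  case distinctions of \<open>growth_inj\<close> few.\<close>

lemma standard_product_zero:
  assumes "standard k" "\<forall>a\<in>A. \<forall>b\<in>B. (a, b) \<in> (\<lambda>(a, b, rhs). (a, b)) ` set straightening"
  shows "(\<forall>a\<in>A. k a = 0) \<or> (\<forall>b\<in>B. k b = 0)"
proof -
  have "k a = 0 \<or> k b = 0" if ab: "a \<in> A" "b \<in> B" for a b
  proof -
    have "(a, b) \<in> (\<lambda>(a, b, rhs). (a, b)) ` set straightening"
      using assms(2) ab by blast
    then obtain rhs where "(a, b, rhs) \<in> set straightening"
      by auto
    then show ?thesis
      using assms(1) by (auto simp: standard_def)
  qed
  then show ?thesis by blast
qed

text \<open>The prime exponents are six linear functions of the 14 exponents of a monomial. The
  alternatives coming from standardness make them determine first the \<open>D\<close> exponents,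
  then those of the \<open>Y\<close>, the \<open>Z\<close> and finally the \<open>P\<close>.\<close>

lemma growth_inj: "inj_on (\<lambda>m. \<Prod>c\<in>UNIV. growth c ^ m c) (Collect standard)"
proof (rule inj_onI)
  fix m m'
  assume std: "m \<in> Collect standard" "m' \<in> Collect standard"
    and eq: "(\<Prod>c\<in>UNIV. growth c ^ m c) = (\<Prod>c\<in>UNIV. growth c ^ m' c)"
  have exponents: "(\<Sum>c\<in>UNIV. m c * count_list (growth_primes c) p) =
      (\<Sum>c\<in>UNIV. m' c * count_list (growth_primes c) p)" if "prime p" for p
    using eq multiplicity_growth_prod[OF that] by metis
  note e = exponents[of 11] exponents[of 37] exponents[of 7] exponents[of 3] exponents[of 2] exponents[of 5]
  note e = e[unfolded UNIV_coord, simplified]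
  have "(\<forall>a\<in>{Y0, Y1, Y2}. k a = 0) \<or> (\<forall>b\<in>{D1, D2, D3}. k b = 0)" if "standard k" for k
    by (rule standard_product_zero[OF that]) (simp add: straightening_def)
  from this[of m] this[of m'] std
  have YD: "m Y0 + m Y1 + m Y2 = 0 \<or> m D1 + m D2 + m D3 = 0" "m' Y0 + m' Y1 + m' Y2 = 0 \<or> m' D1 + m' D2 + m' D3 = 0"
    by simp_all
  \<comment> \<open>The exponents of 7, 3, 2 and 5 together minus that of 11 give the total of the
    \<open>D\<close> minus the total of the \<open>Y\<close>, and one of these totals is 0.\<close>
  have D: "m D1 + m D2 + m D3 = m' D1 + m' D2 + m' D3" "m Y0 + m Y1 + m Y2 = m' Y0 + m' Y1 + m' Y2"
    using YD e by (elim disjE; linarith)+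
  have "(\<forall>a\<in>{Pp, Zp}. k a = 0) \<or> (\<forall>b\<in>{D3}. k b = 0)" if "standard k" for k
    by (rule standard_product_zero[OF that]) (simp add: straightening_def)
  from this[of m] this[of m'] std
  have PD: "m Pp + m Zp = 0 \<or> m D3 = 0" "m' Pp + m' Zp = 0 \<or> m' D3 = 0"
    by simp_all
  have "(\<forall>a\<in>{Pr, Zr}. k a = 0) \<or> (\<forall>b\<in>{D2}. k b = 0)" if "standard k" for k
    by (rule standard_product_zero[OF that]) (simp add: straightening_def)
  from this[of m] this[of m'] std
  have RD: "m Pr + m Zr = 0 \<or> m D2 = 0" "m' Pr + m' Zr = 0 \<or> m' D2 = 0"
    by simp_all
  \<comment> \<open>\<open>D1 + D2\<close> is the smaller of the exponent of 7 and the total of the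
    \<open>D\<close>; \<open>D1\<close> is the smaller of \<open>D1 + D2\<close> and the exponent of
    2.\<close>
  have D1: "m D1 = m' D1"
    using PD RD D(1) e(3,5) by (elim disjE; linarith)
  have D2: "m D2 = m' D2"
    using PD D(1) D1 e(3) by (elim disjE; linarith)
  have D3: "m D3 = m' D3"
    using D D1 D2 by linarith
  have "(\<forall>a\<in>{Y1, Y2}. k a = 0) \<or> (\<forall>b\<in>{Pp, Pq, Pr, Ps}. k b = 0)" if "standard k" for k
    by (rule standard_product_zero[OF that]) (simp add: straightening_def)
  from this[of m] this[of m'] std
  have YP: "m Y1 + m Y2 = 0 \<or> m Pp + m Pq + m Pr + m Ps = 0" "m' Y1 + m' Y2 = 0 \<or> m' Pp + m' Pq + m' Pr + m' Ps = 0"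
    by simp_all
  have "(\<forall>a\<in>{Y0}. k a = 0) \<or> (\<forall>b\<in>{Y2}. k b = 0)" if "standard k" for k
    by (rule standard_product_zero[OF that]) (simp add: straightening_def)
  from this[of m] this[of m'] std
  have YY: "m Y0 = 0 \<or> m Y2 = 0" "m' Y0 = 0 \<or> m' Y2 = 0"
    by simp_all
  have PZ: "m Pp + m Zp = m' Pp + m' Zp" "m Pq + m Zq = m' Pq + m' Zq"
    "m Pr + m Zr = m' Pr + m' Zr" "m Ps + m Zs = m' Ps + m' Zs"
    using e(3-6) D1 D2 D3 by linarith+
  \<comment> \<open>\<open>Y1 + 2 Y2\<close> is the excess of the exponent of 37 over the total of
    all \<open>P\<close> and \<open>Z\<close>, or 0 if there is none. As \<open>Y0\<close> and
    \<open>Y2\<close> do not occur together, this number and the total of the \<open>Y\<close>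
    determine \<open>Y1\<close> and \<open>Y2\<close>.\<close>
  have Y1: "m Y1 = m' Y1" and Y2: "m Y2 = m' Y2"
    using YP YY D(2) PZ e(2) by (elim disjE; linarith)+
  have Y0: "m Y0 = m' Y0"
    using D Y1 Y2 by linarith
  have Z: "m Zp + m Zq + m Zr + m Zs = m' Zp + m' Zq + m' Zr + m' Zs"
    using e(2) Y1 Y2 by linarith
  have "(\<forall>a\<in>{Pq, Pr, Ps}. k a = 0) \<or> (\<forall>b\<in>{Zp}. k b = 0)" if "standard k" for k
    by (rule standard_product_zero[OF that]) (simp add: straightening_def)
  from this[of m] this[of m'] std
  have PZp: "m Pq + m Pr + m Ps = 0 \<or> m Zp = 0" "m' Pq + m' Pr + m' Ps = 0 \<or> m' Zp = 0"
    by simp_all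
  have "(\<forall>a\<in>{Pr, Ps}. k a = 0) \<or> (\<forall>b\<in>{Zq}. k b = 0)" if "standard k" for k
    by (rule standard_product_zero[OF that]) (simp add: straightening_def)
  from this[of m] this[of m'] std
  have PZq: "m Pr + m Ps = 0 \<or> m Zq = 0" "m' Pr + m' Ps = 0 \<or> m' Zq = 0"
    by simp_all
  have "(\<forall>a\<in>{Ps}. k a = 0) \<or> (\<forall>b\<in>{Zr}. k b = 0)" if "standard k" for k
    by (rule standard_product_zero[OF that]) (simp add: straightening_def)
  from this[of m] this[of m'] std
  have PZr: "m Ps = 0 \<or> m Zr = 0" "m' Ps = 0 \<or> m' Zr = 0"
    by simp_all
  \<comment> \<open>In a standard monomial the factors \<open>z\<close> go to \<open>s\<close>
    first, then to \<open>r\<close>, to \<open>q\<close> and to \<open>p\<close>. So the total of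
    the \<open>Z\<close> and the sums in \<open>PZ\<close> determine each of them.\<close>
  have Zp: "m Zp = m' Zp"
    using PZp Z PZ by (elim disjE; linarith)
  have Zq: "m Zq = m' Zq"
    using PZq Z PZ Zp by (elim disjE; linarith)
  have Zr: "m Zr = m' Zr"
    using PZr Z PZ Zp Zq by (elim disjE; linarith)
  have Zs: "m Zs = m' Zs"
    using Z Zp Zq Zr by linarith
  have P: "m Pp = m' Pp" "m Pq = m' Pq" "m Pr = m' Pr" "m Ps = m' Ps"
    using Zp Zq Zr Zs PZ by linarith+
  have "m c = m' c" for c
    by (cases c) (simp_all add: D1 D2 D3 Y0 Y1 Y2 Zp Zq Zr Zs P)
  then show "m = m'" by blast
qed


section \<open>Points of a chart\<close>

definition vec_7 :: "complex \<Rightarrow> complex \<Rightarrow> complex \<Rightarrow> complex \<Rightarrow> complex \<Rightarrow> complex \<Rightarrow> complex \<Rightarrow> complex ^ 7"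
  where "vec_7 a b c d e f g = (\<chi> i. if i = 0 then a else if i = 1 then b else if i = 2 then c else
    if i = 3 then d else if i = 4 then e else if i = 5 then f else g)"

lemma vec_7_nth [simp]:
  "vec_7 a b c d e f g $ 0 = a" "vec_7 a b c d e f g $ 1 = b" "vec_7 a b c d e f g $ 2 = c"
  "vec_7 a b c d e f g $ 3 = d" "vec_7 a b c d e f g $ 4 = e" "vec_7 a b c d e f g $ 5 = f"
  "vec_7 a b c d e f g $ 6 = g"
  by (simp_all add: vec_7_def)

text \<open>The solution of the seven linear equations in the chart of the Grassmannian around \<open>e\<^sub>1 \<and> e\<^sub>5\<close>.\<close>

definition chart_point :: "complex \<Rightarrow> complex \<Rightarrow> complex \<Rightarrow> complex \<Rightarrow> complex \<Rightarrow> complex \<Rightarrow> complex \<Rightarrow> complex ^ coord"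
  where "chart_point t u z p q r s = form_coords (
    ext_vec (u *s vec_7 1 (- z - t * (p * s - q * r)) p (- (t * (p * r + q * q))) 0 r (- q)) \<^bold>\<and>
    ext_vec (vec_7 0 (- (t * (r * r + q * s))) q z 1 s r))"

lemma chart_point_in_G_family:
  assumes "u \<noteq> 0"
  shows "chart_point t u z p q r s \<in> G_family t"
proof -
  define v where "v = u *s vec_7 1 (- z - t * (p * s - q * r)) p (- (t * (p * r + q * q))) 0 r (- q)"
  define w where "w = vec_7 0 (- (t * (r * r + q * s))) q z 1 s r"
  have power: "ext_vec v \<^bold>\<and> ext_vec w \<in> ext_power 2"
    using wedge_ext_power[OF ext_vec_ext_power[of v] ext_vec_ext_power[of w]] by (simp add: numeral_2_eq_2)
  have "(ext_vec v \<^bold>\<and> ext_vec w) \<^bold>\<and> omega_family t = 0"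
    unfolding wedge_omega_family_eq_0_iff[OF power]
    by (simp add: ext_vec_wedge_nth v_def w_def algebra_simps)
  then have "span_form t (chart_point t u z p q r s) = ext_vec v \<^bold>\<and> ext_vec w"
    unfolding chart_point_def v_def[symmetric] w_def[symmetric] by (rule span_form_form_coords[OF power])
  moreover have "chart_point t u z p q r s $ Y0 = u"
    by (simp add: chart_point_def ext_vec_wedge_nth)
  then have "chart_point t u z p q r s \<noteq> 0"
    using assms by auto
  ultimately show ?thesis
    by (auto simp: G_family_iff)
qed

text \<open>The primes satisfy, among other comparisons, \<open>3 * 3 < 7 * 2\<close>,
  \<open>3 * 2 < 7 * 5\<close>, \<open>2 * 2 < 3 * 5\<close>, \<open>7 * 5 < 37\<close> and
  \<open>7 * 15 < 37 * 3\<close>. This keeps the leading term of every coordinate free of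
  \<open>t\<close>.\<close>

lemma chart_point_growth:
  "\<exists>\<sigma>. \<sigma> \<noteq> 0 \<and> grows_like (\<lambda>n. chart_point t (of_nat 11 ^ n) (of_nat 37 ^ n) (of_nat 7 ^ n)
    (of_nat 3 ^ n) (of_nat 2 ^ n) (of_nat 5 ^ n) $ c) (growth c) \<sigma>"
proof -
  define U Z p q r s :: "nat \<Rightarrow> complex" where
    "U = (\<lambda>n. of_nat 11 ^ n)" and "Z = (\<lambda>n. of_nat 37 ^ n)" and "p = (\<lambda>n. of_nat 7 ^ n)" and
    "q = (\<lambda>n. of_nat 3 ^ n)" and "r = (\<lambda>n. of_nat 2 ^ n)" and "s = (\<lambda>n. of_nat 5 ^ n)"
  have U: "grows_like U 11 1" and Z: "grows_like Z 37 1" and p: "grows_like p 7 1"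
    and q: "grows_like q 3 1" and r: "grows_like r 2 1" and s: "grows_like s 5 1"
    unfolding U_def Z_def p_def q_def r_def s_def by (rule grows_like_power; simp)+
  define d1 d2 d3 a2 b2 a4 where "d1 = (\<lambda>n. p n * r n + q n * q n)" and "d2 = (\<lambda>n. p n * s n - q n * r n)"
    and "d3 = (\<lambda>n. q n * s n + r n * r n)" and "a2 = (\<lambda>n. - Z n - t * d2 n)"
    and "b2 = (\<lambda>n. - (t * d3 n))" and "a4 = (\<lambda>n. - (t * d1 n))"
  have d1: "grows_like d1 14 1"
    unfolding d1_def using grows_like_add_dominated[OF grows_like_mult[OF p r] grows_like_mult[OF q q]] by simp
  have d2: "grows_like d2 35 1"
    unfolding d2_def using grows_like_diff_dominated[OF grows_like_mult[OF p s] grows_like_mult[OF q r]] by simp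
  have d3: "grows_like d3 15 1"
    unfolding d3_def using grows_like_add_dominated[OF grows_like_mult[OF q s] grows_like_mult[OF r r]] by simp
  have a2: "grows_like a2 37 (- 1)"
    unfolding a2_def
    using grows_like_diff_dominated[OF grows_like_uminus[OF Z] grows_like_const_mult[OF d2, of t]] by simp
  \<comment> \<open>The constant is 0 at \<open>t = 0\<close>. The bound on the growth, which is all
    that the comparisons below use, holds nevertheless.\<close>
  have b2: "grows_like b2 15 (- t)"
    unfolding b2_def using grows_like_uminus[OF grows_like_const_mult[OF d3, of t]] by simp
  have a4: "grows_like a4 14 (- t)"
    unfolding a4_def using grows_like_uminus[OF grows_like_const_mult[OF d1, of t]] by simp
  have y2: "grows_like (\<lambda>n. a2 n * Z n - a4 n * b2 n) 1369 (- 1)"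
    using grows_like_diff_dominated[OF grows_like_mult[OF a2 Z] grows_like_mult[OF a4 b2]] by simp
  have zp: "grows_like (\<lambda>n. Z n * p n - a4 n * q n) 259 1"
    using grows_like_diff_dominated[OF grows_like_mult[OF Z p] grows_like_mult[OF a4 q]] by simp
  have zq: "grows_like (\<lambda>n. a2 n * q n - p n * b2 n) 111 (- 1)"
    using grows_like_diff_dominated[OF grows_like_mult[OF a2 q] grows_like_mult[OF p b2]] by simp
  have zr: "grows_like (\<lambda>n. a2 n * r n + q n * b2 n) 74 (- 1)"
    using grows_like_add_dominated[OF grows_like_mult[OF a2 r] grows_like_mult[OF q b2]] by simp
  have zs: "grows_like (\<lambda>n. a2 n * s n - r n * b2 n) 185 (- 1)"
    using grows_like_diff_dominated[OF grows_like_mult[OF a2 s] grows_like_mult[OF r b2]] by simp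
  note mult = grows_like_mult[OF U]
  have point: "chart_point t (U n) (Z n) (p n) (q n) (r n) (s n) $ c = U n * (case c of
      Y0 \<Rightarrow> 1 | Y1 \<Rightarrow> Z n | Y2 \<Rightarrow> a2 n * Z n - a4 n * b2 n | Pp \<Rightarrow> p n | Pq \<Rightarrow> q n | Pr \<Rightarrow> r n | Ps \<Rightarrow> s n |
      Zp \<Rightarrow> Z n * p n - a4 n * q n | Zq \<Rightarrow> a2 n * q n - p n * b2 n | Zr \<Rightarrow> a2 n * r n + q n * b2 n |
      Zs \<Rightarrow> a2 n * s n - r n * b2 n | D1 \<Rightarrow> d1 n | D2 \<Rightarrow> d2 n | D3 \<Rightarrow> d3 n)" for c n
    by (cases c) (simp_all add: chart_point_def ext_vec_wedge_nth a2_def a4_def b2_def d1_def d2_def d3_def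
        algebra_simps)
  define \<sigma> :: complex where "\<sigma> = (if c \<in> {Y2, Zq, Zr, Zs} then - 1 else 1)"
  have "grows_like (\<lambda>n. chart_point t (U n) (Z n) (p n) (q n) (r n) (s n) $ c) (growth c) \<sigma>"
    unfolding point \<sigma>_def
    using U mult[OF Z] mult[OF y2] mult[OF p] mult[OF q] mult[OF r] mult[OF s] mult[OF zp] mult[OF zq]
      mult[OF zr] mult[OF zs] mult[OF d1] mult[OF d2] mult[OF d3]
    by (cases c) (simp_all add: growth_def)
  moreover have "\<sigma> \<noteq> 0"
    by (simp add: \<sigma>_def)
  ultimately show ?thesis
    unfolding U_def Z_def p_def q_def r_def s_def by blast
qed

lemma standard_monomials_independent:
  assumes "finite F" "F \<subseteq> Collect standard" "\<And>z. z \<in> G_family t \<Longrightarrow> (\<Sum>m\<in>F. \<beta> m * monomial m z) = 0" "m \<in> F"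
  shows "\<beta> m = 0"
proof -
  define x where "x n = chart_point t (of_nat 11 ^ n) (of_nat 37 ^ n) (of_nat 7 ^ n)
    (of_nat 3 ^ n) (of_nat 2 ^ n) (of_nat 5 ^ n)" for n
  have "\<forall>c. \<exists>\<sigma>. \<sigma> \<noteq> 0 \<and> grows_like (\<lambda>n. x n $ c) (growth c) \<sigma>"
    unfolding x_def using chart_point_growth by blast
  from choice[OF this] obtain \<sigma> where
    \<sigma>: "\<And>c. \<sigma> c \<noteq> 0" "\<And>c. grows_like (\<lambda>n. x n $ c) (growth c) (\<sigma> c)"
    by blast
  show ?thesis
  proof (rule grows_like_independent[where F = F and \<beta> = \<beta> and N = "\<lambda>m. \<Prod>c\<in>UNIV. growth c ^ m c"
        and f = "\<lambda>m n. monomial m (x n)" and c = "\<lambda>m. \<Prod>c\<in>UNIV. \<sigma> c ^ m c"])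
    show "inj_on (\<lambda>m. \<Prod>c\<in>UNIV. growth c ^ m c) F"
      using growth_inj assms(2) by (rule inj_on_subset)
    show "grows_like (\<lambda>n. monomial m (x n)) (\<Prod>c\<in>UNIV. growth c ^ m c) (\<Prod>c\<in>UNIV. \<sigma> c ^ m c)" for m
      unfolding monomial_def by (intro grows_like_prod grows_like_pow \<sigma>)
    show "(\<Sum>m\<in>F. \<beta> m * monomial m (x n)) = 0" for n
      by (rule assms(3)) (simp add: x_def chart_point_in_G_family)
  qed (use assms \<sigma> growth_pos in \<open>auto simp: prod_pos\<close>)
qed


section \<open>The orbit of a non-degenerate form\<close>

lemma ext_map_axis_4:
  "ext_map g (axis {0, 1, 2, 6 :: 7} 1) = wedge_list (map (\<lambda>i. g *v axis i 1) [0, 1, 2, 6])"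
  "ext_map g (axis {3, 4, 5, 6 :: 7} 1) = wedge_list (map (\<lambda>i. g *v axis i 1) [3, 4, 5, 6])"
  "ext_map g (axis {1, 2, 4, 5 :: 7} 1) = wedge_list (map (\<lambda>i. g *v axis i 1) [1, 2, 4, 5])"
  "ext_map g (axis {0, 2, 3, 5 :: 7} 1) = wedge_list (map (\<lambda>i. g *v axis i 1) [0, 2, 3, 5])"
  "ext_map g (axis {0, 1, 3, 4 :: 7} 1) = wedge_list (map (\<lambda>i. g *v axis i 1) [0, 1, 3, 4])"
  by (simp_all add: ext_map_axis_insert_min ext_map_axis[of g "{}"])

lemma matrix_mult_axis: "(A *v axis k 1) $ i = (A $ i $ k :: complex)"
  by (simp add: matrix_vector_mult_def axis_def if_distrib[where f = "(*) _"] cong: if_cong)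

lemma omega0_eq_ext_map:
  assumes "is_basis x"
  obtains g where "invertible g" "omega0 x = ext_map g (omega_family 0)"
proof
  \<comment> \<open>Shifts the indices 0 to 6 of the type \<open>7\<close> to 1 to 7, so that the
    columns of \<open>g\<close> are the given basis.\<close>
  define c :: "7 \<Rightarrow> nat" where "c j = (if j = 0 then 1 else if j = 1 then 2 else if j = 2 then 3 else
    if j = 3 then 4 else if j = 4 then 5 else if j = 5 then 6 else 7)" for j
  define g :: "complex ^ 7 ^ 7" where "g = (\<chi> i j. x (c j) $ i)"
  have column: "g *v axis j 1 = x (c j)" for j
    by (simp add: g_def matrix_mult_axis vec_eq_iff)
  have "range c = {1..7}"
  proof
    show "range c \<subseteq> {1..7}"
      by (auto simp: c_def)
    show "{1..7} \<subseteq> range c"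
    proof
      fix k :: nat assume "k \<in> {1..7}"
      then have "k = c 0 \<or> k = c 1 \<or> k = c 2 \<or> k = c 3 \<or> k = c 4 \<or> k = c 5 \<or> k = c 6"
        by (simp add: c_def) linarith
      then show "k \<in> range c" by blast
    qed
  qed
  moreover have "columns g = x ` range c"
    by (auto simp: columns_def g_def column_def vec_eq_iff image_iff)
  ultimately have "vec.span (columns g) = UNIV"
    using assms by (simp add: is_basis_def)
  then show "invertible g"
    using matrix_right_invertible_span_columns invertible_right_inverse by blast
  show "omega0 x = ext_map g (omega_family 0)"
    by (simp add: omega0_def omega_family_def ext_map_add ext_map_scale ext_map_axis_4 column c_def)
qed

section \<open>The infinitesimal action on four-forms\<close>

lemma scaleR_vec_complex: "r *\<^sub>R v = complex_of_real r *s v"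
  by (simp add: vec_eq_iff scaleR_conv_of_real[where 'a = complex])

lemma bounded_bilinear_wedge: "bounded_bilinear (wedge :: 'm::{finite,linorder} ext \<Rightarrow> _)"
  unfolding bilinear_conv_bounded_bilinear[symmetric] bilinear_def
  by (auto intro!: linearI simp: wedge_add_left wedge_add_right wedge_scale_left wedge_scale_right scaleR_vec_complex)

lemma bounded_linear_column: "bounded_linear (\<lambda>g :: complex ^ 7 ^ 7. ext_vec (g *v axis i 1))"
  unfolding linear_conv_bounded_linear[symmetric]
proof (rule linearI)
  fix r :: real and g :: "complex ^ 7 ^ 7"
  have "(r *\<^sub>R g) *v axis i 1 = complex_of_real r *s (g *v axis i 1)"
    by (simp add: vec_eq_iff matrix_mult_axis scaleR_conv_of_real[where 'a = complex])
  then show "ext_vec ((r *\<^sub>R g) *v axis i 1) = r *\<^sub>R ext_vec (g *v axis i 1)"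
    by (simp add: ext_vec_scale scaleR_vec_complex)
qed (simp add: matrix_vector_mult_add_rdistrib ext_vec_add)

text \<open>The Leibniz rule: how \<open>X\<close>, as an element of the Lie algebra of GL(7), acts
  on the product of the basis vectors with indices \<open>a\<close>, \<open>b\<close>,
  \<open>c\<close>, \<open>d\<close>.\<close>

definition wedge_tangent :: "7 \<Rightarrow> 7 \<Rightarrow> 7 \<Rightarrow> 7 \<Rightarrow> complex ^ 7 ^ 7 \<Rightarrow> 7 ext"
  where "wedge_tangent a b c d X =
    ext_vec (X *v axis a 1) \<^bold>\<and> axis {b} 1 \<^bold>\<and> axis {c} 1 \<^bold>\<and> axis {d} 1 +
    axis {a} 1 \<^bold>\<and> ext_vec (X *v axis b 1) \<^bold>\<and> axis {c} 1 \<^bold>\<and> axis {d} 1 +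
    axis {a} 1 \<^bold>\<and> axis {b} 1 \<^bold>\<and> ext_vec (X *v axis c 1) \<^bold>\<and> axis {d} 1 +
    axis {a} 1 \<^bold>\<and> axis {b} 1 \<^bold>\<and> axis {c} 1 \<^bold>\<and> ext_vec (X *v axis d 1)"

lemma has_derivative_wedge_list_4:
  "((\<lambda>g. wedge_list (map (\<lambda>i. g *v axis i 1) [a, b, c, d])) has_derivative wedge_tangent a b c d) (at (mat 1))"
proof -
  note column = bounded_linear_imp_has_derivative[OF bounded_linear_column]
  note wedge = bounded_bilinear.FDERIV[OF bounded_bilinear_wedge]
  show ?thesis
    by (rule has_derivative_eq_rhs, simp only: list.map wedge_list_simps wedge_ext_one,
        (rule wedge column)+)
       (auto simp: wedge_tangent_def fun_eq_iff wedge_add_right add_ac)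
qed

definition orbit_tangent :: "complex ^ 7 ^ 7 \<Rightarrow> 7 ext"
  where "orbit_tangent X = wedge_tangent 0 1 2 6 X + wedge_tangent 3 4 5 6 X + wedge_tangent 1 2 4 5 X +
    wedge_tangent 0 2 3 5 X + wedge_tangent 0 1 3 4 X"

lemma has_derivative_orbit:
  "((\<lambda>g. ext_map g (omega_family 1)) has_derivative orbit_tangent) (at (mat 1))"
proof -
  have "(\<lambda>g. ext_map g (omega_family 1)) = (\<lambda>g. wedge_list (map (\<lambda>i. g *v axis i 1) [0, 1, 2, 6]) +
      wedge_list (map (\<lambda>i. g *v axis i 1) [3, 4, 5, 6]) + wedge_list (map (\<lambda>i. g *v axis i 1) [1, 2, 4, 5]) +
      wedge_list (map (\<lambda>i. g *v axis i 1) [0, 2, 3, 5]) + wedge_list (map (\<lambda>i. g *v axis i 1) [0, 1, 3, 4]))"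
    unfolding omega_family_def by (simp only: ext_map_add ext_map_scale ext_map_axis_4 vec.scale_one)
  then show ?thesis
    unfolding orbit_tangent_def[abs_def] by (auto intro!: has_derivative_add has_derivative_wedge_list_4 simp del: list.map)
qed

text \<open>Scaling by a complex number: on \<open>complex ^ 7 ^ 7\<close> the operation
  \<open>*s\<close> takes its scalar from \<open>complex ^ 7\<close>, and \<open>*\<^sub>R\<close>
  takes a real one.\<close>

definition matrix_scale :: "complex \<Rightarrow> complex ^ 7 ^ 7 \<Rightarrow> complex ^ 7 ^ 7"
  where "matrix_scale c X = (\<chi> i j. c * X $ i $ j)"

definition elementary_matrix :: "7 \<Rightarrow> 7 \<Rightarrow> complex ^ 7 ^ 7"
  where "elementary_matrix i j = (\<chi> k l. if k = i \<and> l = j then 1 else 0)"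

lemma matrix_scale_mult_vec: "matrix_scale c X *v u = c *s (X *v u)"
  by (simp add: matrix_scale_def matrix_vector_mult_def vec_eq_iff sum_distrib_left mult.assoc)

lemma elementary_matrix_axis: "elementary_matrix i j *v axis k 1 = (if k = j then axis i 1 else 0)"
  by (simp add: elementary_matrix_def matrix_mult_axis vec_eq_iff) (simp add: axis_def)

lemma wedge_tangent_add: "wedge_tangent a b c d (X + Y) = wedge_tangent a b c d X + wedge_tangent a b c d Y"
  by (simp add: wedge_tangent_def matrix_vector_mult_add_rdistrib ext_vec_add wedge_add_left wedge_add_right)

lemma wedge_tangent_scale: "wedge_tangent a b c d (matrix_scale k X) = k *s wedge_tangent a b c d X"
  by (simp add: wedge_tangent_def matrix_scale_mult_vec ext_vec_scale wedge_scale_left wedge_scale_right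
      vec.scale_right_distrib)

lemma orbit_tangent_add: "orbit_tangent (X + Y) = orbit_tangent X + orbit_tangent Y"
  by (simp add: orbit_tangent_def wedge_tangent_add)

lemma orbit_tangent_scale: "orbit_tangent (matrix_scale k X) = k *s orbit_tangent X"
  by (simp add: orbit_tangent_def wedge_tangent_scale vec.scale_right_distrib)

lemma ext_vec_0 [simp]: "ext_vec 0 = 0"
  by (simp add: ext_vec_def)

text \<open>These are 35 of the 49 elementary matrices, as many as the dimension of the space of
  four-forms. Their images span it by the computation in \<open>orbit_tangent_surj\<close>; so the
  kernel has dimension 14, that of the Lie algebra of type \<open>G\<^sub>2\<close>.\<close>

lemma orbit_tangent_elementary_matrix:
  "orbit_tangent (elementary_matrix 0 0) = axis {0, 1, 2, 6} 1 + axis {0, 1, 3, 4} 1 + axis {0, 2, 3, 5} 1"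
  "orbit_tangent (elementary_matrix 0 1) = axis {0, 2, 4, 5} 1"
  "orbit_tangent (elementary_matrix 0 2) = - axis {0, 1, 4, 5} 1"
  "orbit_tangent (elementary_matrix 0 3) = axis {0, 4, 5, 6} 1"
  "orbit_tangent (elementary_matrix 0 4) = axis {0, 1, 2, 5} 1 - axis {0, 3, 5, 6} 1"
  "orbit_tangent (elementary_matrix 0 5) = - axis {0, 1, 2, 4} 1 + axis {0, 3, 4, 6} 1"
  "orbit_tangent (elementary_matrix 0 6) = - axis {0, 3, 4, 5} 1"
  "orbit_tangent (elementary_matrix 1 0) = axis {1, 2, 3, 5} 1"
  "orbit_tangent (elementary_matrix 1 1) = axis {0, 1, 2, 6} 1 + axis {0, 1, 3, 4} 1 + axis {1, 2, 4, 5} 1"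
  "orbit_tangent (elementary_matrix 1 2) = axis {0, 1, 3, 5} 1"
  "orbit_tangent (elementary_matrix 1 3) = - axis {0, 1, 2, 5} 1 + axis {1, 4, 5, 6} 1"
  "orbit_tangent (elementary_matrix 1 4) = - axis {1, 3, 5, 6} 1"
  "orbit_tangent (elementary_matrix 1 5) = axis {0, 1, 2, 3} 1 + axis {1, 3, 4, 6} 1"
  "orbit_tangent (elementary_matrix 1 6) = - axis {1, 3, 4, 5} 1"
  "orbit_tangent (elementary_matrix 2 0) = - axis {1, 2, 3, 4} 1"
  "orbit_tangent (elementary_matrix 2 1) = axis {0, 2, 3, 4} 1"
  "orbit_tangent (elementary_matrix 2 2) = axis {0, 1, 2, 6} 1 + axis {0, 2, 3, 5} 1 + axis {1, 2, 4, 5} 1"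
  "orbit_tangent (elementary_matrix 2 3) = axis {0, 1, 2, 4} 1 + axis {2, 4, 5, 6} 1"
  "orbit_tangent (elementary_matrix 2 4) = - axis {0, 1, 2, 3} 1 - axis {2, 3, 5, 6} 1"
  "orbit_tangent (elementary_matrix 2 5) = axis {2, 3, 4, 6} 1"
  "orbit_tangent (elementary_matrix 2 6) = - axis {2, 3, 4, 5} 1"
  "orbit_tangent (elementary_matrix 3 0) = axis {1, 2, 3, 6} 1"
  "orbit_tangent (elementary_matrix 3 1) = - axis {0, 2, 3, 6} 1 - axis {2, 3, 4, 5} 1"
  "orbit_tangent (elementary_matrix 3 2) = axis {0, 1, 3, 6} 1 + axis {1, 3, 4, 5} 1"
  "orbit_tangent (elementary_matrix 3 3) = axis {0, 1, 3, 4} 1 + axis {0, 2, 3, 5} 1 + axis {3, 4, 5, 6} 1"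
  "orbit_tangent (elementary_matrix 3 6) = axis {0, 1, 2, 3} 1"
  "orbit_tangent (elementary_matrix 4 0) = axis {1, 2, 4, 6} 1 + axis {2, 3, 4, 5} 1"
  "orbit_tangent (elementary_matrix 4 1) = - axis {0, 2, 4, 6} 1"
  "orbit_tangent (elementary_matrix 4 2) = axis {0, 1, 4, 6} 1 - axis {0, 3, 4, 5} 1"
  "orbit_tangent (elementary_matrix 4 6) = axis {0, 1, 2, 4} 1"
  "orbit_tangent (elementary_matrix 5 0) = axis {1, 2, 5, 6} 1 - axis {1, 3, 4, 5} 1"
  "orbit_tangent (elementary_matrix 5 1) = - axis {0, 2, 5, 6} 1 + axis {0, 3, 4, 5} 1"
  "orbit_tangent (elementary_matrix 5 2) = axis {0, 1, 5, 6} 1"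
  "orbit_tangent (elementary_matrix 5 6) = axis {0, 1, 2, 5} 1"
  "orbit_tangent (elementary_matrix 6 6) = axis {0, 1, 2, 6} 1 + axis {3, 4, 5, 6} 1"
  by (simp_all add: orbit_tangent_def wedge_tangent_def elementary_matrix_axis wedge_axis inversions_singleton_insert
      wedge_scale_right wedge_minus_right insert_commute)


lemma card_4_increasing:
  fixes S :: "'a::linorder set"
  assumes "card S = 4"
  obtains i j k l where "S = {i, j, k, l}" "i < j" "j < k" "k < l"
proof -
  have fin: "finite S"
    using assms card.infinite by fastforce
  have "length (sorted_list_of_set S) = Suc (Suc (Suc (Suc 0)))"
    using assms by simp
  then obtain i j k l where ijkl: "sorted_list_of_set S = [i, j, k, l]"
    unfolding length_Suc_conv by blast
  have "S = set [i, j, k, l]"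
    using set_sorted_list_of_set[OF fin] ijkl by simp
  moreover have "sorted_wrt (<) [i, j, k, l]"
    using strict_sorted_list_of_set[of S] ijkl by simp
  ultimately show thesis
    using that by simp
qed

lemma orbit_tangent_surj:
  assumes "\<alpha> \<in> ext_power 4"
  shows "\<exists>X. orbit_tangent X = \<alpha>"
proof -
  define R where "R = range orbit_tangent"
  have add: "\<beta> + \<gamma> \<in> R" if "\<beta> \<in> R" "\<gamma> \<in> R" for \<beta> \<gamma>
    using that unfolding R_def by (auto simp: orbit_tangent_add[symmetric])
  have scale: "k *s \<beta> \<in> R" if "\<beta> \<in> R" for k \<beta>
    using that unfolding R_def by (auto simp: orbit_tangent_scale[symmetric])
  have zero: "0 \<in> R"
    using scale[of "orbit_tangent 0" 0] by (simp add: R_def)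
  let ?T = orbit_tangent and ?E = elementary_matrix and ?c = matrix_scale
  note tangent = orbit_tangent_add orbit_tangent_scale orbit_tangent_elementary_matrix
  \<comment> \<open>The combinations invert the table in
    \<open>orbit_tangent_elementary_matrix\<close>. The fractions come from the five diagonal
    matrices, whose images involve only the five monomials of \<open>omega_family 1\<close>.\<close>
  have "?T (?E 3 6) = axis {0, 1, 2, 3} 1"
    "?T (?E 4 6) = axis {0, 1, 2, 4} 1"
    "?T (?E 5 6) = axis {0, 1, 2, 5} 1"
    "?T (?c (-1/2) (?E 3 3) + ?c (1/2) (?E 6 6) + ?c (1/2) (?E 0 0)) = axis {0, 1, 2, 6} 1"
    "?T (?c (1/4) (?E 3 3) + ?c (-1/4) (?E 6 6) + ?c (1/4) (?E 0 0) + ?c (-1/2) (?E 2 2) + ?c (1/2) (?E 1 1)) = axis {0, 1, 3, 4} 1"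
    "?T (?E 1 2) = axis {0, 1, 3, 5} 1"
    "?T (?E 3 2 + ?E 1 6) = axis {0, 1, 3, 6} 1"
    "?T (?c (-1) (?E 0 2)) = axis {0, 1, 4, 5} 1"
    "?T (?E 4 2 + ?c (-1) (?E 0 6)) = axis {0, 1, 4, 6} 1"
    "?T (?E 5 2) = axis {0, 1, 5, 6} 1"
    "?T (?E 2 1) = axis {0, 2, 3, 4} 1"
    "?T (?c (1/4) (?E 3 3) + ?c (-1/4) (?E 6 6) + ?c (1/4) (?E 0 0) + ?c (1/2) (?E 2 2) + ?c (-1/2) (?E 1 1)) = axis {0, 2, 3, 5} 1"
    "?T (?c (-1) (?E 3 1) + ?E 2 6) = axis {0, 2, 3, 6} 1"
    "?T (?E 0 1) = axis {0, 2, 4, 5} 1"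
    "?T (?c (-1) (?E 4 1)) = axis {0, 2, 4, 6} 1"
    "?T (?c (-1) (?E 5 1) + ?c (-1) (?E 0 6)) = axis {0, 2, 5, 6} 1"
    "?T (?c (-1) (?E 0 6)) = axis {0, 3, 4, 5} 1"
    "?T (?E 0 5 + ?E 4 6) = axis {0, 3, 4, 6} 1"
    "?T (?c (-1) (?E 0 4) + ?E 5 6) = axis {0, 3, 5, 6} 1"
    "?T (?E 0 3) = axis {0, 4, 5, 6} 1"
    "?T (?c (-1) (?E 2 0)) = axis {1, 2, 3, 4} 1"
    "?T (?E 1 0) = axis {1, 2, 3, 5} 1"
    "?T (?E 3 0) = axis {1, 2, 3, 6} 1"
    "?T (?c (1/4) (?E 3 3) + ?c (-1/4) (?E 6 6) + ?c (-3/4) (?E 0 0) + ?c (1/2) (?E 2 2) + ?c (1/2) (?E 1 1)) = axis {1, 2, 4, 5} 1"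
    "?T (?E 4 0 + ?E 2 6) = axis {1, 2, 4, 6} 1"
    "?T (?E 5 0 + ?c (-1) (?E 1 6)) = axis {1, 2, 5, 6} 1"
    "?T (?c (-1) (?E 1 6)) = axis {1, 3, 4, 5} 1"
    "?T (?E 1 5 + ?c (-1) (?E 3 6)) = axis {1, 3, 4, 6} 1"
    "?T (?c (-1) (?E 1 4)) = axis {1, 3, 5, 6} 1"
    "?T (?E 1 3 + ?E 5 6) = axis {1, 4, 5, 6} 1"
    "?T (?c (-1) (?E 2 6)) = axis {2, 3, 4, 5} 1"
    "?T (?E 2 5) = axis {2, 3, 4, 6} 1"
    "?T (?c (-1) (?E 2 4) + ?c (-1) (?E 3 6)) = axis {2, 3, 5, 6} 1"
    "?T (?E 2 3 + ?c (-1) (?E 4 6)) = axis {2, 4, 5, 6} 1"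
    "?T (?c (1/2) (?E 3 3) + ?c (1/2) (?E 6 6) + ?c (-1/2) (?E 0 0)) = axis {3, 4, 5, 6} 1"
    by (simp_all add: tangent) (simp_all add: vec_eq_iff field_simps)
  note members = this[THEN sym, THEN range_eqI[where f = orbit_tangent], folded R_def]
  have increasing: "\<forall>i j. i < j \<longrightarrow> (\<forall>k. j < k \<longrightarrow> (\<forall>l. k < l \<longrightarrow> axis {i, j, k, l} 1 \<in> R))"
    unfolding all_7 by (simp add: members)
  have axis: "axis S 1 \<in> R" if S: "card S = 4" for S
    using card_4_increasing[OF S] increasing by metis
  have sum: "(\<Sum>S\<in>A. f S) \<in> R" if "\<And>S. S \<in> A \<Longrightarrow> f S \<in> R" for A :: "7 set set" and f
    using that by (induction A rule: infinite_finite_induct) (auto simp: zero add)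
  have "(\<Sum>S\<in>UNIV. \<alpha> $ S *s axis S 1) \<in> R"
  proof (rule sum)
    fix S
    show "\<alpha> $ S *s axis S 1 \<in> R"
      using assms scale[OF axis, of S "\<alpha> $ S"] zero by (cases "card S = 4") (auto simp: ext_power_def)
  qed
  then show ?thesis
    by (auto simp: R_def basis_expansion)
qed

section \<open>The open orbit\<close>

lemma continuous_on_det: "continuous_on UNIV (det :: complex ^ 'n ^ 'n \<Rightarrow> complex)"
  unfolding det_def[abs_def] by (intro continuous_intros)

lemma open_invertible: "open {g :: complex ^ 'n ^ 'n. invertible g}"
proof -
  have "{g :: complex ^ 'n ^ 'n. invertible g} = det -` (- {0})"
    by (auto simp: invertible_det_nz)
  moreover have "open (det -` (- {0 :: complex}) :: (complex ^ 'n ^ 'n) set)"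
    by (rule open_vimage[OF _ continuous_on_det]) (simp add: open_Compl)
  ultimately show ?thesis by simp
qed

text \<open>
  The summand \<open>off\<close> fills up the components of degree other than four, so that the open mapping
  theorem applies in the whole exterior algebra.
\<close>

lemma orbit_omega_family_neighbourhood:
  "\<exists>e>0. \<forall>\<alpha>\<in>ext_power 4. dist (omega_family 1) \<alpha> < e \<longrightarrow> (\<exists>g. invertible g \<and> \<alpha> = ext_map g (omega_family 1))"
proof -
  define off :: "7 ext \<Rightarrow> 7 ext" where "off \<beta> = (\<chi> S. if card S = 4 then 0 else \<beta> $ S)" for \<beta>
  have off: "linear off"
    by (rule linearI) (auto simp: off_def vec_eq_iff)
  define f where "f p = ext_map (fst p) (omega_family 1) + off (snd p)" for p
  define f' where "f' p = orbit_tangent (fst p) + off (snd p)" for p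
  note off' = off[unfolded linear_conv_bounded_linear]
  have "((\<lambda>g. ext_map g (omega_family 1)) has_derivative orbit_tangent) (at (fst (mat 1 :: complex ^ 7 ^ 7, 0 :: 7 ext)))"
    using has_derivative_orbit by simp
  from has_derivative_compose[OF bounded_linear_imp_has_derivative[OF bounded_linear_fst] this]
  have f_der: "(f has_derivative f') (at (mat 1, 0))"
    unfolding f_def[abs_def] f'_def[abs_def]
    by (rule has_derivative_add)
       (rule bounded_linear_imp_has_derivative[OF bounded_linear_compose[OF off' bounded_linear_snd]])
  have "continuous_on UNIV (\<lambda>g. ext_map g (omega_family 1))"
  proof -
    have "continuous_on UNIV (\<lambda>g :: complex ^ 7 ^ 7. ext_vec (g *v axis i 1))" for i
      by (rule linear_continuous_on[OF bounded_linear_column])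
    then show ?thesis
      unfolding omega_family_def ext_map_add ext_map_scale ext_map_axis_4 vec.scale_one
      by (auto intro!: continuous_on_add bounded_bilinear.continuous_on[OF bounded_bilinear_wedge])
  qed
  then have cont: "continuous_on UNIV f"
    unfolding f_def[abs_def]
    by (rule continuous_on_add[OF continuous_on_compose2[OF _ continuous_on_fst[OF continuous_on_id]]
          linear_continuous_on[OF bounded_linear_compose[OF off' bounded_linear_snd]]]) auto
  have surj: "surj f'"
  unfolding surj_def
  proof
    fix \<alpha>
    have "\<alpha> - off \<alpha> \<in> ext_power 4"
      by (simp add: ext_power_def off_def)
    then obtain X where "orbit_tangent X = \<alpha> - off \<alpha>"
      using orbit_tangent_surj by blast
    then have "\<alpha> = f' (X, \<alpha>)"
      by (simp add: f'_def)
    then show "\<exists>p. \<alpha> = f' p" by blast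
  qed
  have "linear f'"
    using f_der has_derivative_linear by blast
  then obtain g' where g': "linear g'" "f' \<circ> g' = id"
    using linear_surjective_right_inverse surj by blast
  define T where "T = {g :: complex ^ 7 ^ 7. invertible g} \<times> (UNIV :: 7 ext set)"
  have "open T"
    unfolding T_def by (intro open_Times open_invertible open_UNIV)
  moreover have "(mat 1, 0) \<in> T"
    by (auto simp: T_def invertible_def intro!: exI[of _ "mat 1"])
  ultimately have "f (mat 1, 0) \<in> interior (f ` T)"
    using g' linear_conv_bounded_linear
    by (intro sussmann_open_mapping[OF open_UNIV cont UNIV_I f_der]) (auto simp: interior_open)
  moreover have "f (mat 1, 0) = omega_family 1"
    by (simp add: f_def off_def ext_map_id vec_eq_iff)
  ultimately obtain e where e: "e > 0" "ball (omega_family 1) e \<subseteq> f ` T"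
    by (auto simp: mem_interior)
  have "\<exists>g. invertible g \<and> \<alpha> = ext_map g (omega_family 1)"
    if \<alpha>: "\<alpha> \<in> ext_power 4" "dist (omega_family 1) \<alpha> < e" for \<alpha>
  proof -
    have "\<alpha> \<in> f ` T"
      using e(2) \<alpha>(2) by auto
    then obtain g \<beta> where g: "invertible g" "\<alpha> = ext_map g (omega_family 1) + off \<beta>"
      by (auto simp: T_def f_def)
    \<comment> \<open>\<alpha> and the image of \<open>omega_family 1\<close> are four-forms, so
      \<open>off \<beta>\<close>, which has no component of degree four, must vanish.\<close>
    have "off \<beta> $ S = 0" for S
    proof (cases "card S = 4")
      case False
      then show ?thesis
        using \<alpha>(1) ext_map_ext_power[OF omega_family_ext_power, of g 1] g(2) by (simp add: ext_power_def)
    qed (simp add: off_def)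
    then have "off \<beta> = 0"
      by (simp add: vec_eq_iff)
    with g show ?thesis by auto
  qed
  with e(1) show ?thesis by blast
qed

lemma mpoly_eval_line:
  fixes f :: "('v, complex) mpoly"
  shows "\<exists>q. \<forall>s. poly q s = mpoly_eval (\<lambda>i. a i + s * b i) f"
proof (induction f rule: mpoly_induct)
  case (const c)
  show ?case by (rule exI[of _ "[:c:]"]) simp
next
  case (add f g)
  then obtain q r where "\<forall>s. poly q s = mpoly_eval (\<lambda>i. a i + s * b i) f" "\<forall>s. poly r s = mpoly_eval (\<lambda>i. a i + s * b i) g"
    by blast
  then show ?case by (intro exI[of _ "q + r"]) simp
next
  case (mult_var f i)
  then obtain q where "\<forall>s. poly q s = mpoly_eval (\<lambda>i. a i + s * b i) f"
    by blast
  then show ?case by (intro exI[of _ "q * [:a i, b i:]"]) (simp add: algebra_simps)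
qed

text \<open>The orbit of \<omega> contains all four-forms at which a certain polynomial
  \<open>f\<close> is nonzero. On the line joining \<open>omega_family 1\<close> to \<omega> this
  fails for finitely many parameters only, because it holds at \<omega>. Near
  \<open>omega_family 1\<close> the line also runs inside the other orbit, so the orbits
  coincide.\<close>

lemma nondegenerate_eq_ext_map:
  assumes "nondegenerate \<omega>"
  obtains g where "invertible g" "\<omega> = ext_map g (omega_family 1)"
proof -
  have \<omega>: "\<omega> \<in> ext_power 4" and "zariski_open_in (ext_power 4) {ext_map g \<omega> | g. invertible g}"
    using assms by (auto simp: nondegenerate_def)
  then obtain F where F: "{ext_map g \<omega> | g. invertible g} = {v \<in> ext_power 4. \<exists>f\<in>F. mpoly_eval (($) v) f \<noteq> 0}"
    unfolding zariski_open_in_def by blast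
  have "invertible (mat 1 :: complex ^ 7 ^ 7)"
    by (auto simp: invertible_def intro!: exI[of _ "mat 1"])
  then have "\<omega> \<in> {ext_map g \<omega> | g. invertible g}"
    using ext_map_id[of \<omega>] by (metis (mono_tags, lifting) mem_Collect_eq)
  then obtain f where f: "f \<in> F" "mpoly_eval (($) \<omega>) f \<noteq> 0"
    unfolding F by blast
  define line where "line s = omega_family 1 + s *s (\<omega> - omega_family 1)" for s
  have line: "line s \<in> ext_power 4" for s
    using \<omega> omega_family_ext_power[of 1] by (simp add: line_def ext_power_def)
  obtain q where q: "poly q s = mpoly_eval (($) (line s)) f" for s
  proof -
    obtain q where "\<forall>s. poly q s = mpoly_eval (\<lambda>i. omega_family 1 $ i + s * (\<omega> - omega_family 1) $ i) f"
      using mpoly_eval_line by blast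
    moreover have "($) (line s) = (\<lambda>i. omega_family 1 $ i + s * (\<omega> - omega_family 1) $ i)" for s
      by (simp add: line_def fun_eq_iff algebra_simps)
    ultimately show thesis
      using that[of q] by simp
  qed
  have "line 1 = \<omega>"
    by (simp add: line_def)
  then have "q \<noteq> 0"
    using q[of 1] f(2) by auto
  obtain e where e: "e > 0"
    "\<And>\<alpha>. \<alpha> \<in> ext_power 4 \<Longrightarrow> dist (omega_family 1) \<alpha> < e \<Longrightarrow> \<exists>g. invertible g \<and> \<alpha> = ext_map g (omega_family 1)"
    using orbit_omega_family_neighbourhood by blast
  have "((\<lambda>s. line s) \<longlongrightarrow> line 0) (at 0)"
    unfolding line_def vector_scalar_mult_def by (intro tendsto_intros tendsto_vec_lambda)
  then have "eventually (\<lambda>s. dist (line s) (line 0) < e) (at 0)"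
    using e(1) by (rule tendstoD)
  moreover have "eventually (\<lambda>s. poly q s \<noteq> 0) (at 0)"
  proof -
    \<comment> \<open>\<open>q\<close> may vanish at 0, but only a punctured neighbourhood of 0
      matters.\<close>
    have "open (- ({s. poly q s = 0} - {0}))"
      using poly_roots_finite[OF \<open>q \<noteq> 0\<close>] by (intro open_Compl finite_imp_closed) simp
    then show ?thesis
      unfolding eventually_at_topological by (intro exI[of _ "- ({s. poly q s = 0} - {0})"]) auto
  qed
  ultimately have "eventually (\<lambda>s. dist (line s) (line 0) < e \<and> poly q s \<noteq> 0) (at 0)"
    by (rule eventually_conj)
  then obtain s where s: "dist (line s) (line 0) < e" "poly q s \<noteq> 0"
    using eventually_happens by (metis (mono_tags, lifting) at_neq_bot)
  have "line 0 = omega_family 1"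
    by (simp add: line_def)
  then obtain h where h: "invertible h" "line s = ext_map h (omega_family 1)"
    using e(2)[OF line, of s] s(1) by (auto simp: dist_commute)
  have "line s \<in> {ext_map g \<omega> | g. invertible g}"
    unfolding F using line f(1) s(2) q by auto
  then obtain g where g: "invertible g" "line s = ext_map g \<omega>"
    by blast
  obtain k where k: "invertible k" "\<And>\<alpha>. ext_map k (ext_map g \<alpha>) = \<alpha>"
    using ext_map_inverse[OF g(1)] by metis
  have "\<omega> = ext_map (k ** h) (omega_family 1)"
    using k(2)[of \<omega>] g(2) h(2) by (metis ext_map_comp)
  moreover have "invertible (k ** h)"
    using k(1) h(1) by (simp add: invertible_mult)
  ultimately show thesis
    using that by blast
qed

lemma omega_family_eq_ext_map:
  assumes "t \<noteq> 0"
  obtains g where "invertible g" "omega_family t = ext_map g (omega_family 1)"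
proof -
  \<comment> \<open>In the last monomial of \<open>\<omega>\<^sub>1\<close> all four vectors are
    scaled by \<open>s\<close>, hence a fourth root of \<open>t\<close>.\<close>
  define s where "s = csqrt (csqrt t)"
  have s4: "s ^ 4 = t"
    using power_mult[of s 2 2] by (simp add: s_def)
  then have "s \<noteq> 0"
    using assms by auto
  \<comment> \<open>The exponents solve the linear system saying that \<open>d\<close> fixes the first four monomials of
    \<open>\<omega>\<^sub>1\<close> and multiplies the last one by \<open>s\<^sup>4\<close>.\<close>
  define d where "d = vec_7 s s (inverse s) s s (inverse s) (inverse s)"
  have nz: "d $ i \<noteq> 0" for i
    using \<open>s \<noteq> 0\<close> by (simp add: d_def vec_7_def)
  define g h :: "complex ^ 7 ^ 7" where "g = (\<chi> i j. if i = j then d $ i else 0)"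
    and "h = (\<chi> i j. if i = j then inverse (d $ i) else 0)"
  have "g ** h = mat 1" "h ** g = mat 1"
    using nz by (simp_all add: g_def h_def matrix_matrix_mult_def mat_def vec_eq_iff
        if_distrib[where f = "\<lambda>x. x * _"] cong: if_cong)
  then have "invertible g"
    by (auto simp: invertible_def)
  moreover have g: "g *v axis i 1 = d $ i *s axis i 1" for i
    by (simp add: vec_eq_iff matrix_mult_axis) (simp add: g_def axis_def)
  have axis: "wedge_list (map (\<lambda>i. axis i 1) [a, b, c, d]) = axis {a, b, c, d} 1"
    if "a < b" "b < c" "c < d" for a b c d :: 7
  proof -
    have "a < c" "a < d" "b < d"
      using that by (auto intro: less_trans)
    with that show ?thesis
      by (simp add: axis_insert_min ext_one_def del: ext_vec_axis)
  qed
  have "ext_map g (omega_family 1) = omega_family t"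
    unfolding omega_family_def ext_map_add ext_map_scale ext_map_axis_4
    using axis \<open>s \<noteq> 0\<close> s4
    by (simp add: g ext_vec_scale wedge_scale_left wedge_scale_right d_def field_simps numeral_eq_Suc)
  ultimately show thesis
    using that by metis
qed


section \<open>The flat family\<close>

text \<open>If \<open>S\<close> does not span, the rows of a square matrix made of a basis of its
  span and zero rows do not span either. A nonzero kernel vector of this matrix is a functional
  vanishing on \<open>S\<close>.\<close>

lemma span_UNIV_if_no_functional:
  fixes S :: "(complex ^ 'k::finite) set"
  assumes "\<And>\<beta>. (\<And>z. z \<in> S \<Longrightarrow> (\<Sum>c\<in>UNIV. \<beta> $ c * z $ c) = 0) \<Longrightarrow> \<beta> = 0"
  shows "vec.span S = UNIV"
proof (rule ccontr)
  assume "vec.span S \<noteq> UNIV"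
  obtain B where B: "B \<subseteq> S" "vec.independent B" "S \<subseteq> vec.span B"
    using vec.maximal_independent_subset by blast
  have fin: "finite B" "card B \<le> vec.dim B"
    using vec.independent_bound_general[OF B(2)] by auto
  have "vec.dim B \<le> card (UNIV :: 'k set)"
    using vec.dim_subset[OF subset_UNIV, of B] unfolding vec_dim_card .
  with fin(2) have "card B \<le> card (UNIV :: 'k set)"
    by simp
  then obtain h :: "complex ^ 'k \<Rightarrow> 'k" where h: "inj_on h B"
    using card_le_inj[OF fin(1) finite[of UNIV]] by blast
  define A :: "complex ^ 'k ^ 'k" where "A = (\<chi> i. if i \<in> h ` B then inv_into B h i else 0)"
  have "rows A \<subseteq> insert 0 B"
    by (auto simp: rows_def row_def A_def vec_lambda_eta inv_into_into h)
  then have "vec.span (rows A) \<subseteq> vec.span B"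
    by (metis vec.span_insert_0 vec.span_mono)
  also have "\<dots> \<subseteq> vec.span S"
    by (rule vec.span_mono[OF B(1)])
  finally have "vec.span (rows A) \<noteq> UNIV"
    using \<open>vec.span S \<noteq> UNIV\<close> by auto
  then have "\<not> inj ((*v) A)"
    using matrix_left_invertible_span_rows_gen matrix_left_invertible_injective by blast
  then obtain \<beta> where \<beta>: "A *v \<beta> = 0" "\<beta> \<noteq> 0"
    by (metis matrix_left_invertible_injective matrix_left_invertible_ker)
  have "(\<Sum>c\<in>UNIV. \<beta> $ c * z $ c) = 0" if "z \<in> vec.span B" for z
    using that
  proof (induction rule: vec.span_induct_alt)
    case base
    show ?case by simp
  next
    case (step k b y)
    have "A $ h b = b"
      using step(1) h by (simp add: A_def)
    moreover have "(A *v \<beta>) $ h b = (\<Sum>c\<in>UNIV. A $ h b $ c * \<beta> $ c)"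
      by (simp add: matrix_vector_mult_def)
    ultimately have "(\<Sum>c\<in>UNIV. b $ c * \<beta> $ c) = 0"
      using \<beta>(1) by simp
    moreover have "(\<Sum>c\<in>UNIV. \<beta> $ c * (k *s b + y) $ c) =
        k * (\<Sum>c\<in>UNIV. b $ c * \<beta> $ c) + (\<Sum>c\<in>UNIV. \<beta> $ c * y $ c)"
      by (simp add: sum_distrib_left sum.distrib algebra_simps)
    ultimately show ?case
      using step by simp
  qed
  then have "\<beta> = 0"
    using assms B(3) by blast
  with \<beta>(2) show False by contradiction
qed

lemma monomial_single: "monomial (\<lambda>d. if d = c then 1 else 0) z = z $ c"
proof -
  have "monomial (\<lambda>d. if d = c then 1 else 0) z = (\<Prod>d\<in>UNIV. if d = c then z $ c else 1)"
    unfolding monomial_def by (rule prod.cong) auto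
  then show ?thesis by simp
qed

text \<open>Every coordinate is a standard monomial of degree one, so by independence no nonzero
  linear form vanishes on \<open>G_family t\<close>. This is the source of the dimension 14.\<close>

lemma span_G_family: "vec.span (G_family t) = UNIV"
proof (rule span_UNIV_if_no_functional)
  fix \<beta> :: "complex ^ coord"
  assume \<beta>: "\<And>z. z \<in> G_family t \<Longrightarrow> (\<Sum>c\<in>UNIV. \<beta> $ c * z $ c) = 0"
  define \<delta> :: "coord \<Rightarrow> coord \<Rightarrow> nat" where "\<delta> c = (\<lambda>d. if d = c then 1 else 0)" for c
  have inj: "inj \<delta>"
    by (rule injI) (metis \<delta>_def zero_neq_one)
  have "standard (\<delta> c)" for c
    unfolding standard_def
  proof (rule ballI)
    fix q assume "q \<in> set straightening"
    then show "case q of (a, b, rhs) \<Rightarrow> \<delta> c a = 0 \<or> \<delta> c b = 0"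
      using straightening_distinct[of "fst q" "fst (snd q)" "snd (snd q)"]
      by (auto simp: \<delta>_def split: prod.split)
  qed
  then have sub: "range \<delta> \<subseteq> Collect standard"
    by auto
  have zero: "(\<Sum>m\<in>range \<delta>. \<beta> $ (inv_into UNIV \<delta> m) * monomial m z) = 0" if "z \<in> G_family t" for z
  proof -
    have "(\<Sum>m\<in>range \<delta>. \<beta> $ (inv_into UNIV \<delta> m) * monomial m z) = (\<Sum>c\<in>UNIV. \<beta> $ c * z $ c)"
      by (subst sum.reindex[OF inj]) (simp add: inj monomial_single[of _ z, folded \<delta>_def])
    then show ?thesis
      using \<beta>[OF that] by simp
  qed
  have "\<beta> $ (inv_into UNIV \<delta> (\<delta> c)) = 0" for c
    by (rule standard_monomials_independent[where F = "range \<delta>" and \<beta> = "\<lambda>m. \<beta> $ (inv_into UNIV \<delta> m)" and t = t])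
       (use sub zero in auto)
  then show "\<beta> = 0"
    by (simp add: vec_eq_iff inj)
qed

section \<open>Coordinates on the linear spans\<close>

lemma ext_map_matrix: "\<exists>L :: complex ^ ('m set) ^ ('m::{finite,linorder} set). \<forall>\<alpha>. ext_map g \<alpha> = L *v \<alpha>"
proof -
  have "ext_map g \<alpha> = (\<chi> T S. ext_map g (axis S 1) $ T) *v \<alpha>" for \<alpha> :: "'m ext"
  proof -
    have "ext_map g \<alpha> = ext_map g (\<Sum>S\<in>UNIV. \<alpha> $ S *s axis S 1)"
      by (simp add: basis_expansion)
    also have "\<dots> = (\<chi> T S. ext_map g (axis S 1) $ T) *v \<alpha>"
      by (simp add: ext_map_sum ext_map_scale matrix_vector_mult_def vec_eq_iff mult.commute)
    finally show ?thesis .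
  qed
  then show ?thesis by blast
qed

lemma span_form_matrix: "\<exists>L :: complex ^ coord ^ (7 set). \<forall>z. span_form t z = L *v z"
proof -
  have sum: "span_form t (\<Sum>i\<in>I. f i) = (\<Sum>i\<in>I. span_form t (f i))" for I :: "coord set" and f
    by (induction I rule: infinite_finite_induct) (simp_all add: span_form_add)
  have "span_form t z = (\<chi> T c. span_form t (axis c 1) $ T) *v z" for z
  proof -
    have "span_form t z = span_form t (\<Sum>c\<in>UNIV. z $ c *s axis c 1)"
      by (simp add: basis_expansion)
    also have "\<dots> = (\<chi> T c. span_form t (axis c 1) $ T) *v z"
      by (simp add: sum span_form_scale matrix_vector_mult_def vec_eq_iff mult.commute)
    finally show ?thesis .
  qed
  then show ?thesis by blast
qed

lemma G_var_omega_family: "G_var (omega_family t) = span_form t ` G_family t"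
proof
  show "G_var (omega_family t) \<subseteq> span_form t ` G_family t"
  proof
    fix \<alpha> assume \<alpha>: "\<alpha> \<in> G_var (omega_family t)"
    then obtain v w where vw: "\<alpha> = ext_vec v \<^bold>\<and> ext_vec w" "\<alpha> \<^bold>\<and> omega_family t = 0"
      by (auto simp: G_var_def)
    have "\<alpha> \<in> ext_power 2"
      using wedge_ext_power[OF ext_vec_ext_power[of v] ext_vec_ext_power[of w]] vw(1)
      by (simp add: numeral_2_eq_2)
    from span_form_form_coords[OF this vw(2)] show "\<alpha> \<in> span_form t ` G_family t"
      using \<alpha> by (metis G_family_def image_eqI mem_Collect_eq)
  qed
qed (auto simp: G_family_def)

text \<open>Combines the change of basis with \<open>span_form t\<close> into one matrix, the shape
  that the comparison with \<open>coordinates_of_span\<close> requires.\<close>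

lemma G_var_coordinates:
  assumes "invertible g"
  obtains \<Phi> :: "complex ^ coord ^ (7 set)" where "inj ((*v) \<Phi>)"
    "G_var (ext_map g (omega_family t)) = (*v) \<Phi> ` G_family t"
proof -
  obtain L :: "complex ^ (7 set) ^ (7 set)" where L: "\<And>\<alpha>. ext_map g \<alpha> = L *v \<alpha>"
    using ext_map_matrix by blast
  obtain L' :: "complex ^ coord ^ (7 set)" where L': "\<And>z. span_form t z = L' *v z"
    using span_form_matrix by blast
  have \<Phi>: "(L ** L') *v z = ext_map g (span_form t z)" for z
    by (simp add: L L' matrix_vector_mul_assoc)
  obtain h where "\<And>\<alpha>. ext_map h (ext_map g \<alpha>) = \<alpha>"
    using ext_map_inverse[OF assms] by metis
  then have "inj ((*v) (L ** L'))"
    by (metis \<Phi> form_coords_span_form injI)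
  moreover have "G_var (ext_map g (omega_family t)) = (*v) (L ** L') ` G_family t"
    by (simp add: G_var_ext_map[OF assms] G_var_omega_family image_image \<Phi>)
  ultimately show thesis
    using that by blast
qed

lemma span_matrix_image:
  fixes \<Phi> :: "complex ^ 'k::finite ^ 'l::finite"
  assumes "vec.span K = UNIV"
  shows "vec.span ((*v) \<Phi> ` K) = range ((*v) \<Phi>)"
  using vec.linear_span_image[OF matrix_vector_mul_linear_gen, of \<Phi> K] assms by simp

lemma dim_matrix_image:
  fixes \<Phi> :: "complex ^ 'k::finite ^ 'l::finite"
  assumes "vec.span K = UNIV" "inj ((*v) \<Phi>)"
  shows "vec.dim ((*v) \<Phi> ` K) = CARD('k)"
proof -
  have "vec.dim ((*v) \<Phi> ` K) = vec.dim K"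
    using vec.dim_image_eq[OF matrix_vector_mul_linear_gen] assms(2) by (metis inj_on_subset subset_UNIV)
  also have "\<dots> = CARD('k)"
    by (metis vec.dim_span assms(1) vec_dim_card)
  finally show ?thesis .
qed

text \<open>\<open>M\<close> and \<Phi> are injective and have the same range, the span, so they
  differ by an isomorphism of their sources. Left inverses of both matrices make it
  explicit.\<close>

lemma coordinate_change:
  fixes \<Phi> :: "complex ^ 'k::finite ^ 'l::finite" and M :: "complex ^ 'n::finite ^ 'l"
  assumes "vec.span K = UNIV" "inj ((*v) \<Phi>)" "coordinates_of_span M ((*v) \<Phi> ` K)"
  obtains A :: "complex ^ 'n ^ 'k" and A' :: "complex ^ 'k ^ 'n" where
    "\<And>x. A' *v (A *v x) = x" "\<And>z. A *v (A' *v z) = z" "(*v) M -` ((*v) \<Phi> ` K) = {x. A *v x \<in> K}"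
proof -
  have M: "inj ((*v) M)" "range ((*v) M) = range ((*v) \<Phi>)"
    using assms(3) by (simp_all add: coordinates_of_span_def span_matrix_image[OF assms(1)])
  obtain \<Psi> where \<Psi>: "\<Psi> ** \<Phi> = mat 1"
    using assms(2) matrix_left_invertible_injective by blast
  obtain \<Psi>' where \<Psi>': "\<Psi>' ** M = mat 1"
    using M(1) matrix_left_invertible_injective by blast
  have \<Phi>: "\<Phi> *v ((\<Psi> ** M) *v x) = M *v x" for x
  proof -
    obtain z where "M *v x = \<Phi> *v z"
      using M(2) by blast
    then show ?thesis
      by (metis \<Psi> matrix_vector_mul_assoc matrix_vector_mul_lid)
  qed
  have M': "M *v ((\<Psi>' ** \<Phi>) *v z) = \<Phi> *v z" for z
  proof -
    obtain x where "\<Phi> *v z = M *v x"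
      using M(2) by blast
    then show ?thesis
      by (metis \<Psi>' matrix_vector_mul_assoc matrix_vector_mul_lid)
  qed
  show thesis
  proof
    show "(\<Psi>' ** \<Phi>) *v ((\<Psi> ** M) *v x) = x" for x
      by (metis \<Phi> M' M(1) injD)
    show "(\<Psi> ** M) *v ((\<Psi>' ** \<Phi>) *v z) = z" for z
      by (metis \<Phi> M' assms(2) injD)
    show "(*v) M -` ((*v) \<Phi> ` K) = {x. (\<Psi> ** M) *v x \<in> K}"
      unfolding set_eq_iff
      by (simp only: vimage_eq \<Phi>[symmetric] inj_image_mem_iff[OF assms(2)] mem_Collect_eq) blast
  qed
qed

text \<open>Carries the basis from the coordinates indexed by \<open>coord\<close> to arbitrary
  coordinates on the span: \<open>e m\<close> is the standard monomial \<open>m\<close> in the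
  linear forms given by the rows of \<open>A\<close>.\<close>

lemma based_family_G_family:
  fixes A :: "complex ^ 'n::finite ^ coord" and A' :: "complex ^ coord ^ 'n"
  assumes A: "\<And>x. A' *v (A *v x) = x" "\<And>z. A *v (A' *v z) = z"
  defines "e \<equiv> \<lambda>m. \<Prod>c\<in>UNIV. (\<Sum>i\<in>UNIV. mpoly_const (A $ c $ i) * mpoly_var i) ^ m c"
  shows "based_family (\<lambda>t. {x. A *v x \<in> G_family t}) e (Collect standard)"
proof
  have e: "mpoly_eval (($) x) (e m) = monomial m (A *v x)" for x m
    by (simp add: e_def monomial_def matrix_vector_mult_def)
  show "complex_cone {x. A *v x \<in> G_family t}" for t
    using complex_cone_G_family[of t] by (auto simp: complex_cone_def vector_scalar_commute)
  show "\<exists>F r. finite F \<and> F \<subseteq> Collect standard \<and> (\<forall>t. \<forall>x\<in>{x. A *v x \<in> G_family t}.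
      family_eval (line_point t) (($) x) f = (\<Sum>m\<in>F. poly (r m) t * mpoly_eval (($) x) (e m)))" for f
  proof -
    \<comment> \<open>In terms of \<open>z\<close>, multiplication by a variable is a constant
      combination of multiplications by coordinates, under which \<open>standard_span\<close> is
      closed.\<close>
    have "(\<lambda>t z. family_eval (line_point t) (($) (A' *v z)) f) \<in> standard_span"
    proof (induction f rule: mpoly_induct)
      case (const a)
      have "(\<lambda>t z. poly (line_poly a) t * monomial (\<lambda>_. 0) z) \<in> standard_span"
        by (rule standard_span_mult_poly[OF monomial_in_standard_span])
      then show ?case
        by (rule standard_span_cong) (simp add: poly_line_poly monomial_def)
    next
      case (add f g)
      then show ?case
        by (simp add: standard_span_add)
    next
      case (mult_var f i)
      let ?h = "\<lambda>t z. family_eval (line_point t) (($) (A' *v z)) f"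
      have "(\<lambda>t z. \<Sum>c\<in>UNIV. poly [:A' $ i $ c:] t * (z $ c * ?h t z)) \<in> standard_span"
        by (intro standard_span_sum standard_span_mult_poly standard_span_mult_coord mult_var)
      then show ?case
      proof (rule standard_span_cong)
        fix t z
        have "(A' *v z) $ i = (\<Sum>c\<in>UNIV. A' $ i $ c * z $ c)"
          by (simp add: matrix_vector_mult_def)
        then show "family_eval (line_point t) (($) (A' *v z)) (f * mpoly_var i) =
            (\<Sum>c\<in>UNIV. poly [:A' $ i $ c:] t * (z $ c * ?h t z))"
          by (simp add: sum_distrib_left mult_ac)
      qed
    qed
    then obtain F r where F: "finite F" "F \<subseteq> Collect standard" and
      r: "\<And>t z. z \<in> G_family t \<Longrightarrow> family_eval (line_point t) (($) (A' *v z)) f = (\<Sum>m\<in>F. poly (r m) t * monomial m z)"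
      unfolding standard_span_def by blast
    have "family_eval (line_point t) (($) x) f = (\<Sum>m\<in>F. poly (r m) t * mpoly_eval (($) x) (e m))"
      if "A *v x \<in> G_family t" for t x
      using r[OF that] by (simp add: A(1) e)
    with F show ?thesis
      by (intro exI[of _ F] exI[of _ r]) simp
  qed
  show "\<beta> m = 0" if F: "finite F" "F \<subseteq> Collect standard" and "m \<in> F"
    and zero: "\<And>x. x \<in> {x. A *v x \<in> G_family t} \<Longrightarrow> (\<Sum>m\<in>F. \<beta> m * mpoly_eval (($) x) (e m)) = 0"
    for F t \<beta> m
  proof (rule standard_monomials_independent[OF F _ \<open>m \<in> F\<close>])
    fix z assume "z \<in> G_family t"
    then show "(\<Sum>m\<in>F. \<beta> m * monomial m z) = 0"
      using zero[of "A' *v z"] by (simp add: e A(2))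
  qed
qed

theorem lemma3p14:
  fixes x :: "nat \<Rightarrow> complex ^ 7" and \<omega> :: "7 ext"
  assumes "is_basis x" and "nondegenerate \<omega>"
  shows "vec.dim (G_var (omega0 x)) = 14 \<and> vec.dim (G_var \<omega>) = 14 \<and>
    (\<forall>(M :: complex ^ 14 ^ (7 set)) (N :: complex ^ 14 ^ (7 set)).
      coordinates_of_span M (G_var (omega0 x)) \<and> coordinates_of_span N (G_var \<omega>) \<longrightarrow>
      flat_deformation ((*v) M -` G_var (omega0 x)) ((*v) N -` G_var \<omega>))"
proof (intro conjI allI impI; (elim conjE)?)
  obtain g where g: "invertible g" "omega0 x = ext_map g (omega_family 0)"
    using omega0_eq_ext_map[OF assms(1)] .
  obtain \<Phi> where \<Phi>: "inj ((*v) \<Phi>)" "G_var (omega0 x) = (*v) \<Phi> ` G_family 0"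
    using G_var_coordinates[OF g(1), of 0] g(2) by metis
  obtain k where k: "invertible k" "\<omega> = ext_map k (omega_family 1)"
    using nondegenerate_eq_ext_map[OF assms(2)] .
  \<comment> \<open>\<omega> is equivalent to \<open>\<omega>\<^sub>t\<close> for every nonzero
    \<open>t\<close>, so its variety is a linear image of each of these fibres; the matrix depends
    on \<open>t\<close>.\<close>
  have \<omega>: "\<exists>\<Phi>. inj ((*v) \<Phi>) \<and> G_var \<omega> = (*v) \<Phi> ` G_family t" if t: "t \<noteq> 0" for t
  proof -
    obtain h where h: "invertible h" "omega_family t = ext_map h (omega_family 1)"
      using omega_family_eq_ext_map[OF t] .
    obtain h' where h': "invertible h'" "\<And>\<alpha>. ext_map h' (ext_map h \<alpha>) = \<alpha>"
      using ext_map_inverse[OF h(1)] by metis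
    have "\<omega> = ext_map (k ** h') (omega_family t)"
      by (simp add: ext_map_comp[symmetric] h(2) h'(2) k(2))
    then show ?thesis
      using G_var_coordinates[OF invertible_mult[OF k(1) h'(1)], of t] by metis
  qed
  have card: "CARD(coord) = 14"
    by (simp add: UNIV_coord)
  show "vec.dim (G_var (omega0 x)) = 14"
    using dim_matrix_image[OF span_G_family \<Phi>(1)] \<Phi>(2) card by simp
  show "vec.dim (G_var \<omega>) = 14"
    using \<omega>[of 1] dim_matrix_image[OF span_G_family] card by force
  fix M N :: "complex ^ 14 ^ (7 set)"
  assume M: "coordinates_of_span M (G_var (omega0 x))" and N: "coordinates_of_span N (G_var \<omega>)"
  \<comment> \<open>The coordinates chosen by \<open>M\<close> at the special fibre serve for the
    whole family, through their identification \<open>A\<close> with the coordinates of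
    \<open>span_form\<close>.\<close>
  obtain A A' where A: "\<And>x. A' *v (A *v x) = x" "\<And>z. A *v (A' *v z) = z"
    and M_eq: "(*v) M -` G_var (omega0 x) = {x. A *v x \<in> G_family 0}"
    using coordinate_change[OF span_G_family \<Phi>(1), where M = M] M unfolding \<Phi>(2) by metis
  interpret based_family "\<lambda>t. {x. A *v x \<in> G_family t}"
    "\<lambda>m. \<Prod>c\<in>UNIV. (\<Sum>i\<in>UNIV. mpoly_const (A $ c $ i) * mpoly_var i) ^ m c" "Collect standard"
    by (rule based_family_G_family[OF A])
  show "flat_deformation ((*v) M -` G_var (omega0 x)) ((*v) N -` G_var \<omega>)"
    unfolding M_eq
  proof (rule flat_deformation)
    fix t :: complex assume "t \<noteq> 0"
    then obtain \<Phi>' where \<Phi>': "inj ((*v) \<Phi>')" "G_var \<omega> = (*v) \<Phi>' ` G_family t"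
      using \<omega> by blast
    \<comment> \<open>\<open>C\<close> compares the coordinates chosen by \<open>N\<close> with
      those of the fibre over \<open>t\<close>; followed by \<open>A'\<close> it carries the variety
      of \<omega> onto this fibre.\<close>
    obtain C C' where C: "\<And>x. C' *v (C *v x) = x" "\<And>z. C *v (C' *v z) = z"
      and N_eq: "(*v) N -` G_var \<omega> = {x. C *v x \<in> G_family t}"
      using coordinate_change[OF span_G_family \<Phi>'(1), where M = N] N unfolding \<Phi>'(2) by metis
    have "(A' ** C) ** (C' ** A) = mat 1" "(C' ** A) ** (A' ** C) = mat 1"
      unfolding matrix_eq by (simp_all add: matrix_vector_mul_assoc[symmetric] A C)
    then have "invertible (A' ** C)"
      by (auto simp: invertible_def)
    moreover have "{x. A *v x \<in> G_family t} = (*v) (A' ** C) ` ((*v) N -` G_var \<omega>)"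
    proof -
      have "x \<in> (*v) (A' ** C) ` {x. C *v x \<in> G_family t}" if "A *v x \<in> G_family t" for x
        using that by (intro image_eqI[of _ _ "C' *v (A *v x)"]) (simp_all add: matrix_vector_mul_assoc[symmetric] A C)
      then show ?thesis
        unfolding N_eq by (auto simp: matrix_vector_mul_assoc[symmetric] A)
    qed
    ultimately show "\<exists>g :: complex ^ 14 ^ 14. invertible g \<and>
        {x. A *v x \<in> G_family t} = (*v) g ` ((*v) N -` G_var \<omega>)"
      by blast
  qed
qed

end
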